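(* Let $A$ be an abelian variety over a perfect field $k$ and let $n\geq 1$ be an integer. Let $n_\star:\mathrm{CH}_0(A)\to\mathrm{CH}_0(A)$ be the push-forward induced by the multiplication-by-$n$ map $A\to A$. Then for every $r\geq 0$ the homomorphism $F^r(A)/F^{r+1}(A)\to F^r(A)/F^{r+1}(A)$ induced by $n_\star$ is multiplication by $n^r$.
   Context: **Somekawa $K$-group.** Let $A_1,\ldots,A_r$ be abelian varieties over $k$. For finite extensions $K\subset L$ of $k$ there are restriction maps $\mathrm{res}_{L/K}:A_i(K)\to A_i(L)$ and norm (trace) maps $N_{L/K}:A_i(L)\to A_i(K)$. The Mackey product $(A_1\otimes^M\cdots\otimes^M A_r)(k)$ is the quotient of $\bigoplus_{L/k\text{ finite}}A_1(L)\otimes_{\mathbb Z}\cdots\otimes_{\mathbb Z} A_r(L)$ by the projection formula relations; writing $\{a_1,\ldots,a_r\}_{L/k}$ for the class of $a_1\otimes\cdots\otimes a_r$ with $a_i\in A_i(L)$, these are: for every tower of finite extensions $k\subset K\subset L$ (with $K\to L$ any $k$-embedding), every $i$, every $a_i\in A_i(L)$ and $a_j\in A_j(K)$ for $j\neq i$, $\{\mathrm{res}_{L/K}(a_1),\ldots,a_i,\ldots,\mathrm{res}_{L/K}(a_r)\}_{L/k}=\{a_1,\ldots,N_{L/K}(a_i),\ldots,a_r\}_{K/k}$. The Somekawa $K$-group $K(k;A_1,\ldots,A_r)$ is the quotient of the Mackey product by Weil reciprocity: for every smooth projective curve $C$ over $k$, all regular maps $g_i:C\to A_i$ ($i=1,\ldots,r$)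 and every $f\in k(C)^\times$, $\sum_{x}\mathrm{ord}_x(f)\{g_1\circ\iota_x,\ldots,g_r\circ\iota_x\}_{k(x)/k}=0$, the sum being over closed points $x$ of $C$, with $\iota_x:\mathrm{Spec}\,k(x)\to C$ the canonical inclusion. **Symmetric quotient.** For an abelian variety $A$ and $r\geq 1$, $K_r(k;A)=K(k;A,\ldots,A)$ ($r$ copies) and $S_r(k;A)$ is the quotient of $K_r(k;A)$ by the action of the symmetric group $\Sigma_r$ permuting entries of symbols. Set $K_0(k;A)=S_0(k;A)=\mathbb Z$. **The filtration $F^r(A)$.** For every $r\geq 0$ there is a well-defined homomorphism $\Phi_r:\mathrm{CH}_0(A)\to S_r(k;A)$ sending the class $[a]$ of a closed point $a$ with residue field $k(a)$ to $\{a,\ldots,a\}_{k(a)/k}$ (for $r=0$ it is the degree map). Set $F^0(A)=\mathrm{CH}_0(A)$ and $F^r(A)=\bigcap_{j=0}^{r-1}\ker(\Phi_j)$ for $r\geq 1$. The push-forward $n_\star$ preserves this filtration. *)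

theory Defs
  imports
    "HOL-Algebra.Algebra"
    "HOL-Algebra.Algebraic_Closure_Type"
    "HOL-Algebra.Free_Abelian_Groups"
    "HOL-Combinatorics.Permutations"
    "HOL-Library.Function_Algebras"
    "HOL-Library.FuncSet"
begin

text \<open>
  Varieties over a perfect field \<open>k\<close> are described by their points over the algebraic closure:
  a projective (reduced) variety over \<open>k\<close> is a subset of projective space over the algebraic closure
  that is cut out by forms with coefficients in \<open>k\<close>, a \<open>k\<close>-morphism is a map of such point sets
  that is locally given by forms with coefficients in \<open>k\<close>, and closed points are Galois orbits.
\<close>


section \<open>Fields\<close>

text \<open>\<open>k\<close> is perfect if every irreducible polynomial over \<open>k\<close> is separable.\<close>

definition perfect_field :: "'k::field itself \<Rightarrow> bool" where
  "perfect_field _ \<longleftrightarrow>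
     (\<forall>p :: 'k poly. Factorial_Ring.irreducible p \<longrightarrow> rsquarefree (map_poly to_ac p))"

abbreviation kbar :: "'k::field alg_closure ring" where
  "kbar \<equiv> ring_of_type_algebra"

definition base :: "'k::field alg_closure set" where
  "base = range to_ac"

text \<open>
  Finite extensions of \<open>k\<close>, realised inside the algebraic closure. Every finite extension is
  isomorphic to one of these; the inclusion carries no information, since below all
  \<open>k\<close>-embeddings between such fields are used.
\<close>

definition finite_ext :: "'k::field alg_closure set \<Rightarrow> bool" where
  "finite_ext L \<longleftrightarrow> subfield L kbar \<and> base \<subseteq> L \<and> ring.finite_dimension kbar base L"

definition ext_degree :: "'k::field alg_closure set \<Rightarrow> 'k alg_closure set \<Rightarrow> nat" where
  "ext_degree K L = ring.dim kbar K L"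

definition embeddings ::
  "'k::field alg_closure set \<Rightarrow> 'k alg_closure set \<Rightarrow> ('k alg_closure \<Rightarrow> 'k alg_closure) set" where
  "embeddings K L =
     {\<sigma> \<in> extensional K. \<sigma> \<in> ring_hom (kbar\<lparr>carrier := K\<rparr>) (kbar\<lparr>carrier := L\<rparr>) \<and> (\<forall>c\<in>base. \<sigma> c = c)}"

definition galois_group :: "('k::field alg_closure \<Rightarrow> 'k alg_closure) set" where
  "galois_group = {\<sigma> \<in> ring_iso kbar kbar. \<forall>c\<in>base. \<sigma> c = c}"


section \<open>Projective varieties\<close>

text \<open>
  A point of \<open>N\<close>-dimensional projective space is represented by its unique homogeneous coordinate
  vector whose first nonzero entry is \<open>1\<close>, extended by \<open>0\<close> beyond index \<open>N\<close>. Hence its coordinates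
  generate its residue field, and field embeddings act coordinatewise.
\<close>

type_synonym 'k point = "nat \<Rightarrow> 'k alg_closure"

definition proj_space :: "nat \<Rightarrow> 'k::field point set" where
  "proj_space N = {x. (\<forall>i>N. x i = 0) \<and> (\<exists>i. x i \<noteq> 0) \<and> x (LEAST i. x i \<noteq> 0) = 1}"

definition proj_class :: "nat \<Rightarrow> (nat \<Rightarrow> 'k::field alg_closure) \<Rightarrow> 'k point" where
  "proj_class N v = (\<lambda>i. if i \<le> N then v i / v (LEAST i. v i \<noteq> 0) else 0)"

type_synonym 'k mpoly = "(nat \<Rightarrow>\<^sub>0 nat) \<Rightarrow>\<^sub>0 'k alg_closure"

definition eval_mpoly :: "'k::field mpoly \<Rightarrow> (nat \<Rightarrow> 'k alg_closure) \<Rightarrow> 'k alg_closure" where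
  "eval_mpoly p x =
     (\<Sum>m\<in>Poly_Mapping.keys p. Poly_Mapping.lookup p m *
        (\<Prod>i\<in>Poly_Mapping.keys m. x i ^ Poly_Mapping.lookup m i))"

definition eval_partial :: "nat \<Rightarrow> 'k::field mpoly \<Rightarrow> (nat \<Rightarrow> 'k alg_closure) \<Rightarrow> 'k alg_closure" where
  "eval_partial i p x =
     (\<Sum>m\<in>Poly_Mapping.keys p. Poly_Mapping.lookup p m *
        (of_nat (Poly_Mapping.lookup m i) * x i ^ (Poly_Mapping.lookup m i - 1) *
         (\<Prod>j\<in>Poly_Mapping.keys m - {i}. x j ^ Poly_Mapping.lookup m j)))"

text \<open>Forms of degree \<open>d\<close> in the variables \<open>0, \<dots>, N\<close> with coefficients in \<open>K\<close>.\<close>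

definition forms :: "'k::field alg_closure set \<Rightarrow> nat \<Rightarrow> nat \<Rightarrow> 'k mpoly set" where
  "forms K N d =
     {p. range (Poly_Mapping.lookup p) \<subseteq> K \<and>
         (\<forall>m\<in>Poly_Mapping.keys p. Poly_Mapping.keys m \<subseteq> {..N} \<and>
            (\<Sum>i\<in>Poly_Mapping.keys m. Poly_Mapping.lookup m i) = d)}"

definition zariski_closed :: "'k::field alg_closure set \<Rightarrow> nat \<Rightarrow> 'k point set \<Rightarrow> bool" where
  "zariski_closed K N V \<longleftrightarrow>
     (\<exists>P. P \<subseteq> (\<Union>d. forms K N d) \<and> V = {x \<in> proj_space N. \<forall>p\<in>P. eval_mpoly p x = 0})"

definition irreducible_closed :: "'k::field alg_closure set \<Rightarrow> nat \<Rightarrow> 'k point set \<Rightarrow> bool" where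
  "irreducible_closed K N V \<longleftrightarrow> zariski_closed K N V \<and> V \<noteq> {} \<and>
     (\<forall>Y Z. zariski_closed K N Y \<and> zariski_closed K N Z \<and> V \<subseteq> Y \<union> Z \<longrightarrow> V \<subseteq> Y \<or> V \<subseteq> Z)"

text \<open>Krull dimension (of the scheme over \<open>k\<close>, i.e. for the topology of \<open>k\<close>-closed subsets).\<close>

definition krull_dim :: "nat \<Rightarrow> 'k::field point set \<Rightarrow> nat" where
  "krull_dim N V =
     Sup {d. \<exists>Z. (\<forall>i\<le>d. irreducible_closed base N (Z i) \<and> Z i \<subseteq> V) \<and> (\<forall>i<d. Z i \<subset> Z (Suc i))}"

text \<open>
  The tangent space at \<open>x\<close> of the affine cone over \<open>V\<close>; by Euler's relation it contains the line \<open>x\<close>,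
  and its quotient by that line is the Zariski tangent space of \<open>V\<close> at \<open>x\<close>. As \<open>k\<close> is perfect, the
  forms over \<open>k\<close> vanishing on \<open>V\<close> generate the ideal of all forms vanishing on \<open>V\<close>.
\<close>

definition cone_tangent_space ::
  "nat \<Rightarrow> 'k::field point set \<Rightarrow> 'k point \<Rightarrow> (nat \<Rightarrow> 'k alg_closure) set" where
  "cone_tangent_space N V x =
     {v. (\<forall>i>N. v i = 0) \<and>
         (\<forall>d. \<forall>p\<in>forms base N d. (\<forall>y\<in>V. eval_mpoly p y = 0) \<longrightarrow>
            (\<Sum>i\<le>N. eval_partial i p x * v i) = 0)}"

text \<open>Jacobian criterion, for \<open>V\<close> irreducible over \<open>k\<close> (hence equidimensional).\<close>

definition smooth_variety :: "nat \<Rightarrow> 'k::field point set \<Rightarrow> bool" where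
  "smooth_variety N V \<longleftrightarrow>
     (\<forall>x\<in>V. vector_space.dim (\<lambda>c v i. c * v i) (cone_tangent_space N V x) = krull_dim N V + 1)"

text \<open>
  The forms are only required to describe \<open>\<phi>\<close> on the open set where they do not all vanish. Any
  description on a smaller open neighbourhood of \<open>x\<close> takes this shape after multiplying by a form
  that does not vanish at \<open>x\<close> but vanishes off that neighbourhood.
\<close>

definition regular_map ::
  "nat \<Rightarrow> 'k::field point set \<Rightarrow> nat \<Rightarrow> 'k point set \<Rightarrow> ('k point \<Rightarrow> 'k point) \<Rightarrow> bool" where
  "regular_map N V M Y \<phi> \<longleftrightarrow> \<phi> \<in> V \<rightarrow> Y \<and>
     (\<forall>x\<in>V. \<exists>d F. (\<forall>j\<le>M. F j \<in> forms base N d) \<and> (\<exists>j\<le>M. eval_mpoly (F j) x \<noteq> 0) \<and>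
        (\<forall>y\<in>V. (\<exists>j\<le>M. eval_mpoly (F j) y \<noteq> 0) \<longrightarrow>
           \<phi> y = proj_class M (\<lambda>j. eval_mpoly (F j) y)))"

text \<open>
  The Segre embedding into projective space of dimension \<open>(N + 1) * (M + 1) - 1\<close>, where \<open>M\<close> is the
  dimension of the second factor. It maps normalised vectors to normalised vectors.
\<close>

definition segre :: "nat \<Rightarrow> 'k::field point \<Rightarrow> 'k point \<Rightarrow> 'k point" where
  "segre M x y = (\<lambda>i. x (i div (M + 1)) * y (i mod (M + 1)))"


section \<open>Closed points and zero-cycles\<close>

definition residue_field :: "'k::field point \<Rightarrow> 'k alg_closure set" where
  "residue_field x = generate_field kbar (base \<union> range x)"

definition closed_point :: "'k::field point \<Rightarrow> 'k point set" where
  "closed_point x = (\<lambda>\<sigma>. \<sigma> \<circ> x) ` galois_group"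

definition closed_points :: "'k::field point set \<Rightarrow> 'k point set set" where
  "closed_points V = closed_point ` V"

text \<open>
  A geometric point over the closed point \<open>c\<close>; choosing it means choosing a \<open>k\<close>-embedding of the
  residue field of \<open>c\<close> into the algebraic closure.
\<close>

definition geom_pt :: "'k::field point set \<Rightarrow> 'k point" where
  "geom_pt c = (SOME x. x \<in> c)"

type_synonym 'k cycle = "'k point set \<Rightarrow>\<^sub>0 int"

definition zero_cycles :: "'k::field point set \<Rightarrow> 'k cycle monoid" where
  "zero_cycles V = free_Abelian_group (closed_points V)"

definition cycle_degree :: "'k::field cycle \<Rightarrow> int" where
  "cycle_degree z =
     (\<Sum>c\<in>Poly_Mapping.keys z.
        Poly_Mapping.lookup z c * int (ext_degree base (residue_field (geom_pt c))))"

definition push_cycle :: "('k::field point \<Rightarrow> 'k point) \<Rightarrow> 'k cycle \<Rightarrow> 'k cycle" where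
  "push_cycle g =
     frag_extend (\<lambda>c. let x = geom_pt c in
       frag_cmul (int (ext_degree (residue_field (g x)) (residue_field x)))
         (frag_of (closed_point (g x))))"


section \<open>Curves and principal divisors\<close>

text \<open>Smooth projective curves, integral over \<open>k\<close> but not necessarily geometrically irreducible.\<close>

definition smooth_proj_curve :: "nat \<Rightarrow> 'k::field point set \<Rightarrow> bool" where
  "smooth_proj_curve M C \<longleftrightarrow>
     irreducible_closed base M C \<and> krull_dim M C = 1 \<and> smooth_variety M C"

text \<open>
  A nonzero rational function on \<open>C\<close> is a fraction of two forms of the same degree, neither of which
  vanishes identically on \<open>C\<close>. Two fractions represent the same function iff \<open>frac_eq\<close> holds.
\<close>

type_synonym 'k frac = "'k mpoly \<times> 'k mpoly"

definition nonzero_on :: "'k::field point set \<Rightarrow> 'k mpoly \<Rightarrow> bool" where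
  "nonzero_on C p \<longleftrightarrow> (\<exists>y\<in>C. eval_mpoly p y \<noteq> 0)"

definition rat_functions_nz :: "nat \<Rightarrow> 'k::field point set \<Rightarrow> 'k frac set" where
  "rat_functions_nz M C =
     {(p, q). (\<exists>d. p \<in> forms base M d \<and> q \<in> forms base M d) \<and> nonzero_on C p \<and> nonzero_on C q}"

definition frac_eq :: "'k::field point set \<Rightarrow> 'k frac \<Rightarrow> 'k frac \<Rightarrow> bool" where
  "frac_eq C f g \<longleftrightarrow>
     (\<forall>y\<in>C. eval_mpoly (fst f) y * eval_mpoly (snd g) y = eval_mpoly (fst g) y * eval_mpoly (snd f) y)"

text \<open>Membership in the local ring at \<open>x\<close>, its maximal ideal, and its units, for nonzero functions.\<close>

definition in_local_ring :: "nat \<Rightarrow> 'k::field point set \<Rightarrow> 'k point \<Rightarrow> 'k frac \<Rightarrow> bool" where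
  "in_local_ring M C x f \<longleftrightarrow>
     (\<exists>g\<in>rat_functions_nz M C. frac_eq C f g \<and> eval_mpoly (snd g) x \<noteq> 0)"

definition in_max_ideal :: "nat \<Rightarrow> 'k::field point set \<Rightarrow> 'k point \<Rightarrow> 'k frac \<Rightarrow> bool" where
  "in_max_ideal M C x f \<longleftrightarrow>
     (\<exists>g\<in>rat_functions_nz M C. frac_eq C f g \<and> eval_mpoly (snd g) x \<noteq> 0 \<and> eval_mpoly (fst g) x = 0)"

definition is_local_unit :: "nat \<Rightarrow> 'k::field point set \<Rightarrow> 'k point \<Rightarrow> 'k frac \<Rightarrow> bool" where
  "is_local_unit M C x f \<longleftrightarrow>
     (\<exists>g\<in>rat_functions_nz M C. frac_eq C f g \<and> eval_mpoly (snd g) x \<noteq> 0 \<and> eval_mpoly (fst g) x \<noteq> 0)"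

definition frac_mult :: "'k::field frac \<Rightarrow> 'k frac \<Rightarrow> 'k frac" where
  "frac_mult f g = (fst f * fst g, snd f * snd g)"

definition frac_powi :: "'k::field frac \<Rightarrow> int \<Rightarrow> 'k frac" where
  "frac_powi f n =
     (fst f ^ nat n * snd f ^ nat (- n), snd f ^ nat n * fst f ^ nat (- n))"

definition uniformizer :: "nat \<Rightarrow> 'k::field point set \<Rightarrow> 'k point \<Rightarrow> 'k frac \<Rightarrow> bool" where
  "uniformizer M C x t \<longleftrightarrow> t \<in> rat_functions_nz M C \<and> in_max_ideal M C x t \<and>
     (\<forall>f\<in>rat_functions_nz M C. in_max_ideal M C x f \<longrightarrow>
        in_local_ring M C x (frac_mult f (frac_powi t (- 1))))"

definition ord_at :: "nat \<Rightarrow> 'k::field point set \<Rightarrow> 'k point \<Rightarrow> 'k frac \<Rightarrow> int" where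
  "ord_at M C x f =
     (THE n. \<exists>t. uniformizer M C x t \<and> is_local_unit M C x (frac_mult f (frac_powi t (- n))))"

definition principal_divisor :: "nat \<Rightarrow> 'k::field point set \<Rightarrow> 'k frac \<Rightarrow> 'k cycle" where
  "principal_divisor M C f =
     (\<Sum>c\<in>{c \<in> closed_points C. ord_at M C (geom_pt c) f \<noteq> 0}.
        frag_cmul (ord_at M C (geom_pt c) f) (frag_of c))"


section \<open>Abelian varieties\<close>

text \<open>The group structure is the one on the points over the algebraic closure, written multiplicatively.\<close>

record ('k::field) abvar = "'k point monoid" +
  ambient :: nat

definition abelian_variety :: "'k::field abvar \<Rightarrow> bool" where
  "abelian_variety A \<longleftrightarrow>
     zariski_closed base (ambient A) (carrier A) \<and>
     irreducible_closed UNIV (ambient A) (carrier A) \<and>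
     smooth_variety (ambient A) (carrier A) \<and>
     comm_group A \<and>
     range \<one>\<^bsub>A\<^esub> \<subseteq> base \<and>
     regular_map (ambient A) (carrier A) (ambient A) (carrier A) (\<lambda>x. inv\<^bsub>A\<^esub> x) \<and>
     (\<exists>\<mu>. regular_map ((ambient A + 1) * (ambient A + 1) - 1)
            {segre (ambient A) x y | x y. x \<in> carrier A \<and> y \<in> carrier A}
            (ambient A) (carrier A) \<mu> \<and>
          (\<forall>x\<in>carrier A. \<forall>y\<in>carrier A. \<mu> (segre (ambient A) x y) = x \<otimes>\<^bsub>A\<^esub> y))"

definition rational_points :: "'k::field abvar \<Rightarrow> 'k alg_closure set \<Rightarrow> 'k point set" where
  "rational_points A L = {x \<in> carrier A. range x \<subseteq> L}"

text \<open>
  Restriction and norm along a \<open>k\<close>-embedding \<open>\<sigma>\<close> of \<open>K\<close> into \<open>L\<close>. Since \<open>k\<close> is perfect, the norm is the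
  sum of the conjugates under all embeddings of \<open>L\<close> into the algebraic closure that extend the
  inclusion of \<open>K\<close> along \<open>\<sigma>\<close>.
\<close>

definition restrict_pt :: "('k::field alg_closure \<Rightarrow> 'k alg_closure) \<Rightarrow> 'k point \<Rightarrow> 'k point" where
  "restrict_pt \<sigma> a = \<sigma> \<circ> a"

definition norm_pt ::
  "'k::field abvar \<Rightarrow> 'k alg_closure set \<Rightarrow> 'k alg_closure set \<Rightarrow>
   ('k alg_closure \<Rightarrow> 'k alg_closure) \<Rightarrow> 'k point \<Rightarrow> 'k point" where
  "norm_pt A K L \<sigma> a = finprod A (\<lambda>\<tau>. \<tau> \<circ> a) {\<tau> \<in> embeddings L UNIV. \<forall>x\<in>K. \<tau> (\<sigma> x) = x}"


section \<open>Quotients by generated subgroups\<close>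

definition quot_group :: "('a, 'm) monoid_scheme \<Rightarrow> 'a set \<Rightarrow> 'a set monoid" where
  "quot_group G R = G Mod generate G R"

definition quot_class :: "('a, 'm) monoid_scheme \<Rightarrow> 'a set \<Rightarrow> 'a \<Rightarrow> 'a set" where
  "quot_class G R a = generate G R #>\<^bsub>G\<^esub> a"


section \<open>The group of zero-cycles modulo rational equivalence\<close>

text \<open>
  Rational equivalence is generated by the push-forwards of principal divisors along morphisms from
  smooth projective curves (e.g. normalisations of integral curves in the variety).
\<close>

definition rat_equiv_rels :: "'k::field abvar \<Rightarrow> 'k cycle set" where
  "rat_equiv_rels A =
     {push_cycle g (principal_divisor M C f) | M C g f.
        smooth_proj_curve M C \<and> regular_map M C (ambient A) (carrier A) g \<and> f \<in> rat_functions_nz M C}"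

definition CH0 :: "'k::field abvar \<Rightarrow> 'k cycle set monoid" where
  "CH0 A = quot_group (zero_cycles (carrier A)) (rat_equiv_rels A)"

definition CH0_class :: "'k::field abvar \<Rightarrow> 'k cycle \<Rightarrow> 'k cycle set" where
  "CH0_class A = quot_class (zero_cycles (carrier A)) (rat_equiv_rels A)"

definition mult_push :: "'k::field abvar \<Rightarrow> nat \<Rightarrow> 'k cycle set \<Rightarrow> 'k cycle set" where
  "mult_push A n c = the_elem ((\<lambda>z. CH0_class A (push_cycle (\<lambda>x. x [^]\<^bsub>A\<^esub> n) z)) ` c)"


section \<open>Somekawa K-groups\<close>

text \<open>\<open>(L, [a\<^sub>1, \<dots>, a\<^sub>r])\<close> stands for the symbol \<open>{a\<^sub>1, \<dots>, a\<^sub>r}\<close> over \<open>L/k\<close>.\<close>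

type_synonym 'k symb = "'k alg_closure set \<times> 'k point list"

definition point_tuples :: "'k::field abvar list \<Rightarrow> 'k alg_closure set \<Rightarrow> 'k point list set" where
  "point_tuples As L =
     {as. length as = length As \<and> (\<forall>i<length As. as ! i \<in> rational_points (As ! i) L)}"

definition symbols :: "'k::field abvar list \<Rightarrow> 'k symb set" where
  "symbols As = {(L, as). finite_ext L \<and> as \<in> point_tuples As L}"

text \<open>
  The direct sum over \<open>L\<close> of the tensor products is the free abelian group on the symbols modulo
  \<open>multilinear_rels\<close>.
\<close>

definition multilinear_rels :: "'k::field abvar list \<Rightarrow> ('k symb \<Rightarrow>\<^sub>0 int) set" where
  "multilinear_rels As =
     {frag_of (L, as[i := a \<otimes>\<^bsub>As ! i\<^esub> b]) - frag_of (L, as[i := a]) - frag_of (L, as[i := b])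
      | L as i a b. finite_ext L \<and> as \<in> point_tuples As L \<and> i < length As \<and>
          a \<in> rational_points (As ! i) L \<and> b \<in> rational_points (As ! i) L}"

definition projection_rels :: "'k::field abvar list \<Rightarrow> ('k symb \<Rightarrow>\<^sub>0 int) set" where
  "projection_rels As =
     {frag_of (L, (map (restrict_pt \<sigma>) bs)[i := a]) - frag_of (K, bs[i := norm_pt (As ! i) K L \<sigma> a])
      | K L \<sigma> bs i a. finite_ext K \<and> finite_ext L \<and> \<sigma> \<in> embeddings K L \<and>
          bs \<in> point_tuples As K \<and> i < length As \<and> a \<in> rational_points (As ! i) L}"

definition weil_rels :: "'k::field abvar list \<Rightarrow> ('k symb \<Rightarrow>\<^sub>0 int) set" where
  "weil_rels As =
     {frag_extend (\<lambda>c. frag_of (residue_field (geom_pt c), map (\<lambda>g. g (geom_pt c)) gs))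
        (principal_divisor M C f)
      | M C gs f. smooth_proj_curve M C \<and> length gs = length As \<and>
          (\<forall>i<length As. regular_map M C (ambient (As ! i)) (carrier (As ! i)) (gs ! i)) \<and>
          f \<in> rat_functions_nz M C}"

definition somekawa_rels :: "'k::field abvar list \<Rightarrow> ('k symb \<Rightarrow>\<^sub>0 int) set" where
  "somekawa_rels As = multilinear_rels As \<union> projection_rels As \<union> weil_rels As"

definition somekawa_K :: "'k::field abvar list \<Rightarrow> ('k symb \<Rightarrow>\<^sub>0 int) set monoid" where
  "somekawa_K As = quot_group (free_Abelian_group (symbols As)) (somekawa_rels As)"

definition somekawa_class :: "'k::field abvar list \<Rightarrow> ('k symb \<Rightarrow>\<^sub>0 int) \<Rightarrow> ('k symb \<Rightarrow>\<^sub>0 int) set" where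
  "somekawa_class As = quot_class (free_Abelian_group (symbols As)) (somekawa_rels As)"

text \<open>\<open>K_sym\<close> and \<open>S_sym\<close> are only meaningful for \<open>r \<ge> 1\<close>; the case \<open>r = 0\<close> is \<open>\<int>\<close> by convention.\<close>

definition K_sym :: "'k::field abvar \<Rightarrow> nat \<Rightarrow> ('k symb \<Rightarrow>\<^sub>0 int) set monoid" where
  "K_sym A r = somekawa_K (replicate r A)"

definition symmetry_rels :: "'k::field abvar \<Rightarrow> nat \<Rightarrow> ('k symb \<Rightarrow>\<^sub>0 int) set set" where
  "symmetry_rels A r =
     {somekawa_class (replicate r A) (frag_of (L, permute_list \<pi> as))
        \<otimes>\<^bsub>K_sym A r\<^esub> inv\<^bsub>K_sym A r\<^esub> somekawa_class (replicate r A) (frag_of (L, as))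
      | L as \<pi>. (L, as) \<in> symbols (replicate r A) \<and> \<pi> permutes {..<r}}"

definition S_sym :: "'k::field abvar \<Rightarrow> nat \<Rightarrow> ('k symb \<Rightarrow>\<^sub>0 int) set set monoid" where
  "S_sym A r = quot_group (K_sym A r) (symmetry_rels A r)"

definition S_class :: "'k::field abvar \<Rightarrow> nat \<Rightarrow> ('k symb \<Rightarrow>\<^sub>0 int) \<Rightarrow> ('k symb \<Rightarrow>\<^sub>0 int) set set" where
  "S_class A r s = quot_class (K_sym A r) (symmetry_rels A r) (somekawa_class (replicate r A) s)"


section \<open>The filtration\<close>

text \<open>
  \<open>Phi0\<close> and \<open>Phi\<close> are the homomorphisms \<open>\<Phi>\<^sub>0\<close> and \<open>\<Phi>\<^sub>r\<close> (\<open>r \<ge> 1\<close>) on \<open>CH0 A\<close>, given by their graphs: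
  the class of a cycle \<open>z\<close> is related to the value of the defining formula on \<open>z\<close>. That these graphs
  are single-valued is the fact that the homomorphisms are well defined (for \<open>\<Phi>\<^sub>0\<close>: that principal
  divisors have degree zero).
\<close>

definition Phi0 :: "'k::field abvar \<Rightarrow> ('k cycle set \<times> int) set" where
  "Phi0 A = (\<lambda>z. (CH0_class A z, cycle_degree z)) ` carrier (zero_cycles (carrier A))"

definition Phi ::
  "'k::field abvar \<Rightarrow> nat \<Rightarrow> ('k cycle set \<times> ('k symb \<Rightarrow>\<^sub>0 int) set set) set" where
  "Phi A r =
     (\<lambda>z. (CH0_class A z,
           S_class A r (frag_extend (\<lambda>c. frag_of (residue_field (geom_pt c), replicate r (geom_pt c))) z)))
     ` carrier (zero_cycles (carrier A))"

definition ker_Phi :: "'k::field abvar \<Rightarrow> nat \<Rightarrow> 'k cycle set set" where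
  "ker_Phi A r = (if r = 0 then {c. (c, 0) \<in> Phi0 A} else {c. (c, \<one>\<^bsub>S_sym A r\<^esub>) \<in> Phi A r})"

definition F_filt :: "'k::field abvar \<Rightarrow> nat \<Rightarrow> 'k cycle set set" where
  "F_filt A r = carrier (CH0 A) \<inter> (\<Inter>j<r. ker_Phi A j)"

definition gr_group :: "'k::field abvar \<Rightarrow> nat \<Rightarrow> 'k cycle set set monoid" where
  "gr_group A r = (CH0 A)\<lparr>carrier := F_filt A r\<rparr> Mod F_filt A (Suc r)"

definition gr_mult_push :: "'k::field abvar \<Rightarrow> nat \<Rightarrow> nat \<Rightarrow> 'k cycle set set \<Rightarrow> 'k cycle set set" where
  "gr_mult_push A n r V = the_elem ((\<lambda>c. F_filt A (Suc r) #>\<^bsub>CH0 A\<^esub> mult_push A n c) ` V)"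

end

theory Submission
  imports Defs
begin

text \<open>
  Let \<open>x\<close> be a closed point of \<open>A\<close> and \<open>y = n x\<close>. The symbol of \<open>n\<^sub>\<star>[x] = [k(x) : k(y)] [y]\<close> is
  \<open>[k(x) : k(y)] {y, \<dots>, y}\<close> over \<open>k(y)\<close>. The norm of \<open>y\<close> from \<open>k(x)\<close> to \<open>k(y)\<close> is \<open>[k(x) : k(y)] y\<close>,
  so the projection formula turns this into \<open>{n x, \<dots>, n x}\<close> over \<open>k(x)\<close>, which is \<open>n\<^sup>r {x, \<dots>, x}\<close> by
  multilinearity. Hence \<open>\<Phi>\<^sub>r \<circ> n\<^sub>\<star> = n\<^sup>r \<Phi>\<^sub>r\<close>, and \<open>n\<^sub>\<star> - n\<^sup>r\<close> maps \<open>F\<^sup>r\<close> into the kernel of \<open>\<Phi>\<^sub>r\<close>.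

  The norm is defined as a sum over embeddings, so this rests on the fact that a finite extension
  \<open>L/K\<close> of perfect fields has exactly \<open>[L : K]\<close> embeddings over \<open>K\<close>. The same count gives the Galois
  descent which shows that norms are rational over the smaller field.
\<close>

section \<open>The algebraic closure as a field\<close>

text \<open>Two features of the encoding shape the argument. A closed point is a Galois orbit and
  \<open>geom_pt\<close> picks an unspecified member of it, so after a push-forward the point
  \<open>y\<close> is represented by some conjugate \<open>\<sigma> \<circ> y\<close>. Degrees are
  insensitive to this; for symbols the conjugation is removed by the projection formula along the
  isomorphism of residue fields, which has degree 1. Moreover, quotients are formed by
  \<open>generate\<close>, which is under control once the generators lie in the carrier. For the
  projection relations this means that norms are rational, and that is what the descent is for. The
  formula for a single \<open>r\<close> puts \<open>n\<^sub>\<star> - n\<^sup>r\<close> only into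
  one kernel. To land in \<open>F\<^sup>r\<^sup>+\<^sup>1\<close> it must also preserve
  \<open>F\<^sup>r\<close>; this comes from the same formula for all \<open>j < r\<close>, since
  \<open>n\<^sub>\<star> = (n\<^sub>\<star> - n\<^sup>j) + n\<^sup>j\<close> and both summands
  respect the kernel of \<open>\<Phi>\<^sub>j\<close>. The case \<open>j = 0\<close> is invariance
  of the degree and has its own proof, as \<open>\<Phi>\<^sub>0\<close> takes values in the integers
  and not in a group of symbols.\<close>

lemma kbar_simps [simp]:
  "carrier (kbar :: 'k::field alg_closure ring) = UNIV"
  "x \<otimes>\<^bsub>kbar\<^esub> y = x * y" "x \<oplus>\<^bsub>kbar\<^esub> y = x + y"
  "\<one>\<^bsub>kbar\<^esub> = (1 :: 'k alg_closure)" "\<zero>\<^bsub>kbar\<^esub> = (0 :: 'k alg_closure)"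
  by (simp_all add: ring_of_type_algebra_def)

lemma field_kbar: "Ring.field (kbar :: 'k::field alg_closure ring)"
  by (rule field_from_type_algebra)

interpretation kbar: domain "kbar :: 'k::field alg_closure ring"
  using field_kbar by (rule field.axioms)

lemma kbar_minus [simp]: "\<ominus>\<^bsub>kbar\<^esub> x = - (x :: 'k::field alg_closure)"
  by (rule kbar.minus_equality) auto

lemma kbar_inv [simp]: "(x :: 'k::field alg_closure) \<noteq> 0 \<Longrightarrow> inv\<^bsub>kbar\<^esub> x = inverse x"
  by (rule kbar.comm_inv_char) auto

lemma kbar_pow [simp]: "x [^]\<^bsub>kbar\<^esub> (n::nat) = (x :: 'k::field alg_closure) ^ n"
  by (induction n) (auto simp: mult.commute)

text \<open>As \<open>inverse 0 = 0\<close> in a type-class field, closure under inverses can be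
  demanded of all elements, with no exception at zero.\<close>

lemma subfield_kbar_iff:
  "subfield (K :: 'k::field alg_closure set) kbar \<longleftrightarrow>
     1 \<in> K \<and> (\<forall>x\<in>K. - x \<in> K \<and> inverse x \<in> K) \<and> (\<forall>x\<in>K. \<forall>y\<in>K. x + y \<in> K \<and> x * y \<in> K)"
  (is "?l \<longleftrightarrow> ?r")
proof
  assume l: ?l
  note * = kbar.subfield_m_inv(1)[OF l] subringE[OF subfieldE(1)[OF l]]
  have "inverse x \<in> K" if "x \<in> K" for x
    using *(1)[of x] *(3) that by (cases "x = 0") auto
  then show ?r using * by auto
next
  assume r: ?r
  show ?l
  proof (rule field.subfieldI'[OF field_kbar])
    show "subring K kbar" using r by (intro kbar.subringI) auto
  qed (use r in auto)
qed

lemma subfield_kbarD: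
  assumes "subfield (K :: 'k::field alg_closure set) kbar"
  shows "1 \<in> K" "0 \<in> K" "x \<in> K \<Longrightarrow> - x \<in> K" "x \<in> K \<Longrightarrow> inverse x \<in> K"
    "x \<in> K \<Longrightarrow> y \<in> K \<Longrightarrow> x + y \<in> K" "x \<in> K \<Longrightarrow> y \<in> K \<Longrightarrow> x * y \<in> K"
    "x \<in> K \<Longrightarrow> y \<in> K \<Longrightarrow> x - y \<in> K" "x \<in> K \<Longrightarrow> y \<in> K \<Longrightarrow> x / y \<in> K"
    "x \<in> K \<Longrightarrow> x ^ n \<in> K"
proof -
  note * = assms[unfolded subfield_kbar_iff]
  show "1 \<in> K" "x \<in> K \<Longrightarrow> - x \<in> K" "x \<in> K \<Longrightarrow> inverse x \<in> K"
    "x \<in> K \<Longrightarrow> y \<in> K \<Longrightarrow> x + y \<in> K" "x \<in> K \<Longrightarrow> y \<in> K \<Longrightarrow> x * y \<in> K" using * by auto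
  show "0 \<in> K" using * by (metis add.right_inverse)
  show "x \<in> K \<Longrightarrow> y \<in> K \<Longrightarrow> x - y \<in> K" using * by (metis diff_conv_add_uminus)
  show "x \<in> K \<Longrightarrow> y \<in> K \<Longrightarrow> x / y \<in> K" using * by (metis divide_inverse)
  show "x \<in> K \<Longrightarrow> x ^ n \<in> K" using * by (induction n) auto
qed

lemma subfield_sum: "subfield K kbar \<Longrightarrow> (\<And>i. i \<in> I \<Longrightarrow> f i \<in> K) \<Longrightarrow> sum f I \<in> K"
  for K :: "'k::field alg_closure set"
  by (induction I rule: infinite_finite_induct) (auto intro: subfield_kbarD)

lemma subfield_prod: "subfield K kbar \<Longrightarrow> (\<And>i. i \<in> I \<Longrightarrow> f i \<in> K) \<Longrightarrow> prod f I \<in> K"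
  for K :: "'k::field alg_closure set"
  by (induction I rule: infinite_finite_induct) (auto intro: subfield_kbarD)

lemma subfield_base: "subfield (base :: 'k::field alg_closure set) kbar"
  unfolding subfield_kbar_iff base_def
  by (auto simp flip: to_ac_minus to_ac_inverse to_ac_add to_ac_mult to_ac_1 simp del: to_ac_eq_iff)

lemma subfield_UNIV: "subfield (UNIV :: 'k::field alg_closure set) kbar"
  by (auto simp: subfield_kbar_iff)

section \<open>Homomorphisms over \<open>k\<close> on subfields of the algebraic closure\<close>

lemma embeddings_iff:
  fixes K L :: "'k::field alg_closure set"
  shows "\<sigma> \<in> embeddings K L \<longleftrightarrow> \<sigma> \<in> extensional K \<and> (\<forall>x\<in>K. \<sigma> x \<in> L) \<and>
    (\<forall>x\<in>K. \<forall>y\<in>K. \<sigma> (x + y) = \<sigma> x + \<sigma> y \<and> \<sigma> (x * y) = \<sigma> x * \<sigma> y) \<and> \<sigma> 1 = 1 \<and> (\<forall>c\<in>base. \<sigma> c = c)"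
  by (auto simp: embeddings_def ring_hom_def)

text \<open>This is \<open>embeddings\<close> without extensionality and without a target. Galois
  automorphisms, composites and restrictions to smaller fields then fall under one predicate;
  extensionality matters for counting.\<close>

definition base_hom :: "'k::field alg_closure set \<Rightarrow> ('k alg_closure \<Rightarrow> 'k alg_closure) \<Rightarrow> bool" where
  "base_hom K \<sigma> \<longleftrightarrow>
    (\<forall>x\<in>K. \<forall>y\<in>K. \<sigma> (x + y) = \<sigma> x + \<sigma> y \<and> \<sigma> (x * y) = \<sigma> x * \<sigma> y) \<and> \<sigma> 1 = 1 \<and> (\<forall>c\<in>base. \<sigma> c = c)"

lemma embeddings_iff_base_hom:
  "\<sigma> \<in> embeddings K L \<longleftrightarrow> \<sigma> \<in> extensional K \<and> \<sigma> ` K \<subseteq> L \<and> base_hom K \<sigma>"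
  by (auto simp: embeddings_iff base_hom_def)

context
  fixes K :: "'k::field alg_closure set" and \<sigma>
  assumes K: "subfield K kbar" and \<sigma>: "base_hom K \<sigma>"
begin

lemma base_hom_simps:
  shows base_hom_add: "x \<in> K \<Longrightarrow> y \<in> K \<Longrightarrow> \<sigma> (x + y) = \<sigma> x + \<sigma> y"
    and base_hom_mult: "x \<in> K \<Longrightarrow> y \<in> K \<Longrightarrow> \<sigma> (x * y) = \<sigma> x * \<sigma> y"
    and base_hom_1: "\<sigma> 1 = 1" and base_hom_base: "c \<in> base \<Longrightarrow> \<sigma> c = c"
    and base_hom_0: "\<sigma> 0 = 0"
proof -
  show "x \<in> K \<Longrightarrow> y \<in> K \<Longrightarrow> \<sigma> (x + y) = \<sigma> x + \<sigma> y" "x \<in> K \<Longrightarrow> y \<in> K \<Longrightarrow> \<sigma> (x * y) = \<sigma> x * \<sigma> y"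
    "\<sigma> 1 = 1" "c \<in> base \<Longrightarrow> \<sigma> c = c"
    using \<sigma> unfolding base_hom_def by auto
  show "\<sigma> 0 = 0"
    using \<sigma> subfield_kbarD(2)[OF K] unfolding base_hom_def by (metis add_cancel_left_left add_0)
qed

lemma base_hom_minus: "x \<in> K \<Longrightarrow> \<sigma> (- x) = - \<sigma> x"
  using base_hom_add[of x "- x"] base_hom_0 subfield_kbarD(3)[OF K]
  by (simp add: eq_neg_iff_add_eq_0 add.commute)

lemma base_hom_diff: "x \<in> K \<Longrightarrow> y \<in> K \<Longrightarrow> \<sigma> (x - y) = \<sigma> x - \<sigma> y"
  using base_hom_add[of x "- y"] base_hom_minus subfield_kbarD(3)[OF K] by simp

lemma base_hom_eq_0_iff: "x \<in> K \<Longrightarrow> \<sigma> x = 0 \<longleftrightarrow> x = 0"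
  by (metis base_hom_0 base_hom_1 base_hom_mult mult_zero_left subfield_kbarD(4)[OF K] right_inverse zero_neq_one)

lemma base_hom_inverse: "x \<in> K \<Longrightarrow> \<sigma> (inverse x) = inverse (\<sigma> x)"
  by (cases "x = 0")
     (metis base_hom_0 inverse_zero,
      metis base_hom_1 base_hom_mult subfield_kbarD(4)[OF K] right_inverse inverse_unique)

lemma base_hom_divide: "x \<in> K \<Longrightarrow> y \<in> K \<Longrightarrow> \<sigma> (x / y) = \<sigma> x / \<sigma> y"
  by (simp add: base_hom_inverse base_hom_mult divide_inverse subfield_kbarD(4)[OF K])

lemma base_hom_power: "x \<in> K \<Longrightarrow> \<sigma> (x ^ n) = \<sigma> x ^ n"
  by (induction n) (auto simp: base_hom_1 base_hom_mult subfield_kbarD(9)[OF K])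

lemma base_hom_inj: "inj_on \<sigma> K"
  by (rule inj_onI)
     (metis base_hom_diff base_hom_eq_0_iff right_minus_eq subfield_kbarD(7)[OF K])

lemma base_hom_sum: "(\<And>i. i \<in> I \<Longrightarrow> f i \<in> K) \<Longrightarrow> \<sigma> (sum f I) = (\<Sum>i\<in>I. \<sigma> (f i))"
  by (induction I rule: infinite_finite_induct)
     (auto simp: base_hom_0 base_hom_add subfield_sum[OF K])

lemma base_hom_prod: "(\<And>i. i \<in> I \<Longrightarrow> f i \<in> K) \<Longrightarrow> \<sigma> (prod f I) = (\<Prod>i\<in>I. \<sigma> (f i))"
  by (induction I rule: infinite_finite_induct)
     (auto simp: base_hom_1 base_hom_mult subfield_prod[OF K])

lemma subfield_image: "subfield (\<sigma> ` K) kbar"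
  unfolding subfield_kbar_iff
  using base_hom_1 subfield_kbarD[OF K]
  by (auto simp flip: base_hom_minus base_hom_inverse base_hom_add base_hom_mult intro!: image_eqI[of 1 \<sigma> 1])

lemma base_hom_comp: "base_hom (\<sigma> ` K) \<tau> \<Longrightarrow> base_hom K (\<tau> \<circ> \<sigma>)"
  unfolding base_hom_def[of _ \<tau>] base_hom_def[of _ "\<tau> \<circ> \<sigma>"]
  by (auto simp: base_hom_add base_hom_mult base_hom_1 base_hom_base)

end

lemma base_hom_cong: "base \<subseteq> K \<Longrightarrow> subfield K kbar \<Longrightarrow> (\<And>x. x \<in> K \<Longrightarrow> \<sigma> x = \<tau> x) \<Longrightarrow> base_hom K \<sigma> \<longleftrightarrow> base_hom K \<tau>"
  for K :: "'k::field alg_closure set"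
  unfolding base_hom_def by (auto simp: subfield_kbarD subset_iff)

lemma base_hom_subset: "base_hom L \<sigma> \<Longrightarrow> K \<subseteq> L \<Longrightarrow> base_hom K \<sigma>"
  unfolding base_hom_def by blast

text \<open>The maps \<open>\<tau>\<close> in \<open>norm_pt\<close> satisfy
  \<open>\<tau> (\<sigma> x) = x\<close> on \<open>K\<close>: they are the extensions to
  \<open>L\<close> of this inverse, which lives on the image of \<open>K\<close>.\<close>

lemma base_hom_inv_into:
  fixes K :: "'k::field alg_closure set"
  assumes K: "subfield K kbar" "base \<subseteq> K" and \<sigma>: "base_hom K \<sigma>"
  shows "base_hom (\<sigma> ` K) (inv_into K \<sigma>)"
proof -
  note inj = base_hom_inj[OF K(1) \<sigma>] and simps = base_hom_simps[OF K(1) \<sigma>]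
  have [simp]: "inv_into K \<sigma> (\<sigma> x) = x" if "x \<in> K" for x using inj that by simp
  have "inv_into K \<sigma> 1 = 1" using simps(3) subfield_kbarD(1)[OF K(1)] by (metis inj inv_into_f_f)
  moreover have "inv_into K \<sigma> c = c" if "c \<in> base" for c
    using simps(4)[OF that] that K(2) by (metis inj inv_into_f_f subset_iff)
  ultimately show ?thesis
    unfolding base_hom_def using subfield_kbarD[OF K(1)]
    by (auto simp flip: simps(1,2))
qed

section \<open>Counting embeddings\<close>

text \<open>Splitting off a root \<open>a\<close> leaves a cofactor that cannot vanish at
  \<open>a\<close>, since otherwise the square of the linear factor would divide \<open>q\<close>.
  Below, \<open>q\<close> comes from an irreducible polynomial over \<open>k\<close>, and
  \<open>p\<close> is a conjugate of a minimal polynomial over a larger field.\<close>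

lemma card_roots_dvd_rsquarefree:
  fixes p q :: "'a::alg_closed_field poly"
  assumes "rsquarefree q" "p dvd q"
  shows "card {x. poly p x = 0} = Polynomial.degree p"
  using assms(2)
proof (induction "Polynomial.degree p" arbitrary: p)
  case 0
  have "p \<noteq> 0" using 0(2) assms(1) by (auto simp: rsquarefree_def)
  moreover obtain c where "p = [:c:]" using 0(1) by (metis degree_eq_zeroE)
  ultimately have "{x. poly p x = 0} = {}" by simp
  then show ?case using 0(1) by simp
next
  case (Suc d)
  have [simp]: "p \<noteq> 0" using Suc.hyps(2) by auto
  obtain a where a: "poly p a = 0" using alg_closed_imp_poly_has_root[of p] Suc.hyps(2) by auto
  then obtain r where r: "p = [:- a, 1:] * r" by (metis poly_eq_0_iff_dvd dvdE)
  have [simp]: "r \<noteq> 0" using r \<open>p \<noteq> 0\<close> by auto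
  have deg: "Polynomial.degree r = d"
    using Suc.hyps(2) unfolding r by (subst (asm) degree_mult_eq) auto
  have "poly r a \<noteq> 0"
  proof
    assume "poly r a = 0"
    then obtain s where "r = [:- a, 1:] * s" by (metis poly_eq_0_iff_dvd dvdE)
    then have "[:- a, 1:] ^ 2 dvd p" unfolding r by (simp add: power2_eq_square del: mult_pCons_left mult_pCons_right)
    then have "[:- a, 1:] ^ 2 dvd q" using Suc.prems by (rule dvd_trans)
    moreover have "q \<noteq> 0" "order a q = 0 \<or> order a q = 1" using assms(1) by (auto simp: rsquarefree_def)
    ultimately show False by (auto simp: order_divides)
  qed
  moreover have "{x. poly p x = 0} = insert a {x. poly r x = 0}" unfolding r by auto
  ultimately have "card {x. poly p x = 0} = Suc (card {x. poly r x = 0})"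
    by (simp add: poly_roots_finite)
  also have "card {x. poly r x = 0} = d"
    using Suc.hyps(1)[of r] deg Suc.prems r by (metis dvd_mult_right)
  finally show ?case using Suc.hyps(2) by simp
qed

text \<open>\<open>K[x]\<close> inside the type-class polynomials, where roots, degrees and
  \<open>rsquarefree\<close> live. The coefficient lists of HOL-Algebra, which carry the theory of
  field extensions, are translated by \<open>eval_eq_poly\<close>.\<close>

definition polys_over :: "'k::field alg_closure set \<Rightarrow> 'k alg_closure poly set" where
  "polys_over K = {p. \<forall>i. coeff p i \<in> K}"

lemma polys_over_closed:
  assumes K: "subfield (K :: 'k::field alg_closure set) kbar"
  shows "0 \<in> polys_over K"
    "c \<in> K \<Longrightarrow> Polynomial.monom c n \<in> polys_over K"
    "p \<in> polys_over K \<Longrightarrow> q \<in> polys_over K \<Longrightarrow> p + q \<in> polys_over K"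
    "p \<in> polys_over K \<Longrightarrow> q \<in> polys_over K \<Longrightarrow> p - q \<in> polys_over K"
    "p \<in> polys_over K \<Longrightarrow> q \<in> polys_over K \<Longrightarrow> p * q \<in> polys_over K"
    "c \<in> K \<Longrightarrow> p \<in> polys_over K \<Longrightarrow> pCons c p \<in> polys_over K"
  using subfield_kbarD[OF K]
  by (auto simp: polys_over_def coeff_mult coeff_pCons intro!: subfield_sum[OF K] split: nat.split)

lemma map_poly_polys_over:
  fixes K :: "'k::field alg_closure set"
  assumes K: "subfield K kbar" and \<sigma>: "base_hom K \<sigma>"
  shows map_poly_hom_add: "p \<in> polys_over K \<Longrightarrow> q \<in> polys_over K \<Longrightarrow> map_poly \<sigma> (p + q) = map_poly \<sigma> p + map_poly \<sigma> q"
    and map_poly_hom_diff: "p \<in> polys_over K \<Longrightarrow> q \<in> polys_over K \<Longrightarrow> map_poly \<sigma> (p - q) = map_poly \<sigma> p - map_poly \<sigma> q"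
    and map_poly_hom_mult: "p \<in> polys_over K \<Longrightarrow> q \<in> polys_over K \<Longrightarrow> map_poly \<sigma> (p * q) = map_poly \<sigma> p * map_poly \<sigma> q"
  by (auto simp: polys_over_def coeff_mult coeff_map_poly base_hom_simps[OF K \<sigma>] base_hom_diff[OF K \<sigma>]
      base_hom_sum[OF K \<sigma>] subfield_kbarD[OF K] intro!: poly_eqI)

text \<open>Dividing by a monic polynomial only adds, subtracts and multiplies coefficients, so
  quotient and remainder stay over \<open>K\<close>.\<close>

lemma polys_over_division:
  fixes K :: "'k::field alg_closure set"
  assumes K: "subfield K kbar" and q: "q \<in> polys_over K" "Polynomial.lead_coeff q = 1" and p: "p \<in> polys_over K"
  shows "\<exists>s\<in>polys_over K. \<exists>r\<in>polys_over K. p = q * s + r \<and> (r = 0 \<or> Polynomial.degree r < Polynomial.degree q)"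
  using p
proof (induction "Polynomial.degree p" arbitrary: p rule: less_induct)
  case less
  note cl = polys_over_closed[OF K]
  show ?case
  proof (cases "p = 0 \<or> Polynomial.degree p < Polynomial.degree q")
    case True
    then show ?thesis using less.prems cl(1) by (intro bexI[of _ 0] bexI[of _ p]) auto
  next
    case False
    define m where "m = Polynomial.monom (Polynomial.lead_coeff p) (Polynomial.degree p - Polynomial.degree q)"
    have m: "m \<in> polys_over K" using less.prems unfolding m_def by (intro cl) (auto simp: polys_over_def)
    have [simp]: "q \<noteq> 0" using q by auto
    define p' where "p' = p - q * m"
    have p': "p' \<in> polys_over K" unfolding p'_def using less.prems m q cl by auto
    have "m \<noteq> 0" unfolding m_def using False by (simp add: monom_eq_0_iff)
    have d: "Polynomial.degree (q * m) = Polynomial.degree p"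
      using False \<open>m \<noteq> 0\<close> by (subst degree_mult_eq) (auto simp: m_def degree_monom_eq)
    have "coeff p' (Polynomial.degree p) = 0"
      using q(2) d unfolding p'_def
      by (simp, metis (no_types, lifting) Polynomial.lead_coeff_monom lead_coeff_mult m_def mult_1)
    moreover have "Polynomial.degree p' \<le> Polynomial.degree p" unfolding p'_def using d by (metis degree_diff_le order_refl)
    ultimately have "p' = 0 \<or> Polynomial.degree p' < Polynomial.degree p"
      by (metis le_neq_implies_less leading_coeff_0_iff)
    then show ?thesis
    proof
      assume "p' = 0"
      then show ?thesis using m cl(1) unfolding p'_def by (intro bexI[of _ m] bexI[of _ 0]) auto
    next
      assume "Polynomial.degree p' < Polynomial.degree p"
      from less.hyps[OF this p'] obtain s r where sr: "s \<in> polys_over K" "r \<in> polys_over K"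
        "p' = q * s + r" "r = 0 \<or> Polynomial.degree r < Polynomial.degree q" by blast
      then have "p = q * (s + m) + r" unfolding p'_def by (simp add: algebra_simps)
      then show ?thesis using sr m cl by blast
    qed
  qed
qed

text \<open>The lists of HOL-Algebra put the leading coefficient first, \<open>Poly\<close> puts the
  constant term first; hence \<open>rev\<close> here and in the translations below.\<close>

lemma eval_eq_poly: "kbar.eval l x = poly (Poly (rev l)) (x :: 'k::field alg_closure)"
  by (induction l) (auto simp: Poly_append poly_monom mult.commute add.commute)

lemma carrier_univ_poly_kbar:
  "l \<in> carrier (univ_poly (kbar :: 'k::field alg_closure ring) K) \<longleftrightarrow> l = [] \<or> (set l \<subseteq> K \<and> hd l \<noteq> 0)"
  by (auto simp: univ_poly_def polynomial_def)

lemma Poly_rev_in_polys_over: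
  assumes "subfield (K :: 'k::field alg_closure set) kbar" "set l \<subseteq> K"
  shows "Poly (rev l) \<in> polys_over K"
  using assms subfield_kbarD(2)[OF assms(1)] by (auto simp: polys_over_def nth_default_def subset_iff rev_nth)

lemma rev_coeffs_in_carrier:
  assumes "p \<in> polys_over K"
  shows "rev (coeffs p) \<in> carrier (univ_poly (kbar :: 'k::field alg_closure ring) K)"
  using assms by (cases "p = 0")
    (auto simp: carrier_univ_poly_kbar polys_over_def coeffs_def hd_rev last_coeffs_eq_coeff_degree last_map)

lemma map_poly_to_ac_in_polys_over: "base \<subseteq> K \<Longrightarrow> subfield K kbar \<Longrightarrow> map_poly to_ac p \<in> polys_over K"
  using subfield_kbarD(2) by (auto simp: polys_over_def coeff_map_poly base_def)

lemma algebraic_over_base: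
  fixes K :: "'k::field alg_closure set"
  assumes "subfield K kbar" "base \<subseteq> K"
  shows "(kbar.algebraic over K) a"
proof -
  obtain p where p: "p \<noteq> 0" "poly (map_poly to_ac p) a = 0" by (rule alg_closure_algebraic)
  have "map_poly to_ac p \<in> polys_over K"
    using map_poly_to_ac_in_polys_over assms by blast
  moreover have "map_poly to_ac p \<noteq> 0" using p(1) by (simp add: map_poly_eq_0_iff)
  ultimately show ?thesis
    using p(2) by (intro kbar.algebraicI[of "rev (coeffs (map_poly to_ac p))"] rev_coeffs_in_carrier)
       (auto simp: eval_eq_poly)
qed

text \<open>Take a polynomial over \<open>k\<close> of least degree among those vanishing at
  \<open>a\<close>: a factor that vanishes at \<open>a\<close> already has the full degree, so its
  cofactor is constant. Perfectness speaks of irreducible polynomials over the type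
  \<open>'k\<close>, so a minimal polynomial over a subfield of the algebraic closure cannot be fed
  to it directly.\<close>

lemma irreducible_poly_over_base:
  fixes a :: "'k::field alg_closure"
  obtains P :: "'k poly" where "Factorial_Ring.irreducible P" "poly (map_poly to_ac P) a = 0"
proof -
  let ?Q = "\<lambda>P :: 'k poly. P \<noteq> 0 \<and> poly (map_poly to_ac P) a = 0"
  obtain p0 where "?Q p0" by (metis alg_closure_algebraic)
  then obtain P where P: "?Q P" and min: "\<And>p. ?Q p \<Longrightarrow> Polynomial.degree P \<le> Polynomial.degree p"
    using arg_min_nat_lemma[of ?Q p0 Polynomial.degree] by blast
  have mult: "map_poly to_ac (b * c) = map_poly to_ac b * map_poly to_ac c" for b c :: "'k poly"
    by (rule poly_eqI) (simp add: coeff_map_poly coeff_mult to_ac_sum)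
  have "Factorial_Ring.irreducible P"
  proof (rule Factorial_Ring.irreducibleI)
    show "P \<noteq> 0" using P by simp
    show "\<not> is_unit P"
    proof
      assume "is_unit P"
      then obtain c where "P = [:c:]" by (auto simp: is_unit_poly_iff)
      then show False using P by (simp add: map_poly_pCons)
    qed
    fix b c assume bc: "P = b * c"
    have unit: "is_unit c'" if "P = b' * c'" "poly (map_poly to_ac b') a = 0" for b' c'
    proof -
      have nz: "b' \<noteq> 0" "c' \<noteq> 0" using that P by auto
      then have "Polynomial.degree P \<le> Polynomial.degree b'" using that(2) min by blast
      then have "Polynomial.degree c' = 0" using that(1) nz by (simp add: degree_mult_eq)
      then show ?thesis using nz is_unit_iff_degree by blast
    qed
    have "poly (map_poly to_ac b) a = 0 \<or> poly (map_poly to_ac c) a = 0"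
      using P unfolding bc mult by simp
    then show "is_unit b \<or> is_unit c" using unit bc by (metis mult.commute)
  qed
  then show ?thesis using P that by blast
qed

lemma simple_extension_eq_polys:
  assumes K: "subfield (K :: 'k::field alg_closure set) kbar"
  shows "kbar.simple_extension K a = (\<lambda>p. poly p a) ` polys_over K"
proof -
  have "kbar.simple_extension K a = (\<lambda>p. kbar.eval p a) ` carrier (univ_poly kbar K)"
    by (rule kbar.simple_extension_as_eval_img) auto
  also have "\<dots> = (\<lambda>p. poly p a) ` polys_over K"
  proof safe
    fix l assume "l \<in> carrier (univ_poly kbar K)"
    then show "kbar.eval l a \<in> (\<lambda>p. poly p a) ` polys_over K"
      unfolding eval_eq_poly by (intro imageI Poly_rev_in_polys_over[OF K]) (auto simp: carrier_univ_poly_kbar)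
  next
    fix p assume "p \<in> polys_over K"
    then show "poly p a \<in> (\<lambda>p. kbar.eval p a) ` carrier (univ_poly kbar K)"
      by (intro image_eqI[of _ _ "rev (coeffs p)"] rev_coeffs_in_carrier) (auto simp: eval_eq_poly)
  qed
  finally show ?thesis .
qed

text \<open>Minimality of \<open>kbar.Irr\<close> supplies a degree bound, and divisibility then
  comes from division with remainder. In this way the cofactor \<open>s\<close> is over
  \<open>K\<close>, so that a homomorphism defined on \<open>K\<close> can be applied to its
  coefficients.\<close>

lemma minimal_polynomial_kbar:
  fixes K :: "'k::field alg_closure set"
  assumes K: "subfield K kbar" "base \<subseteq> K"
  obtains q where "q \<in> polys_over K" "Polynomial.lead_coeff q = 1" "poly q a = 0"
    "kbar.dimension (Polynomial.degree q) K (kbar.simple_extension K a)"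
    "\<And>p. p \<in> polys_over K \<Longrightarrow> poly p a = 0 \<Longrightarrow> \<exists>s\<in>polys_over K. p = q * s"
proof -
  note alg = algebraic_over_base[OF K, of a]
  define l where "l = kbar.Irr K a"
  have l: "l \<in> carrier (univ_poly kbar K)" "Polynomials.lead_coeff l = 1" "kbar.eval l a = 0"
    using kbar.IrrE(1,3,4)[OF K(1) _ alg] by (auto simp: l_def)
  have "l \<noteq> []" using kbar.IrrE(2)[OF K(1) _ alg] by (auto simp: l_def ring_irreducible_def univ_poly_zero)
  define q where "q = Poly (rev l)"
  have q1: "q \<in> polys_over K"
    unfolding q_def using l by (intro Poly_rev_in_polys_over[OF K(1)]) (auto simp: carrier_univ_poly_kbar)
  have cl: "coeffs q = rev l"
  proof -
    have "hd l \<noteq> 0" using l(2) by auto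
    then show ?thesis
      using \<open>l \<noteq> []\<close> unfolding q_def by (cases l) (auto simp: strip_while_def)
  qed
  have degq: "Polynomial.degree q = Polynomials.degree l"
    by (simp add: degree_eq_length_coeffs cl)
  have lead: "Polynomial.lead_coeff q = 1"
    using \<open>l \<noteq> []\<close> l(2) cl by (metis last_coeffs_eq_coeff_degree last_rev coeffs_eq_Nil rev_is_Nil_conv)
  have root: "poly q a = 0" using l(3) by (simp add: eval_eq_poly q_def)
  have dim: "kbar.dimension (Polynomial.degree q) K (kbar.simple_extension K a)"
    using kbar.dimension_simple_extension[OF K(1) _ alg] unfolding degq l_def by simp
  have min: "p = 0 \<or> Polynomial.degree q \<le> Polynomial.degree p" if p: "p \<in> polys_over K" "poly p a = 0" for p
  proof -
    have "l pdivides\<^bsub>kbar\<^esub> rev (coeffs p)"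
      unfolding l_def using p rev_coeffs_in_carrier[OF p(1)]
      by (intro kbar.Irr_minimal[OF K(1) _ alg]) (auto simp: eval_eq_poly)
    then have "rev (coeffs p) = [] \<or> Polynomials.degree l \<le> Polynomials.degree (rev (coeffs p))"
      using kbar.pdivides_imp_degree_le[OF subfieldE(1)[OF K(1)] l(1) rev_coeffs_in_carrier[OF p(1)]] by blast
    then show ?thesis by (auto simp: degq degree_eq_length_coeffs[of p])
  qed
  have "\<exists>s\<in>polys_over K. p = q * s" if p: "p \<in> polys_over K" "poly p a = 0" for p
  proof -
    obtain s r where sr: "s \<in> polys_over K" "r \<in> polys_over K" "p = q * s + r"
      "r = 0 \<or> Polynomial.degree r < Polynomial.degree q"
      using polys_over_division[OF K(1) q1 lead p(1)] by blast
    have "poly r a = 0" using sr(3) p(2) root by simp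
    then have "r = 0" using min[OF sr(2)] sr(4) by auto
    then show ?thesis using sr by auto
  qed
  then show ?thesis using that q1 lead root dim by blast
qed

lemma poly_in_subfield:
  assumes "subfield (E :: 'k::field alg_closure set) kbar" "p \<in> polys_over E" "a \<in> E"
  shows "poly p a \<in> E"
  using assms(2)
proof (induction p)
  case 0
  then show ?case using subfield_kbarD[OF assms(1)] by simp
next
  case (pCons c p)
  have "c \<in> E" "p \<in> polys_over E"
    using pCons.prems unfolding polys_over_def by (force dest: spec[of _ 0], simp, metis coeff_pCons_Suc)
  then show ?case using pCons.IH subfield_kbarD[OF assms(1)] assms(3) by simp
qed

lemma base_hom_poly:
  fixes K :: "'k::field alg_closure set"
  assumes E: "subfield E kbar" "base_hom E \<psi>" and KE: "K \<subseteq> E" "\<And>x. x \<in> K \<Longrightarrow> \<psi> x = \<phi> x" "\<phi> 0 = 0"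
    and a: "a \<in> E" and p: "p \<in> polys_over K"
  shows "\<psi> (poly p a) = poly (map_poly \<phi> p) (\<psi> a)"
  using p
proof (induction p)
  case 0
  then show ?case using base_hom_0[OF E] by simp
next
  case (pCons c p)
  have c: "c \<in> K" "p \<in> polys_over K"
    using pCons.prems unfolding polys_over_def by (force dest: spec[of _ 0], simp, metis coeff_pCons_Suc)
  then have p: "poly p a \<in> E" using KE(1) by (intro poly_in_subfield[OF E(1) _ a]) (auto simp: polys_over_def)
  have "map_poly \<phi> (pCons c p) = pCons (\<phi> c) (map_poly \<phi> p)"
    using KE(3) by (simp add: map_poly_pCons)
  then show ?case
    using c p pCons.IH a KE base_hom_simps[OF E] subfield_kbarD(6)[OF E(1)] by auto
qed

text \<open>An extension of \<open>\<phi>\<close> to \<open>K(a)\<close> is determined by the image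
  of \<open>a\<close>, and the possible images are the roots of \<open>q'\<close>, the conjugate
  under \<open>\<phi>\<close> of the minimal polynomial. These roots are simple: an irreducible
  polynomial \<open>P\<close> over \<open>k\<close> with root \<open>a\<close> is fixed by
  \<open>\<phi>\<close>, so \<open>q'\<close> divides it, and \<open>P\<close> is separable because
  \<open>k\<close> is perfect.\<close>

lemma card_extensions_simple:
  fixes K :: "'k::field alg_closure set" and a
  assumes perf: "perfect_field TYPE('k)"
    and K: "subfield K kbar" "base \<subseteq> K" and \<phi>: "base_hom K \<phi>"
  defines "E \<equiv> kbar.simple_extension K a"
  defines "Ext \<equiv> {\<psi> \<in> embeddings E UNIV. \<forall>x\<in>K. \<psi> x = \<phi> x}"
  shows "finite Ext" "card Ext = ext_degree K E"
proof -
  note alg = algebraic_over_base[OF K, of a]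
  have E: "subfield E kbar" unfolding E_def using kbar.simple_extension_is_subfield[OF K(1)] alg by auto
  have KE: "K \<subseteq> E" unfolding E_def by (rule kbar.simple_extension_incl) auto
  have aE: "a \<in> E" unfolding E_def by (rule kbar.simple_extension_mem[OF subfieldE(1)[OF K(1)]]) auto
  have E_eq: "E = (\<lambda>p. poly p a) ` polys_over K" unfolding E_def by (rule simple_extension_eq_polys[OF K(1)])
  note \<phi>_simps = base_hom_simps[OF K(1) \<phi>]
  note cl = polys_over_closed[OF K(1)]
  obtain q where q: "q \<in> polys_over K" "Polynomial.lead_coeff q = 1" "poly q a = 0"
    "kbar.dimension (Polynomial.degree q) K E"
    and min: "\<And>p. p \<in> polys_over K \<Longrightarrow> poly p a = 0 \<Longrightarrow> \<exists>s\<in>polys_over K. p = q * s"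
    unfolding E_def using minimal_polynomial_kbar[OF K, of a thesis] by blast
  have deg_eq: "ext_degree K E = Polynomial.degree q"
    using kbar.dimI[OF K(1) q(4)] by (simp add: ext_degree_def over_def)
  define q' where "q' = map_poly \<phi> q"
  have "coeff q' (Polynomial.degree q) = 1"
    unfolding q'_def using q(2) \<phi>_simps by (simp add: coeff_map_poly)
  then have degq': "Polynomial.degree q' = Polynomial.degree q"
    unfolding q'_def using q(2) \<phi>_simps(3) by (intro map_poly_degree_eq) auto
  obtain P :: "'k poly" where P: "Factorial_Ring.irreducible P" "poly (map_poly to_ac P) a = 0"
    by (rule irreducible_poly_over_base)
  let ?P = "map_poly to_ac P"
  have P_over: "?P \<in> polys_over K" using K by (rule map_poly_to_ac_in_polys_over[rotated])
  have P_fix: "map_poly \<phi> ?P = ?P"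
    using \<phi>_simps by (intro poly_eqI) (simp add: coeff_map_poly base_def)
  obtain s where s: "s \<in> polys_over K" "?P = q * s" using min[OF P_over P(2)] by blast
  have "?P = q' * map_poly \<phi> s"
    using map_poly_hom_mult[OF K(1) \<phi> q(1) s(1)] P_fix s(2) unfolding q'_def by metis
  then have "q' dvd ?P" by simp
  moreover have "rsquarefree ?P" using perf P(1) unfolding perfect_field_def by blast
  ultimately have card: "card {b. poly q' b = 0} = Polynomial.degree q"
    using card_roots_dvd_rsquarefree degq' by metis
  have "q' \<noteq> 0" using \<open>coeff q' _ = 1\<close> by auto
  then have fin: "finite {b. poly q' b = 0}" by (rule poly_roots_finite)
  have XD: "base_hom E \<psi>" "\<And>x. x \<in> K \<Longrightarrow> \<psi> x = \<phi> x" "\<psi> \<in> extensional E" if "\<psi> \<in> Ext" for \<psi>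
    using that unfolding Ext_def embeddings_iff_base_hom by auto
  have X_poly: "\<psi> (poly p a) = poly (map_poly \<phi> p) (\<psi> a)" if "\<psi> \<in> Ext" "p \<in> polys_over K" for \<psi> p
    using base_hom_poly[OF E XD(1)[OF that(1)] KE XD(2)[OF that(1)] \<phi>_simps(5) aE that(2)] by simp
  have "bij_betw (\<lambda>\<psi>. \<psi> a) Ext {b. poly q' b = 0}"
  proof (rule bij_betwI')
    fix \<psi> \<psi>' assume \<psi>: "\<psi> \<in> Ext" "\<psi>' \<in> Ext"
    have "\<psi> y = \<psi>' y" if "\<psi> a = \<psi>' a" "y \<in> E" for y
      using that X_poly[OF \<psi>(1)] X_poly[OF \<psi>(2)] unfolding E_eq by auto
    then show "(\<psi> a = \<psi>' a) = (\<psi> = \<psi>')" using extensionalityI[OF XD(3) XD(3)] \<psi> by metis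
  next
    fix \<psi> assume \<psi>: "\<psi> \<in> Ext"
    have "poly q' (\<psi> a) = \<psi> 0" using X_poly[OF \<psi> q(1)] q(3) by (simp add: q'_def)
    then show "\<psi> a \<in> {b. poly q' b = 0}" using base_hom_0[OF E XD(1)[OF \<psi>]] by simp
  next
    fix b assume b: "b \<in> {b. poly q' b = 0}"
    \<comment> \<open>The substitution of \<open>b\<close> for \<open>a\<close>. The choice of
      \<open>p\<close> does not matter: two candidates differ by a multiple of \<open>q\<close>,
      whose conjugate \<open>q'\<close> vanishes at \<open>b\<close>.\<close>
    define \<psi> where "\<psi> = (\<lambda>y\<in>E. poly (map_poly \<phi> (SOME p. p \<in> polys_over K \<and> poly p a = y)) b)"
    have \<psi>_poly: "\<psi> (poly p a) = poly (map_poly \<phi> p) b" if p: "p \<in> polys_over K" for p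
    proof -
      define p' where "p' = (SOME p'. p' \<in> polys_over K \<and> poly p' a = poly p a)"
      have p': "p' \<in> polys_over K" "poly p' a = poly p a"
        using someI[of "\<lambda>p'. p' \<in> polys_over K \<and> poly p' a = poly p a" p] p unfolding p'_def by auto
      have "poly (p' - p) a = 0" using p' by simp
      then obtain s where s: "s \<in> polys_over K" "p' - p = q * s" using min cl(4)[OF p'(1) p] by blast
      have "map_poly \<phi> p' - map_poly \<phi> p = map_poly \<phi> (q * s)"
        using map_poly_hom_diff[OF K(1) \<phi> p'(1) p] s(2) by metis
      also have "\<dots> = q' * map_poly \<phi> s"
        using map_poly_hom_mult[OF K(1) \<phi> q(1) s(1)] by (simp only: q'_def)
      finally have "map_poly \<phi> p' - map_poly \<phi> p = q' * map_poly \<phi> s" .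
      then have "poly (map_poly \<phi> p' - map_poly \<phi> p) b = poly q' b * poly (map_poly \<phi> s) b" by simp
      then have "poly (map_poly \<phi> p') b = poly (map_poly \<phi> p) b" using b by simp
      moreover have "poly p a \<in> E" unfolding E_eq using p by auto
      ultimately show ?thesis unfolding \<psi>_def p'_def by simp
    qed
    have \<psi>K: "\<psi> x = \<phi> x" if "x \<in> K" for x
      using \<psi>_poly[of "[:x:]"] that cl(1,6) \<phi>_simps(5) by (simp add: map_poly_pCons)
    have "base_hom E \<psi>"
      unfolding base_hom_def
    proof (intro conjI ballI)
      fix x y assume "x \<in> E" "y \<in> E"
      then obtain p r where pr: "p \<in> polys_over K" "r \<in> polys_over K" "x = poly p a" "y = poly r a"
        unfolding E_eq by auto
      show "\<psi> (x + y) = \<psi> x + \<psi> y" "\<psi> (x * y) = \<psi> x * \<psi> y"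
        using \<psi>_poly[OF cl(3)[OF pr(1,2)]] \<psi>_poly[OF cl(5)[OF pr(1,2)]] \<psi>_poly[OF pr(1)] \<psi>_poly[OF pr(2)]
          map_poly_hom_add[OF K(1) \<phi> pr(1,2)] map_poly_hom_mult[OF K(1) \<phi> pr(1,2)]
        by (simp_all add: pr(3,4))
    next
      show "\<psi> 1 = 1" using \<psi>K[OF subfield_kbarD(1)[OF K(1)]] \<phi>_simps by simp
      show "\<psi> c = c" if "c \<in> base" for c using \<psi>K[of c] \<phi>_simps(4)[OF that] K(2) that by auto
    qed
    then have "\<psi> \<in> Ext"
      unfolding Ext_def embeddings_iff_base_hom using \<psi>K by (auto simp: \<psi>_def)
    moreover have "\<psi> a = b"
    proof -
      have "[:0, 1:] \<in> polys_over K" using cl subfield_kbarD[OF K(1)] by auto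
      from \<psi>_poly[OF this] show ?thesis using \<phi>_simps by (simp add: map_poly_pCons)
    qed
    ultimately show "\<exists>\<psi>\<in>Ext. b = \<psi> a" by blast
  qed
  with fin card deg_eq show "finite Ext" "card Ext = ext_degree K E"
    using bij_betw_finite bij_betw_same_card by metis+
qed

section \<open>Finite extensions and degrees in towers\<close>

lemma finite_extD:
  assumes "finite_ext L"
  shows "subfield L kbar" "base \<subseteq> L" "kbar.finite_dimension base L"
  using assms unfolding finite_ext_def by auto

text \<open>A list spanning \<open>L\<close> over \<open>F\<close> spans it over \<open>K\<close>
  too; its \<open>K\<close>-span stays inside \<open>L\<close> because \<open>L\<close> is a
  \<open>K\<close>-subalgebra.\<close>

lemma finite_dimension_upper:
  fixes K :: "'k::field alg_closure set"
  assumes K: "subfield F kbar" "subfield K kbar" "F \<subseteq> K" and L: "subfield L kbar" "K \<subseteq> L" "kbar.finite_dimension F L"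
  shows "kbar.finite_dimension K L"
proof -
  obtain n where "kbar.dimension n F L" using L(3) unfolding kbar.finite_dimension_def by auto
  then obtain Us where Us: "kbar.Span F Us = L" using kbar.exists_base[OF K(1)] by blast
  have sub: "set Us \<subseteq> L" using kbar.Span_base_incl[OF K(1), of Us] Us by auto
  have "subalgebra K L kbar"
  proof (intro subalgebra.intro subalgebra_axioms.intro)
    show "subgroup L (add_monoid kbar)" using L(1) kbar.finite_dimension_imp_subalgebra[OF K(1) L(3)] by (simp add: subalgebra_def)
  qed (use L(2) subfield_kbarD(6)[OF L(1)] in auto)
  then have "kbar.Span K Us \<subseteq> L" using kbar.subalgebra_Span_incl[OF K(2) _ sub] by blast
  moreover have car: "set Us \<subseteq> carrier kbar" by simp
  have "kbar.Span F Us \<subseteq> kbar.Span K Us"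
    unfolding kbar.Span_eq_combine_set[OF K(1) car] kbar.Span_eq_combine_set[OF K(2) car]
    using K(3) by blast
  ultimately have "kbar.Span K Us = L" using Us by auto
  then show ?thesis using kbar.Span_finite_dimension[OF K(2), of Us] by simp
qed

lemma finite_dimension_lower:
  fixes K :: "'k::field alg_closure set"
  assumes K: "subfield F kbar" "F \<subseteq> K" "subfield K kbar" "K \<subseteq> L" "kbar.finite_dimension F L"
  shows "kbar.finite_dimension F K"
proof (rule kbar.subalbegra_incl_imp_finite_dimension[OF K(1,5) _ K(4)])
  show "subalgebra F K kbar"
  proof (intro subalgebra.intro subalgebra_axioms.intro)
    show "subgroup K (add_monoid kbar)"
      using subfieldE(1)[OF K(3)] by (simp add: subring_def)
  qed (use K(2) subfield_kbarD(6)[OF K(3)] in auto)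
qed

lemma ext_degree_tower:
  fixes K :: "'k::field alg_closure set"
  assumes K: "subfield F kbar" "subfield K kbar" "F \<subseteq> K" and L: "subfield L kbar" "K \<subseteq> L" "kbar.finite_dimension F L"
  shows "ext_degree F L = ext_degree F K * ext_degree K L"
  using kbar.telescopic_base_dim(2)[OF K(1,2) finite_dimension_lower[OF K(1,3,2) L(2,3)]
      finite_dimension_upper[OF K L]]
  by (simp add: ext_degree_def over_def)

lemma ext_degree_pos:
  fixes K :: "'k::field alg_closure set"
  assumes K: "subfield K kbar" "subfield L kbar" "kbar.finite_dimension K L"
  shows "ext_degree K L > 0"
proof (rule ccontr)
  assume "\<not> ext_degree K L > 0"
  then have "kbar.dimension 0 K L"
    using kbar.finite_dimensionE[OF K(1,3)] by (simp add: ext_degree_def over_def)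
  then have "L = {0}" using kbar.dimension_zero[OF K(1)] by simp
  then show False using subfield_kbarD(1)[OF K(2)] by auto
qed

text \<open>The list \<open>[1]\<close> is independent and has the length of a basis, so it spans
  \<open>L\<close>; but its span is \<open>K\<close>.\<close>

lemma ext_degree_eq_1:
  fixes K :: "'k::field alg_closure set"
  assumes K: "subfield K kbar" "K \<subseteq> L" "kbar.finite_dimension K L" "ext_degree K L = 1"
  shows "L = K"
proof -
  have dim: "kbar.dimension 1 K L"
    using kbar.finite_dimensionE[OF K(1,3)] K(4) by (simp add: ext_degree_def over_def)
  have "kbar.independent K [1]"
    using kbar.li_Cons[of 1 K "[]"] by (auto intro: kbar.li_Cons)
  then have "length [1 :: 'k alg_closure] = 1 \<longleftrightarrow> kbar.Span K [1] = L"
    using subfield_kbarD(1)[OF K(1)] K(2) by (intro kbar.independent_length_eq_dimension[OF K(1) dim]) auto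
  then have "kbar.Span K [1] = L" by simp
  moreover have car: "set [1 :: 'k alg_closure] \<subseteq> carrier kbar" by simp
  have "kbar.Span K [1] = K"
    unfolding kbar.Span_eq_combine_set_length_version[OF K(1) car]
  proof safe
    fix x assume "x \<in> K"
    then show "\<exists>Ks. x = kbar.combine Ks [1] \<and> length Ks = length [1 :: 'k alg_closure] \<and> set Ks \<subseteq> K"
      by (intro exI[of _ "[x]"]) auto
  qed (auto simp: length_Suc_conv)
  ultimately show ?thesis by simp
qed

text \<open>Induction on the degree, with a simple extension \<open>E\<close> in between: the
  extensions of \<open>\<phi>\<close> to \<open>L\<close> are sorted by their restriction to
  \<open>E\<close>, giving \<open>[E : K]\<close> classes of \<open>[L : E]\<close> elements. The
  homomorphism is arbitrary because the class over \<open>\<psi>\<close> is the same counting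
  problem with \<open>\<psi>\<close> for \<open>\<phi>\<close>; this also covers the inverses of
  embeddings that occur in norms.\<close>

theorem card_extensions:
  fixes K :: "'k::field alg_closure set"
  assumes perf: "perfect_field TYPE('k)"
    and K: "subfield K kbar" "base \<subseteq> K" and \<phi>: "base_hom K \<phi>"
    and L: "subfield L kbar" "K \<subseteq> L" "kbar.finite_dimension K L"
  shows "finite {\<psi> \<in> embeddings L UNIV. \<forall>x\<in>K. \<psi> x = \<phi> x} \<and>
         card {\<psi> \<in> embeddings L UNIV. \<forall>x\<in>K. \<psi> x = \<phi> x} = ext_degree K L"
  using K \<phi> L(2,3)
proof (induction "ext_degree K L" arbitrary: K \<phi> rule: less_induct)
  case less
  note K = less.prems(1,2) and \<phi> = less.prems(3) and KL = less.prems(4,5)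
  show ?case
  proof (cases "K = L")
    case True
    \<comment> \<open>Embeddings are extensional, so the only one is \<open>\<phi>\<close> cut off
      outside \<open>L\<close>.\<close>
    have "{\<psi> \<in> embeddings L UNIV. \<forall>x\<in>K. \<psi> x = \<phi> x} = {restrict \<phi> L}"
    proof (intro equalityI subsetI)
      fix \<psi> assume "\<psi> \<in> {\<psi> \<in> embeddings L UNIV. \<forall>x\<in>K. \<psi> x = \<phi> x}"
      then show "\<psi> \<in> {restrict \<phi> L}" unfolding embeddings_iff_base_hom True
        by (auto simp: extensional_def restrict_def)
    next
      fix \<psi> assume "\<psi> \<in> {restrict \<phi> L}"
      then show "\<psi> \<in> {\<psi> \<in> embeddings L UNIV. \<forall>x\<in>K. \<psi> x = \<phi> x}"
        using \<phi> True base_hom_cong[OF K(2,1), of \<phi> "restrict \<phi> K"] unfolding embeddings_iff_base_hom by auto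
    qed
    moreover have "ext_degree K L = 1"
      using kbar.dimI[OF K(1) kbar.dimension_one[OF K(1)]] True by (simp add: ext_degree_def over_def)
    ultimately show ?thesis by simp
  next
    case False
    then obtain a where a: "a \<in> L" "a \<notin> K" using KL by auto
    define E where "E = kbar.simple_extension K a"
    have E: "subfield E kbar" unfolding E_def
      using kbar.simple_extension_is_subfield[OF K(1)] algebraic_over_base[OF K, of a] by auto
    have KE: "K \<subseteq> E" unfolding E_def by (rule kbar.simple_extension_incl) auto
    have aE: "a \<in> E" unfolding E_def by (rule kbar.simple_extension_mem[OF subfieldE(1)[OF K(1)]]) auto
    have EL: "E \<subseteq> L" unfolding E_def
      by (rule kbar.simple_extension_subring_incl[OF subfieldE(1)[OF L(1)] KL(1) a(1)])
    have fE: "kbar.finite_dimension K E" by (rule finite_dimension_lower[OF K(1) KE E EL KL(2)])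
    have fL: "kbar.finite_dimension E L" by (rule finite_dimension_upper[OF K(1) E KE L(1) EL KL(2)])
    have tower: "ext_degree K L = ext_degree K E * ext_degree E L"
      by (rule ext_degree_tower[OF K(1) E KE L(1) EL KL(2)])
    have pos: "ext_degree K E > 0" "ext_degree E L > 0"
      by (rule ext_degree_pos[OF K(1) E fE], rule ext_degree_pos[OF E L(1) fL])
    have "ext_degree K E \<noteq> 1" using ext_degree_eq_1[OF K(1) KE fE] a aE by auto
    then have lt: "ext_degree E L < ext_degree K L" unfolding tower using pos by simp
    define Ext where "Ext = {\<psi> \<in> embeddings E UNIV. \<forall>x\<in>K. \<psi> x = \<phi> x}"
    define Y where "Y \<psi> = {\<chi> \<in> embeddings L UNIV. \<forall>x\<in>E. \<chi> x = \<psi> x}" for \<psi>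
    have Ext: "finite Ext" "card Ext = ext_degree K E"
      using card_extensions_simple[OF perf K \<phi>, of a] unfolding Ext_def E_def by auto
    have Y: "finite (Y \<psi>)" "card (Y \<psi>) = ext_degree E L" if "\<psi> \<in> Ext" for \<psi>
    proof -
      have "base_hom E \<psi>" using that unfolding Ext_def embeddings_iff_base_hom by auto
      from less.hyps[OF lt E _ this EL fL] show "finite (Y \<psi>)" "card (Y \<psi>) = ext_degree E L"
        using K(2) KE unfolding Y_def by auto
    qed
    have "{\<psi> \<in> embeddings L UNIV. \<forall>x\<in>K. \<psi> x = \<phi> x} = (\<Union>\<psi>\<in>Ext. Y \<psi>)"
    proof (intro equalityI subsetI)
      fix \<chi> assume \<chi>: "\<chi> \<in> {\<psi> \<in> embeddings L UNIV. \<forall>x\<in>K. \<psi> x = \<phi> x}"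
      then have "base_hom E \<chi>" using EL base_hom_subset unfolding embeddings_iff_base_hom by blast
      then have "base_hom E (restrict \<chi> E)"
        using base_hom_cong[OF _ E, of \<chi> "restrict \<chi> E"] K(2) KE by auto
      then have "restrict \<chi> E \<in> Ext" using \<chi> KE unfolding Ext_def embeddings_iff_base_hom by auto
      moreover have "\<chi> \<in> Y (restrict \<chi> E)" using \<chi> unfolding Y_def by auto
      ultimately show "\<chi> \<in> (\<Union>\<psi>\<in>Ext. Y \<psi>)" by blast
    next
      fix \<chi> assume "\<chi> \<in> (\<Union>\<psi>\<in>Ext. Y \<psi>)"
      then show "\<chi> \<in> {\<psi> \<in> embeddings L UNIV. \<forall>x\<in>K. \<psi> x = \<phi> x}" using KE unfolding Ext_def Y_def by fastforce
    qed
    moreover have "card (\<Union>\<psi>\<in>Ext. Y \<psi>) = (\<Sum>\<psi>\<in>Ext. card (Y \<psi>))"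
    proof (rule card_UN_disjoint)
      show "\<forall>\<psi>\<in>Ext. \<forall>\<psi>'\<in>Ext. \<psi> \<noteq> \<psi>' \<longrightarrow> Y \<psi> \<inter> Y \<psi>' = {}"
      proof (intro ballI impI, rule ccontr)
        fix \<psi> \<psi>' assume \<psi>: "\<psi> \<in> Ext" "\<psi>' \<in> Ext" "\<psi> \<noteq> \<psi>'" "Y \<psi> \<inter> Y \<psi>' \<noteq> {}"
        then have "\<forall>x\<in>E. \<psi> x = \<psi>' x" unfolding Y_def by force
        then have "\<psi> = \<psi>'" using \<psi>(1,2) extensionalityI[of \<psi> E \<psi>'] unfolding Ext_def embeddings_iff_base_hom
          by blast
        then show False using \<psi> by simp
      qed
    qed (use Ext Y in auto)
    moreover have "(\<Sum>\<psi>\<in>Ext. card (Y \<psi>)) = ext_degree K L" using Y Ext(2) tower by simp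
    moreover have "finite (\<Union>\<psi>\<in>Ext. Y \<psi>)" using Ext Y by auto
    ultimately show ?thesis by simp
  qed
qed

section \<open>Residue fields and closed points\<close>

text \<open>Residue fields are the case \<open>S = range x\<close>. Arbitrary generating sets serve
  the composite fields in the descent of norms.\<close>

definition adjoin :: "'k::field alg_closure set \<Rightarrow> 'k alg_closure set" where
  "adjoin S = generate_field kbar (base \<union> S)"

lemma subfield_adjoin: "subfield (adjoin S) kbar"
  unfolding adjoin_def by (rule field.generate_field_is_subfield[OF field_kbar]) auto

lemma base_subset_adjoin: "base \<subseteq> adjoin S" and subset_adjoin: "S \<subseteq> adjoin S"
  unfolding adjoin_def by (auto intro: generate_field.incl)

lemma adjoin_subset: "subfield E kbar \<Longrightarrow> base \<subseteq> E \<Longrightarrow> S \<subseteq> E \<Longrightarrow> adjoin S \<subseteq> E"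
  unfolding adjoin_def by (rule field.generate_field_min_subfield1[OF field_kbar]) auto

lemma finite_ext_adjoin:
  fixes S :: "'k::field alg_closure set"
  assumes "finite S"
  shows "finite_ext (adjoin S)"
proof -
  obtain xs where xs: "set xs = S" using finite_list[OF assms] by blast
  let ?E = "kbar.finite_extension base xs"
  have alg: "(kbar.algebraic over base) x" for x :: "'k alg_closure"
    by (rule algebraic_over_base[OF subfield_base order_refl])
  have E: "subfield ?E kbar" "kbar.finite_dimension base ?E" "base \<subseteq> ?E" "S \<subseteq> ?E"
    using kbar.finite_extension_is_subfield[OF subfield_base, of xs]
      kbar.finite_extension_finite_dimension(1)[OF subfield_base, of xs]
      kbar.finite_extension_incl[of base xs]
      kbar.finite_extension_mem[OF subfieldE(1)[OF subfield_base], of xs] alg xs by auto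
  then have "kbar.finite_dimension base (adjoin S)"
    using finite_dimension_lower[OF subfield_base base_subset_adjoin subfield_adjoin adjoin_subset]
    by blast
  then show ?thesis unfolding finite_ext_def using subfield_adjoin base_subset_adjoin by auto
qed

lemma residue_field_eq_adjoin: "residue_field x = adjoin (range x)"
  by (simp add: residue_field_def adjoin_def)

lemma subfield_residue_field: "subfield (residue_field x) kbar"
  and base_subset_residue_field: "base \<subseteq> residue_field x"
  and range_subset_residue_field: "range x \<subseteq> residue_field x"
  by (simp_all only: residue_field_eq_adjoin subfield_adjoin base_subset_adjoin subset_adjoin)

lemma residue_field_subset: "subfield E kbar \<Longrightarrow> base \<subseteq> E \<Longrightarrow> range x \<subseteq> E \<Longrightarrow> residue_field x \<subseteq> E"
  unfolding residue_field_eq_adjoin by (rule adjoin_subset)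

lemma finite_range_proj_space: "x \<in> proj_space N \<Longrightarrow> finite (range x)"
  by (rule finite_subset[of _ "insert 0 (x ` {..N})"]) (auto simp: proj_space_def not_le[symmetric])

lemma finite_ext_residue_field: "x \<in> proj_space N \<Longrightarrow> finite_ext (residue_field x)"
  unfolding residue_field_eq_adjoin by (intro finite_ext_adjoin finite_range_proj_space)

lemma residue_field_image:
  fixes L :: "'k::field alg_closure set"
  assumes L: "subfield L kbar" "base \<subseteq> L" and \<tau>: "base_hom L \<tau>" and x: "range x \<subseteq> L"
  shows "residue_field (\<tau> \<circ> x) = \<tau> ` residue_field x"
proof
  have sub: "residue_field x \<subseteq> L" by (rule residue_field_subset[OF L x])
  note rf = subfield_residue_field[of x]
  have \<tau>': "base_hom (residue_field x) \<tau>" by (rule base_hom_subset[OF \<tau> sub])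
  show "residue_field (\<tau> \<circ> x) \<subseteq> \<tau> ` residue_field x"
  proof (rule residue_field_subset[OF subfield_image[OF rf \<tau>']])
    show "base \<subseteq> \<tau> ` residue_field x"
      using base_subset_residue_field[of x] base_hom_base[OF rf \<tau>'] by (force simp: image_iff)
    show "range (\<tau> \<circ> x) \<subseteq> \<tau> ` residue_field x" using range_subset_residue_field[of x] by auto
  qed
  \<comment> \<open>For the reverse inclusion: this is a subfield containing \<open>k\<close> and
    the coordinates of \<open>x\<close>, hence all of the residue field.\<close>
  define E where "E = {z \<in> residue_field x. \<tau> z \<in> residue_field (\<tau> \<circ> x)}"
  have "residue_field x \<subseteq> E"
  proof (rule residue_field_subset)
    show "subfield E kbar"
      unfolding E_def subfield_kbar_iff
      using subfield_kbarD[OF rf] subfield_kbarD[OF subfield_residue_field[of "\<tau> \<circ> x"]]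
      by (auto simp: base_hom_simps[OF rf \<tau>'] base_hom_minus[OF rf \<tau>'] base_hom_inverse[OF rf \<tau>'])
    show "base \<subseteq> E" unfolding E_def using base_subset_residue_field base_hom_base[OF rf \<tau>'] by fastforce
    show "range x \<subseteq> E" unfolding E_def
      using range_subset_residue_field[of x] range_subset_residue_field[of "\<tau> \<circ> x"] by auto
  qed
  then show "\<tau> ` residue_field x \<subseteq> residue_field (\<tau> \<circ> x)" unfolding E_def by auto
qed

section \<open>The Galois action on points\<close>

lemma galois_group_iff: "\<sigma> \<in> galois_group \<longleftrightarrow> bij \<sigma> \<and> base_hom UNIV \<sigma>"
  by (auto simp: galois_group_def ring_iso_def ring_hom_def base_hom_def)

lemma galois_group_closed:
  shows "id \<in> galois_group"
    and "\<sigma> \<in> galois_group \<Longrightarrow> \<tau> \<in> galois_group \<Longrightarrow> \<sigma> \<circ> \<tau> \<in> galois_group"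
    and "\<sigma> \<in> galois_group \<Longrightarrow> inv_into UNIV \<sigma> \<in> galois_group"
proof -
  show "id \<in> galois_group" by (auto simp: galois_group_iff base_hom_def)
  show "\<sigma> \<in> galois_group \<Longrightarrow> \<tau> \<in> galois_group \<Longrightarrow> \<sigma> \<circ> \<tau> \<in> galois_group"
    by (auto simp: galois_group_iff bij_comp base_hom_def)
  assume \<sigma>: "\<sigma> \<in> galois_group"
  then have "base_hom (\<sigma> ` UNIV) (inv_into UNIV \<sigma>)"
    by (intro base_hom_inv_into subfield_UNIV) (auto simp: galois_group_iff)
  then show "inv_into UNIV \<sigma> \<in> galois_group"
    using \<sigma> by (auto simp: galois_group_iff bij_imp_bij_inv bij_is_surj)
qed

lemma galois_group_base_hom: "\<sigma> \<in> galois_group \<Longrightarrow> base_hom K \<sigma>"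
  by (auto simp: galois_group_iff base_hom_def)

lemma ext_degree_galois_image:
  fixes K :: "'k::field alg_closure set"
  assumes \<sigma>: "\<sigma> \<in> galois_group" and K: "subfield K kbar" "kbar.finite_dimension K L"
  shows "ext_degree (\<sigma> ` K) (\<sigma> ` L) = ext_degree K L"
proof -
  interpret h: ring_hom_ring kbar kbar \<sigma>
    using \<sigma> by unfold_locales (auto simp: galois_group_def ring_iso_def)
  have "inj_on \<sigma> L" using \<sigma> by (auto simp: galois_group_iff bij_def intro: inj_on_subset)
  then have "kbar.dimension (ext_degree K L) (\<sigma> ` K) (\<sigma> ` L)"
    using kbar.finite_dimensionE[OF K]
    by (intro h.inj_hom_dimension[OF K(1)]) (auto simp: ext_degree_def over_def)
  then show ?thesis
    using kbar.dimI[OF subfield_image[OF K(1) galois_group_base_hom[OF \<sigma>]]]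
    by (simp add: ext_degree_def over_def)
qed

text \<open>One inclusion holds for every \<open>\<sigma>\<close>; applying it to the inverse
  automorphism at the point \<open>\<sigma> \<circ> x\<close> gives the other.\<close>

lemma closed_point_galois:
  assumes \<sigma>: "\<sigma> \<in> galois_group"
  shows "closed_point (\<sigma> \<circ> x) = closed_point x"
proof -
  have "closed_point (\<sigma> \<circ> y) \<subseteq> closed_point y" if "\<sigma> \<in> galois_group" for \<sigma> :: "'a alg_closure \<Rightarrow> _" and y
    unfolding closed_point_def using galois_group_closed(2)[OF _ that] by (auto simp: comp_assoc[symmetric])
  from this[OF \<sigma>] this[OF galois_group_closed(3)[OF \<sigma>], of "\<sigma> \<circ> x"]
  show ?thesis
    using \<sigma> by (auto simp: comp_assoc[symmetric] galois_group_iff bij_is_inj)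
qed

text \<open>This is all that is known about the member of the orbit chosen by
  \<open>geom_pt\<close>. Computations with push-forwards have to absorb the automorphism
  \<open>\<sigma>\<close>.\<close>

lemma geom_pt_closed_point:
  obtains \<sigma> where "\<sigma> \<in> galois_group" "geom_pt (closed_point x) = \<sigma> \<circ> x"
proof -
  have "id \<circ> x \<in> closed_point x" unfolding closed_point_def using galois_group_closed(1) by blast
  then have "geom_pt (closed_point x) \<in> closed_point x" unfolding geom_pt_def by (rule someI[of "\<lambda>y. y \<in> closed_point x"])
  then show ?thesis using that unfolding closed_point_def by blast
qed

text \<open>A field homomorphism preserves the pattern of zero entries and fixes \<open>1\<close>,
  so normalised vectors stay normalised.\<close>

lemma comp_in_proj_space:
  fixes K :: "'k::field alg_closure set"
  assumes K: "subfield K kbar" and \<tau>: "base_hom K \<tau>" and x: "x \<in> proj_space N" "range x \<subseteq> K"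
  shows "\<tau> \<circ> x \<in> proj_space N"
proof -
  have "\<tau> (x i) = 0 \<longleftrightarrow> x i = 0" for i using base_hom_eq_0_iff[OF K \<tau>] x(2) by auto
  then show ?thesis using x base_hom_simps[OF K \<tau>] by (auto simp: proj_space_def)
qed

section \<open>Forms\<close>

lemma eval_mpoly_superset:
  assumes "finite S" "Poly_Mapping.keys p \<subseteq> S"
  shows "eval_mpoly p x = (\<Sum>m\<in>S. Poly_Mapping.lookup p m * (\<Prod>i\<in>Poly_Mapping.keys m. x i ^ Poly_Mapping.lookup m i))"
  unfolding eval_mpoly_def using assms by (intro sum.mono_neutral_left) (auto simp: in_keys_iff)

lemma eval_mpoly_add: "eval_mpoly (p + q) x = eval_mpoly p x + eval_mpoly q x"
proof -
  let ?S = "Poly_Mapping.keys p \<union> Poly_Mapping.keys q"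
  have "eval_mpoly r x = (\<Sum>m\<in>?S. Poly_Mapping.lookup r m * (\<Prod>i\<in>Poly_Mapping.keys m. x i ^ Poly_Mapping.lookup m i))"
    if "r \<in> {p, q, p + q}" for r
    using that keys_add[of p q] by (intro eval_mpoly_superset) auto
  then show ?thesis by (simp add: lookup_add distrib_right sum.distrib)
qed

text \<open>Replaces the supports of the various monomials by the common index range
  \<open>{..N}\<close>.\<close>

lemma form_monomial:
  assumes "p \<in> forms K N d" "m \<in> Poly_Mapping.keys p"
  shows "(\<Prod>i\<in>Poly_Mapping.keys m. x i ^ Poly_Mapping.lookup m i) = (\<Prod>i\<le>N. x i ^ Poly_Mapping.lookup m i)"
    and "(\<Sum>i\<le>N. Poly_Mapping.lookup m i) = d"
    and "Poly_Mapping.lookup p m \<in> K"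
proof -
  have m: "Poly_Mapping.keys m \<subseteq> {..N}" "(\<Sum>i\<in>Poly_Mapping.keys m. Poly_Mapping.lookup m i) = d"
    using assms unfolding forms_def by auto
  show "(\<Prod>i\<in>Poly_Mapping.keys m. x i ^ Poly_Mapping.lookup m i) = (\<Prod>i\<le>N. x i ^ Poly_Mapping.lookup m i)"
    using m(1) by (intro prod.mono_neutral_left) (auto simp: in_keys_iff)
  show "(\<Sum>i\<le>N. Poly_Mapping.lookup m i) = d"
    unfolding m(2)[symmetric] using m(1) by (intro sum.mono_neutral_right) (auto simp: in_keys_iff)
  show "Poly_Mapping.lookup p m \<in> K" using assms unfolding forms_def by auto
qed

lemma eval_form:
  assumes "p \<in> forms K N d"
  shows "eval_mpoly p x = (\<Sum>m\<in>Poly_Mapping.keys p. Poly_Mapping.lookup p m * (\<Prod>i\<le>N. x i ^ Poly_Mapping.lookup m i))"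
  unfolding eval_mpoly_def using form_monomial(1)[OF assms] by (intro sum.cong) auto

lemma eval_form_cong: "p \<in> forms K N d \<Longrightarrow> (\<And>i. i \<le> N \<Longrightarrow> x i = y i) \<Longrightarrow> eval_mpoly p x = eval_mpoly p y"
  unfolding eval_form by (intro sum.cong arg_cong2[where f = "(*)"] prod.cong) auto

lemma eval_form_scale:
  assumes p: "p \<in> forms K N d"
  shows "eval_mpoly p (\<lambda>i. c * x i) = c ^ d * eval_mpoly p x"
proof -
  have "(\<Prod>i\<le>N. (c * x i) ^ Poly_Mapping.lookup m i) = c ^ d * (\<Prod>i\<le>N. x i ^ Poly_Mapping.lookup m i)"
    if "m \<in> Poly_Mapping.keys p" for m
    using form_monomial(2)[OF p that] by (simp add: power_mult_distrib prod.distrib power_sum[symmetric])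
  then show ?thesis
    by (simp add: eval_form[OF p] sum_distrib_left mult.left_commute cong: sum.cong)
qed

lemma eval_form_hom:
  fixes K :: "'k::field alg_closure set"
  assumes K: "subfield K kbar" "base \<subseteq> K" and p: "p \<in> forms base N d" and x: "\<And>i. i \<le> N \<Longrightarrow> x i \<in> K"
  shows "eval_mpoly p x \<in> K" "base_hom K \<tau> \<Longrightarrow> \<tau> (eval_mpoly p x) = eval_mpoly p (\<tau> \<circ> x)"
proof -
  have c: "Poly_Mapping.lookup p m \<in> base" for m using p unfolding forms_def by auto
  have in_K: "(\<Prod>i\<le>N. x i ^ Poly_Mapping.lookup m i) \<in> K" for m
    using x subfield_kbarD[OF K(1)] by (intro subfield_prod[OF K(1)]) auto
  then show "eval_mpoly p x \<in> K"
    unfolding eval_form[OF p] using c K(2) subfield_kbarD[OF K(1)] by (intro subfield_sum[OF K(1)]) blast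
  assume \<tau>: "base_hom K \<tau>"
  have "\<tau> (\<Prod>i\<le>N. x i ^ Poly_Mapping.lookup m i) = (\<Prod>i\<le>N. \<tau> (x i) ^ Poly_Mapping.lookup m i)" for m
    using x subfield_kbarD[OF K(1)]
    by (subst base_hom_prod[OF K(1) \<tau>]) (auto simp: base_hom_power[OF K(1) \<tau>])
  then show "\<tau> (eval_mpoly p x) = eval_mpoly p (\<tau> \<circ> x)"
    unfolding eval_form[OF p] using c K(2) in_K subfield_kbarD[OF K(1)]
    by (subst base_hom_sum[OF K(1) \<tau>]) (auto simp: base_hom_mult[OF K(1) \<tau>] base_hom_base[OF K(1) \<tau>] subset_iff)
qed

text \<open>Forms seen through the functions they induce. The description of a morphism depends on
  these values only, and closure under products and substitution can be shown without computing the
  coefficients of a product.\<close>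

definition form_fun :: "'k::field alg_closure set \<Rightarrow> nat \<Rightarrow> nat \<Rightarrow> ((nat \<Rightarrow> 'k alg_closure) \<Rightarrow> 'k alg_closure) \<Rightarrow> bool" where
  "form_fun K N d f \<longleftrightarrow> (\<exists>p\<in>forms K N d. \<forall>x. eval_mpoly p x = f x)"

context
  fixes K :: "'k::field alg_closure set"
  assumes K: "subfield K kbar"
begin

lemma form_fun_0: "form_fun K N d (\<lambda>x. 0)"
  unfolding form_fun_def
  by (rule bexI[of _ 0]) (use subfield_kbarD[OF K] in \<open>auto simp: forms_def eval_mpoly_def\<close>)

lemma form_fun_add: "form_fun K N d f \<Longrightarrow> form_fun K N d g \<Longrightarrow> form_fun K N d (\<lambda>x. f x + g x)"
  unfolding form_fun_def
proof clarify
  fix p q assume pq: "p \<in> forms K N d" "q \<in> forms K N d" "\<forall>x. eval_mpoly p x = f x" "\<forall>x. eval_mpoly q x = g x"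
  have "p + q \<in> forms K N d"
    unfolding forms_def
  proof (intro CollectI conjI)
    show "range (Poly_Mapping.lookup (p + q)) \<subseteq> K"
      using pq(1,2) unfolding forms_def by (auto simp: lookup_add intro!: subfield_kbarD(5)[OF K])
    show "\<forall>m\<in>Poly_Mapping.keys (p + q). Poly_Mapping.keys m \<subseteq> {..N} \<and>
        (\<Sum>i\<in>Poly_Mapping.keys m. Poly_Mapping.lookup m i) = d"
      using pq(1,2) keys_add[of p q] unfolding forms_def by blast
  qed
  then show "\<exists>p\<in>forms K N d. \<forall>x. eval_mpoly p x = f x + g x"
    using pq(3,4) by (intro bexI[of _ "p + q"]) (auto simp: eval_mpoly_add)
qed

lemma form_fun_sum: "(\<And>j. j \<in> J \<Longrightarrow> form_fun K N d (f j)) \<Longrightarrow> form_fun K N d (\<lambda>x. \<Sum>j\<in>J. f j x)"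
  by (induction J rule: infinite_finite_induct) (auto intro: form_fun_0 form_fun_add)

lemma form_fun_monomial:
  assumes c: "c \<in> K" and d: "(\<Sum>i\<le>N. e i) = d"
  shows "form_fun K N d (\<lambda>x. c * (\<Prod>i\<le>N. x i ^ e i))"
proof -
  define m where "m = Abs_poly_mapping (\<lambda>i. if i \<le> N then e i else 0)"
  have m: "Poly_Mapping.lookup m i = (if i \<le> N then e i else 0)" for i
    unfolding m_def by (subst lookup_Abs_poly_mapping) auto
  have km: "Poly_Mapping.keys m \<subseteq> {..N}" by (auto simp: in_keys_iff m split: if_splits)
  define p where "p = Poly_Mapping.single m c"
  have "(\<Sum>i\<in>Poly_Mapping.keys m. Poly_Mapping.lookup m i) = (\<Sum>i\<le>N. Poly_Mapping.lookup m i)"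
    using km by (intro sum.mono_neutral_left) (auto simp: in_keys_iff)
  then have "p \<in> forms K N d"
    using c d km subfield_kbarD[OF K] unfolding forms_def p_def
    by (auto simp: lookup_single when_def m split: if_splits)
  moreover have "eval_mpoly p x = c * (\<Prod>i\<le>N. x i ^ e i)" for x
    unfolding eval_form[OF calculation] by (auto simp: p_def m)
  ultimately show ?thesis unfolding form_fun_def by blast
qed

lemma form_fun_mult:
  assumes "form_fun K N d f" "form_fun K N e g"
  shows "form_fun K N (d + e) (\<lambda>x. f x * g x)"
proof -
  obtain p q where p: "p \<in> forms K N d" "\<And>x. eval_mpoly p x = f x" and q: "q \<in> forms K N e" "\<And>x. eval_mpoly q x = g x"
    using assms unfolding form_fun_def by blast
  \<comment> \<open>The product is realised as a double sum of monomials, each of which is a form by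
    \<open>form_fun_monomial\<close>.\<close>
  have "form_fun K N (d + e) (\<lambda>x. \<Sum>m\<in>Poly_Mapping.keys p. \<Sum>m'\<in>Poly_Mapping.keys q.
      (Poly_Mapping.lookup p m * Poly_Mapping.lookup q m') *
      (\<Prod>i\<le>N. x i ^ (Poly_Mapping.lookup m i + Poly_Mapping.lookup m' i)))"
    using form_monomial(2,3)[OF p(1)] form_monomial(2,3)[OF q(1)] subfield_kbarD[OF K]
    by (intro form_fun_sum form_fun_monomial) (auto simp: sum.distrib)
  moreover have "f x * g x = (\<Sum>m\<in>Poly_Mapping.keys p. \<Sum>m'\<in>Poly_Mapping.keys q.
      (Poly_Mapping.lookup p m * Poly_Mapping.lookup q m') *
      (\<Prod>i\<le>N. x i ^ (Poly_Mapping.lookup m i + Poly_Mapping.lookup m' i)))" for x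
    unfolding p(2)[symmetric] q(2)[symmetric] eval_form[OF p(1)] eval_form[OF q(1)] sum_product
    by (simp add: power_add prod.distrib mult_ac)
  ultimately show ?thesis by simp
qed

lemma form_fun_const: "c \<in> K \<Longrightarrow> form_fun K N 0 (\<lambda>x. c)"
  using form_fun_monomial[of c "\<lambda>i. 0" N 0] by simp

lemma form_fun_coord: "j \<le> N \<Longrightarrow> form_fun K N 1 (\<lambda>x. x j)"
  using form_fun_monomial[of 1 "\<lambda>i. if i = j then 1 else 0" N 1] subfield_kbarD(1)[OF K]
  by (simp add: if_distrib[of "power _"] cong: if_cong)

lemma form_fun_power: "form_fun K N d f \<Longrightarrow> form_fun K N (d * n) (\<lambda>x. f x ^ n)"
  using subfield_kbarD[OF K] by (induction n) (auto simp: form_fun_const intro!: form_fun_mult)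

lemma form_fun_prod:
  "(\<And>j. j \<in> J \<Longrightarrow> form_fun K N (d j) (f j)) \<Longrightarrow> form_fun K N (\<Sum>j\<in>J. d j) (\<lambda>x. \<Prod>j\<in>J. f j x)"
  using subfield_kbarD[OF K]
  by (induction J rule: infinite_finite_induct) (auto intro!: form_fun_const form_fun_mult)

lemma form_fun_compose:
  assumes p: "p \<in> forms K M e" and F: "\<And>j. j \<le> M \<Longrightarrow> form_fun K N d (F j)"
  shows "form_fun K N (d * e) (\<lambda>x. eval_mpoly p (\<lambda>j. F j x))"
  unfolding eval_form[OF p]
proof (rule form_fun_sum)
  fix m assume m: "m \<in> Poly_Mapping.keys p"
  have "form_fun K N (0 + (\<Sum>j\<le>M. d * Poly_Mapping.lookup m j))
      (\<lambda>x. Poly_Mapping.lookup p m * (\<Prod>j\<le>M. F j x ^ Poly_Mapping.lookup m j))"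
    using F form_monomial(3)[OF p m] by (intro form_fun_mult form_fun_prod form_fun_power form_fun_const) auto
  then show "form_fun K N (d * e) (\<lambda>x. Poly_Mapping.lookup p m * (\<Prod>j\<le>M. F j x ^ Poly_Mapping.lookup m j))"
    using form_monomial(2)[OF p m] by (simp add: sum_distrib_left[symmetric])
qed

end

section \<open>Regular maps\<close>

text \<open>\<open>LEAST\<close> ranges over all indices while the hypothesis stops at
  \<open>N\<close>. The two vectors still have the same leading position, because \<open>v\<close>
  has a nonzero entry within the range.\<close>

lemma proj_class_scale:
  fixes v :: "nat \<Rightarrow> 'k::field alg_closure"
  assumes "\<And>i. i \<le> N \<Longrightarrow> w i = c * v i" "c \<noteq> 0" "\<exists>i\<le>N. v i \<noteq> 0"
  shows "proj_class N w = proj_class N v"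
proof -
  obtain i where i: "i \<le> N" "v i \<noteq> 0" using assms(3) by blast
  have "(LEAST i. v i \<noteq> 0) \<le> i" using i(2) by (rule Least_le)
  then have le: "(LEAST i. v i \<noteq> 0) \<le> N" using i by simp
  have "(LEAST i. w i \<noteq> 0) = (LEAST i. v i \<noteq> 0)"
  proof (rule Least_equality)
    show "w (LEAST i. v i \<noteq> 0) \<noteq> 0"
      using assms(1)[OF le] assms(2) LeastI[of "\<lambda>i. v i \<noteq> 0", OF i(2)] by simp
    fix j assume j: "w j \<noteq> 0"
    show "(LEAST i. v i \<noteq> 0) \<le> j"
    proof (cases "j \<le> N")
      case True
      then have "v j \<noteq> 0" using j assms(1) by auto
      then show ?thesis by (rule Least_le)
    qed (use le in simp)
  qed
  then show ?thesis unfolding proj_class_def using assms(1,2) le by auto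
qed

lemma proj_class_proj_space: "x \<in> proj_space N \<Longrightarrow> proj_class N x = x"
  unfolding proj_class_def proj_space_def by (auto simp: fun_eq_iff)

lemma proj_space_nonzero: "x \<in> proj_space N \<Longrightarrow> \<exists>i\<le>N. x i \<noteq> 0"
  unfolding proj_space_def using linorder_not_less by blast

lemma proj_class_eq_scale:
  assumes "\<exists>i\<le>N. v i \<noteq> 0"
  obtains c where "c \<noteq> 0" "\<And>i. i \<le> N \<Longrightarrow> v i = c * proj_class N v i"
proof -
  have "v (LEAST i. v i \<noteq> 0) \<noteq> 0" using assms LeastI[of "\<lambda>i. v i \<noteq> 0"] by blast
  then show ?thesis by (intro that[of "v (LEAST i. v i \<noteq> 0)"]) (auto simp: proj_class_def)
qed

lemma proj_class_hom:
  fixes K :: "'k::field alg_closure set"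
  assumes K: "subfield K kbar" and \<tau>: "base_hom K \<tau>" and v: "\<exists>i\<le>N. v i \<noteq> 0" "\<And>i. i \<le> N \<Longrightarrow> v i \<in> K"
  shows "proj_class N (\<tau> \<circ> v) = \<tau> \<circ> proj_class N v" "range (proj_class N v) \<subseteq> K"
proof -
  let ?l = "LEAST i. v i \<noteq> 0"
  obtain i where i: "i \<le> N" "v i \<noteq> 0" using v by blast
  have le: "?l \<le> N" using Least_le[of "\<lambda>i. v i \<noteq> 0", OF i(2)] i by simp
  have nz: "v ?l \<noteq> 0" using LeastI[of "\<lambda>i. v i \<noteq> 0", OF i(2)] .
  have "(LEAST i. (\<tau> \<circ> v) i \<noteq> 0) = ?l"
  proof (rule Least_equality)
    show "(\<tau> \<circ> v) ?l \<noteq> 0" using nz base_hom_eq_0_iff[OF K \<tau> v(2)[OF le]] by simp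
    fix j assume j: "(\<tau> \<circ> v) j \<noteq> 0"
    show "?l \<le> j"
    proof (cases "j \<le> N")
      case True
      then have "v j \<noteq> 0" using j base_hom_0[OF K \<tau>] by auto
      then show ?thesis by (rule Least_le)
    qed (use le in simp)
  qed
  then show "proj_class N (\<tau> \<circ> v) = \<tau> \<circ> proj_class N v"
    using v(2) le base_hom_0[OF K \<tau>] by (auto simp: proj_class_def fun_eq_iff base_hom_divide[OF K \<tau>])
  show "range (proj_class N v) \<subseteq> K"
    using v(2) le subfield_kbarD[OF K] by (auto simp: proj_class_def)
qed

text \<open>
  With a factor \<open>c\<close> that may vanish, the description of \<open>\<phi>\<close> by the forms holds on all of \<open>V\<close>.
\<close>

lemma regular_map_forms:
  assumes "regular_map N V M Y \<phi>" "x \<in> V"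
  shows "\<exists>d F. (\<forall>j\<le>M. F j \<in> forms base N d) \<and> (\<exists>j\<le>M. eval_mpoly (F j) x \<noteq> 0) \<and>
    (\<forall>y\<in>V. \<exists>c. \<forall>j\<le>M. eval_mpoly (F j) y = c * \<phi> y j)"
proof -
  obtain d F where F: "\<And>j. j \<le> M \<Longrightarrow> F j \<in> forms base N d" "\<exists>j\<le>M. eval_mpoly (F j) x \<noteq> 0"
    "\<And>y. y \<in> V \<Longrightarrow> \<exists>j\<le>M. eval_mpoly (F j) y \<noteq> 0 \<Longrightarrow> \<phi> y = proj_class M (\<lambda>j. eval_mpoly (F j) y)"
    using assms unfolding regular_map_def by blast
  have "\<exists>c. \<forall>j\<le>M. eval_mpoly (F j) y = c * \<phi> y j" if y: "y \<in> V" for y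
  proof (cases "\<exists>j\<le>M. eval_mpoly (F j) y \<noteq> 0")
    case True
    then show ?thesis using proj_class_eq_scale[OF True] F(3)[OF y] by metis
  qed (auto intro: exI[of _ 0])
  then show ?thesis using F(1,2) by blast
qed

text \<open>Converse of \<open>regular_map_forms\<close>: where the forms do not all vanish, the
  factor \<open>c\<close> is nonzero and normalising removes it.\<close>

lemma regular_mapI:
  fixes V :: "'k::field point set"
  assumes Y: "Y \<subseteq> proj_space M" and \<phi>: "\<phi> \<in> V \<rightarrow> Y"
    and ex: "\<And>x. x \<in> V \<Longrightarrow> \<exists>d F. (\<forall>j\<le>M. form_fun base N d (F j)) \<and> (\<exists>j\<le>M. F j x \<noteq> 0) \<and>
      (\<forall>y\<in>V. \<exists>c. \<forall>j\<le>M. F j y = c * \<phi> y j)"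
  shows "regular_map N V M Y \<phi>"
  unfolding regular_map_def
proof (intro conjI ballI)
  fix x assume "x \<in> V"
  from ex[OF this] obtain d F where F: "\<And>j. j \<le> M \<Longrightarrow> form_fun base N d (F j)" "\<exists>j\<le>M. F j x \<noteq> 0"
    "\<And>y. y \<in> V \<Longrightarrow> \<exists>c. \<forall>j\<le>M. F j y = c * \<phi> y j" by blast
  have "\<forall>j. \<exists>p. j \<le> M \<longrightarrow> p \<in> forms base N d \<and> (\<forall>y. eval_mpoly p y = F j y)"
    using F(1) unfolding form_fun_def by blast
  then obtain P where P: "\<And>j. j \<le> M \<Longrightarrow> P j \<in> forms base N d" "\<And>j y. j \<le> M \<Longrightarrow> eval_mpoly (P j) y = F j y"
    by metis
  have "\<phi> y = proj_class M (\<lambda>j. eval_mpoly (P j) y)" if y: "y \<in> V" "\<exists>j\<le>M. eval_mpoly (P j) y \<noteq> 0" for y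
  proof -
    obtain c where c: "\<And>j. j \<le> M \<Longrightarrow> F j y = c * \<phi> y j" using F(3)[OF y(1)] by blast
    then have "c \<noteq> 0" using y(2) P(2) by auto
    have "\<phi> y \<in> proj_space M" using Y \<phi> y(1) by auto
    then have "\<phi> y = proj_class M (\<phi> y)" by (rule proj_class_proj_space[symmetric])
    also have "\<dots> = proj_class M (\<lambda>j. eval_mpoly (P j) y)"
      using c P(2) \<open>c \<noteq> 0\<close> proj_space_nonzero[OF \<open>\<phi> y \<in> _\<close>] by (intro proj_class_scale[symmetric]) auto
    finally show ?thesis .
  qed
  then show "\<exists>d F. (\<forall>j\<le>M. F j \<in> forms base N d) \<and> (\<exists>j\<le>M. eval_mpoly (F j) x \<noteq> 0) \<and>
      (\<forall>y\<in>V. (\<exists>j\<le>M. eval_mpoly (F j) y \<noteq> 0) \<longrightarrow> \<phi> y = proj_class M (\<lambda>j. eval_mpoly (F j) y))"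
    using P F(2) by (intro exI[of _ d] exI[of _ P]) auto
qed (rule \<phi>)

lemma regular_map_compose:
  fixes V :: "'k::field point set"
  assumes \<phi>: "regular_map N V M Y \<phi>" and \<psi>: "regular_map M Y P Z \<psi>" and Z: "Z \<subseteq> proj_space P"
  shows "regular_map N V P Z (\<psi> \<circ> \<phi>)"
proof (rule regular_mapI[OF Z])
  show "\<psi> \<circ> \<phi> \<in> V \<rightarrow> Z" using \<phi> \<psi> unfolding regular_map_def by auto
  fix x assume x: "x \<in> V"
  have inY: "\<phi> y \<in> Y" if "y \<in> V" for y using \<phi> that unfolding regular_map_def by auto
  obtain d F where F: "\<And>j. j \<le> M \<Longrightarrow> F j \<in> forms base N d" "\<exists>j\<le>M. eval_mpoly (F j) x \<noteq> 0"
    "\<And>y. y \<in> V \<Longrightarrow> \<exists>c. \<forall>j\<le>M. eval_mpoly (F j) y = c * \<phi> y j" using regular_map_forms[OF \<phi> x] by blast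
  obtain e G where G: "\<And>j. j \<le> P \<Longrightarrow> G j \<in> forms base M e" "\<exists>j\<le>P. eval_mpoly (G j) (\<phi> x) \<noteq> 0"
    "\<And>y. y \<in> Y \<Longrightarrow> \<exists>c. \<forall>j\<le>P. eval_mpoly (G j) y = c * \<psi> y j" using regular_map_forms[OF \<psi> inY[OF x]] by blast
  \<comment> \<open>The forms of \<open>\<phi>\<close> are substituted into those of
    \<open>\<psi>\<close>. Evaluating at a multiple of \<open>\<phi> y\<close> by \<open>c\<close>
    costs the factor \<open>c ^ e\<close> by homogeneity; such a factor is permitted, and at
    \<open>x\<close> it is nonzero.\<close>
  let ?H = "\<lambda>j y. eval_mpoly (G j) (\<lambda>i. eval_mpoly (F i) y)"
  have H: "\<exists>c. (\<forall>j\<le>P. ?H j y = c ^ e * eval_mpoly (G j) (\<phi> y)) \<and> (\<forall>j\<le>M. eval_mpoly (F j) y = c * \<phi> y j)"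
    if y: "y \<in> V" for y
  proof -
    obtain c where c: "\<And>j. j \<le> M \<Longrightarrow> eval_mpoly (F j) y = c * \<phi> y j" using F(3)[OF y] by blast
    have "?H j y = c ^ e * eval_mpoly (G j) (\<phi> y)" if j: "j \<le> P" for j
      using eval_form_cong[OF G(1)[OF j], OF c] eval_form_scale[OF G(1)[OF j]] by simp
    then show ?thesis using c by blast
  qed
  show "\<exists>d F. (\<forall>j\<le>P. form_fun base N d (F j)) \<and> (\<exists>j\<le>P. F j x \<noteq> 0) \<and>
      (\<forall>y\<in>V. \<exists>c. \<forall>j\<le>P. F j y = c * (\<psi> \<circ> \<phi>) y j)"
  proof (rule exI[of _ "d * e"], rule exI[of _ ?H], intro conjI allI impI ballI)
    fix j assume "j \<le> P"
    show "form_fun base N (d * e) (?H j)"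
      using F(1) by (intro form_fun_compose[OF subfield_base G(1)[OF \<open>j \<le> P\<close>]]) (auto simp: form_fun_def)
  next
    obtain c where c: "\<forall>j\<le>P. ?H j x = c ^ e * eval_mpoly (G j) (\<phi> x)" "\<forall>j\<le>M. eval_mpoly (F j) x = c * \<phi> x j"
      using H[OF x] by blast
    have "c \<noteq> 0" using c(2) F(2) by auto
    then show "\<exists>j\<le>P. ?H j x \<noteq> 0" using c(1) G(2) by auto
  next
    fix y assume y: "y \<in> V"
    obtain c where c: "\<forall>j\<le>P. ?H j y = c ^ e * eval_mpoly (G j) (\<phi> y)" using H[OF y] by blast
    obtain c' where c': "\<forall>j\<le>P. eval_mpoly (G j) (\<phi> y) = c' * \<psi> (\<phi> y) j" using G(3)[OF inY[OF y]] by blast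
    show "\<exists>c. \<forall>j\<le>P. ?H j y = c * (\<psi> \<circ> \<phi>) y j"
      using c c' by (intro exI[of _ "c ^ e * c'"]) auto
  qed
qed

lemma regular_map_id:
  fixes V :: "'k::field point set"
  assumes V: "V \<subseteq> proj_space N"
  shows "regular_map N V N V (\<lambda>x. x)"
proof (rule regular_mapI[OF V])
  fix x assume "x \<in> V"
  then have "\<exists>j\<le>N. x j \<noteq> 0" using V proj_space_nonzero by blast
  then show "\<exists>d F. (\<forall>j\<le>N. form_fun base N d (F j)) \<and> (\<exists>j\<le>N. F j x \<noteq> 0) \<and>
      (\<forall>y\<in>V. \<exists>c. \<forall>j\<le>N. F j y = c * y j)"
    by (intro exI[of _ "1 :: nat"], intro exI[of _ "\<lambda>j x. x j"])
       (auto intro!: form_fun_coord[OF subfield_base, simplified] intro: exI[of _ "1 :: 'k alg_closure"])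
qed auto

lemma regular_map_const:
  fixes V :: "'k::field point set"
  assumes Y: "Y \<subseteq> proj_space M" and a: "a \<in> Y" "range a \<subseteq> base"
  shows "regular_map N V M Y (\<lambda>x. a)"
proof (rule regular_mapI[OF Y])
  fix x assume "x \<in> V"
  have "\<exists>j\<le>M. a j \<noteq> 0" using a Y proj_space_nonzero by blast
  then show "\<exists>d F. (\<forall>j\<le>M. form_fun base N d (F j)) \<and> (\<exists>j\<le>M. F j x \<noteq> 0) \<and>
      (\<forall>y\<in>V. \<exists>c. \<forall>j\<le>M. F j y = c * a j)"
    using a(2) by (intro exI[of _ "0 :: nat"], intro exI[of _ "\<lambda>j x. a j"])
       (auto intro!: form_fun_const[OF subfield_base] intro: exI[of _ "1 :: 'k alg_closure"])
qed (use a in auto)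

section \<open>The Segre embedding and equivariance of morphisms\<close>

lemma div_mod_mult_add: "j < n \<Longrightarrow> (i * n + j) div n = i" "j < n \<Longrightarrow> (i * n + j) mod n = j"
  for i j n :: nat
  by auto

text \<open>Segre coordinates are ordered lexicographically, so the first nonzero one belongs to the
  pair of leading positions of \<open>x\<close> and \<open>y\<close>, where its value is
  \<open>1 * 1\<close>.\<close>

lemma segre_proj_space:
  assumes x: "x \<in> proj_space N" and y: "y \<in> proj_space M"
  shows "segre M x y \<in> proj_space ((N + 1) * (M + 1) - 1)"
proof -
  let ?i = "LEAST i. x i \<noteq> 0" and ?j = "LEAST j. y j \<noteq> 0"
  have x1: "x ?i = 1" "\<And>i. i > N \<Longrightarrow> x i = 0" and y1: "y ?j = 1" "\<And>j. j > M \<Longrightarrow> y j = 0"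
    using x y unfolding proj_space_def by auto
  have j: "?j \<le> M" using y1 by (metis not_le zero_neq_one)
  let ?l = "?i * (M + 1) + ?j"
  have l: "?l div (M + 1) = ?i" "?l mod (M + 1) = ?j"
    using div_mod_mult_add[of ?j "M + 1" ?i] j by auto
  have s1: "segre M x y ?l = 1" unfolding segre_def l using x1 y1 by simp
  have "(LEAST l. segre M x y l \<noteq> 0) = ?l"
  proof (rule Least_equality)
    show "segre M x y ?l \<noteq> 0" using s1 by simp
    fix l assume "segre M x y l \<noteq> 0"
    then have "x (l div (M + 1)) \<noteq> 0" "y (l mod (M + 1)) \<noteq> 0" by (auto simp: segre_def)
    then have "?i \<le> l div (M + 1)" "?j \<le> l mod (M + 1)" by (auto intro: Least_le)
    then have "?i * (M + 1) + ?j \<le> (l div (M + 1)) * (M + 1) + l mod (M + 1)"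
      by (intro add_mono mult_right_mono) auto
    then show "?l \<le> l" by (simp only: div_mult_mod_eq)
  qed
  moreover have "segre M x y l = 0" if "l > (N + 1) * (M + 1) - 1" for l
  proof -
    have "(N + 1) * (M + 1) \<le> l" using that by simp
    then have "((N + 1) * (M + 1)) div (M + 1) \<le> l div (M + 1)" by (rule div_le_mono)
    moreover have "((N + 1) * (M + 1)) div (M + 1) = N + 1" by (rule nonzero_mult_div_cancel_right) simp
    ultimately have "N < l div (M + 1)" by simp
    then show ?thesis using x1(2) by (simp add: segre_def)
  qed
  ultimately show ?thesis using s1 unfolding proj_space_def by (auto intro!: exI[of _ ?l])
qed

lemma regular_map_segre:
  fixes V :: "'k::field point set"
  assumes f: "regular_map N V M Y f" and g: "regular_map N V M' Y' g"
    and Y: "Y \<subseteq> proj_space M" "Y' \<subseteq> proj_space M'"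
  shows "regular_map N V ((M + 1) * (M' + 1) - 1) {segre M' x y | x y. x \<in> Y \<and> y \<in> Y'} (\<lambda>x. segre M' (f x) (g x))"
proof (rule regular_mapI)
  show "{segre M' x y | x y. x \<in> Y \<and> y \<in> Y'} \<subseteq> proj_space ((M + 1) * (M' + 1) - 1)"
    using Y segre_proj_space by fast
  show "(\<lambda>x. segre M' (f x) (g x)) \<in> V \<rightarrow> {segre M' x y | x y. x \<in> Y \<and> y \<in> Y'}"
    using f g unfolding regular_map_def by fast
  fix x assume x: "x \<in> V"
  obtain d F where F: "\<And>j. j \<le> M \<Longrightarrow> F j \<in> forms base N d" "\<exists>j\<le>M. eval_mpoly (F j) x \<noteq> 0"
    "\<And>y. y \<in> V \<Longrightarrow> \<exists>c. \<forall>j\<le>M. eval_mpoly (F j) y = c * f y j" using regular_map_forms[OF f x] by blast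
  obtain e G where G: "\<And>j. j \<le> M' \<Longrightarrow> G j \<in> forms base N e" "\<exists>j\<le>M'. eval_mpoly (G j) x \<noteq> 0"
    "\<And>y. y \<in> V \<Longrightarrow> \<exists>c. \<forall>j\<le>M'. eval_mpoly (G j) y = c * g y j" using regular_map_forms[OF g x] by blast
  let ?L = "(M + 1) * (M' + 1) - 1"
  have bound: "l div (M' + 1) \<le> M" "l mod (M' + 1) \<le> M'" if "l \<le> ?L" for l
  proof -
    have "l < (M + 1) * (M' + 1)" using that by (metis One_nat_def add_gr_0 less_Suc_eq_le Suc_pred nat_0_less_mult_iff zero_less_one)
    then have "l div (M' + 1) < M + 1" by (simp add: less_mult_imp_div_less)
    then show "l div (M' + 1) \<le> M" by simp
    show "l mod (M' + 1) \<le> M'" using mod_less_divisor[of "M' + 1" l] by linarith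
  qed
  show "\<exists>d F. (\<forall>j\<le>?L. form_fun base N d (F j)) \<and> (\<exists>j\<le>?L. F j x \<noteq> 0) \<and>
      (\<forall>y\<in>V. \<exists>c. \<forall>j\<le>?L. F j y = c * segre M' (f y) (g y) j)"
  proof (rule exI[of _ "d + e"], rule exI[of _ "\<lambda>l y. eval_mpoly (F (l div (M' + 1))) y * eval_mpoly (G (l mod (M' + 1))) y"],
      intro conjI allI impI ballI)
    fix l assume "l \<le> ?L"
    show "form_fun base N (d + e) (\<lambda>y. eval_mpoly (F (l div (M' + 1))) y * eval_mpoly (G (l mod (M' + 1))) y)"
      using F(1)[OF bound(1)[OF \<open>l \<le> ?L\<close>]] G(1)[OF bound(2)[OF \<open>l \<le> ?L\<close>]]
      by (intro form_fun_mult[OF subfield_base]) (auto simp: form_fun_def)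
  next
    obtain i j where ij: "i \<le> M" "eval_mpoly (F i) x \<noteq> 0" "j \<le> M'" "eval_mpoly (G j) x \<noteq> 0" using F(2) G(2) by blast
    have "i * (M' + 1) + j \<le> M * (M' + 1) + M'" using ij by (intro add_mono mult_right_mono) auto
    then have "i * (M' + 1) + j \<le> ?L" by simp
    then show "\<exists>l\<le>?L. eval_mpoly (F (l div (M' + 1))) x * eval_mpoly (G (l mod (M' + 1))) x \<noteq> 0"
      using ij div_mod_mult_add[of j "M' + 1" i] by (intro exI[of _ "i * (M' + 1) + j"]) auto
  next
    fix y assume y: "y \<in> V"
    obtain c c' where "\<forall>j\<le>M. eval_mpoly (F j) y = c * f y j" "\<forall>j\<le>M'. eval_mpoly (G j) y = c' * g y j"
      using F(3)[OF y] G(3)[OF y] by blast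
    then show "\<exists>c. \<forall>j\<le>?L. eval_mpoly (F (j div (M' + 1))) y * eval_mpoly (G (j mod (M' + 1))) y
        = c * segre M' (f y) (g y) j"
      using bound by (intro exI[of _ "c * c'"]) (auto simp: segre_def)
  qed
qed

lemma regular_map_cong:
  "regular_map N V M Y f \<Longrightarrow> (\<And>x. x \<in> V \<Longrightarrow> f x = g x) \<Longrightarrow> regular_map N V M Y g"
  unfolding regular_map_def Pi_def by (simp cong: ball_cong)

text \<open>Forms over \<open>k\<close> that describe \<open>\<phi>\<close> near \<open>x\<close>
  also describe it at \<open>\<tau> \<circ> x\<close>: applying \<open>\<tau>\<close> to their
  values at \<open>x\<close> gives their values there, and these do not all vanish because
  \<open>\<tau>\<close> is injective.\<close>

lemma regular_map_hom:
  fixes K :: "'k::field alg_closure set"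
  assumes \<phi>: "regular_map N V M Y \<phi>" and K: "subfield K kbar" "base \<subseteq> K"
    and x: "x \<in> V" "range x \<subseteq> K"
  shows "range (\<phi> x) \<subseteq> K"
    and "base_hom K \<tau> \<Longrightarrow> \<tau> \<circ> x \<in> V \<Longrightarrow> \<phi> (\<tau> \<circ> x) = \<tau> \<circ> \<phi> x"
proof -
  obtain d F where F: "\<And>j. j \<le> M \<Longrightarrow> F j \<in> forms base N d" "\<exists>j\<le>M. eval_mpoly (F j) x \<noteq> 0"
    "\<And>y. y \<in> V \<Longrightarrow> \<exists>j\<le>M. eval_mpoly (F j) y \<noteq> 0 \<Longrightarrow> \<phi> y = proj_class M (\<lambda>j. eval_mpoly (F j) y)"
    using \<phi> x(1) unfolding regular_map_def by blast
  let ?v = "\<lambda>j. eval_mpoly (F j) x"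
  have v: "?v j \<in> K" if "j \<le> M" for j using eval_form_hom(1)[OF K F(1)[OF that], of x] x(2) by auto
  have eq: "\<phi> x = proj_class M ?v" using F(3)[OF x(1) F(2)] .
  show "range (\<phi> x) \<subseteq> K"
    unfolding eq using proj_class_hom(2)[OF K(1) _ F(2) v, of id] by (auto simp: base_hom_def)
  assume \<tau>: "base_hom K \<tau>" "\<tau> \<circ> x \<in> V"
  have hom: "\<tau> (?v j) = eval_mpoly (F j) (\<tau> \<circ> x)" if "j \<le> M" for j
    using eval_form_hom(2)[OF K F(1)[OF that] _ \<tau>(1), of x] x(2) by auto
  have nz: "\<exists>j\<le>M. eval_mpoly (F j) (\<tau> \<circ> x) \<noteq> 0"
    using F(2) hom base_hom_eq_0_iff[OF K(1) \<tau>(1) v] by metis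
  have "\<phi> (\<tau> \<circ> x) = proj_class M (\<lambda>j. eval_mpoly (F j) (\<tau> \<circ> x))" by (rule F(3)[OF \<tau>(2) nz])
  also have "\<dots> = proj_class M (\<tau> \<circ> ?v)"
    using hom nz by (intro proj_class_scale[where c = 1]) auto
  also have "\<dots> = \<tau> \<circ> \<phi> x" unfolding eq by (rule proj_class_hom(1)[OF K(1) \<tau>(1) F(2) v])
  finally show "\<phi> (\<tau> \<circ> x) = \<tau> \<circ> \<phi> x" .
qed

lemma zariski_closed_hom:
  fixes K :: "'k::field alg_closure set"
  assumes V: "zariski_closed base N V" and K: "subfield K kbar" "base \<subseteq> K"
    and x: "x \<in> V" "range x \<subseteq> K" and \<tau>: "base_hom K \<tau>"
  shows "\<tau> \<circ> x \<in> V"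
proof -
  obtain P where P: "P \<subseteq> (\<Union>d. forms base N d)" "V = {x \<in> proj_space N. \<forall>p\<in>P. eval_mpoly p x = 0}"
    using V unfolding zariski_closed_def by blast
  have "eval_mpoly p (\<tau> \<circ> x) = 0" if p: "p \<in> P" for p
  proof -
    obtain d where d: "p \<in> forms base N d" using P(1) p by blast
    have "\<And>i. i \<le> N \<Longrightarrow> x i \<in> K" using x(2) by auto
    then have "eval_mpoly p (\<tau> \<circ> x) = \<tau> (eval_mpoly p x)" by (rule eval_form_hom(2)[OF K d _ \<tau>, symmetric])
    then show ?thesis using x(1) p P(2) base_hom_0[OF K(1) \<tau>] by simp
  qed
  then show ?thesis using P(2) x comp_in_proj_space[OF K(1) \<tau>] by simp
qed

lemma zariski_closed_proj_space: "zariski_closed K N V \<Longrightarrow> V \<subseteq> proj_space N"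
  unfolding zariski_closed_def by auto

section \<open>Norms of rational points\<close>

lemma base_hom_preimage_subfield:
  fixes L M :: "'k::field alg_closure set"
  assumes L: "subfield L kbar" and M: "subfield M kbar" and \<tau>: "base_hom L \<tau>"
  shows "subfield {y \<in> L. \<tau> y \<in> M} kbar"
  unfolding subfield_kbar_iff
  using subfield_kbarD[OF L] subfield_kbarD[OF M]
  by (auto simp: base_hom_simps[OF L \<tau>] base_hom_minus[OF L \<tau>] base_hom_inverse[OF L \<tau>])

lemma base_hom_fixed_subfield:
  fixes L :: "'k::field alg_closure set"
  assumes L: "subfield L kbar" and \<tau>: "base_hom L \<tau>"
  shows "subfield {y \<in> L. \<tau> y = y} kbar"
  unfolding subfield_kbar_iff
  using subfield_kbarD[OF L]
  by (auto simp: base_hom_simps[OF L \<tau>] base_hom_minus[OF L \<tau>] base_hom_inverse[OF L \<tau>])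

text \<open>Turns finite extensions into finite sets of generators, so that the field generated by
  several of them is again finite over \<open>k\<close> by \<open>finite_ext_adjoin\<close>.\<close>

lemma finite_ext_generators:
  fixes L :: "'k::field alg_closure set"
  assumes "finite_ext L"
  obtains S where "finite S" "L = adjoin S"
proof -
  note L = finite_extD[OF assms]
  obtain n where "kbar.dimension n base L" using L(3) unfolding kbar.finite_dimension_def by auto
  then obtain Us where Us: "kbar.Span base Us = L" using kbar.exists_base[OF subfield_base] by blast
  have sub: "set Us \<subseteq> L" using kbar.Span_base_incl[OF subfield_base, of Us] Us by auto
  note ad = subfield_adjoin[of "set Us"]
  have "subalgebra base (adjoin (set Us)) kbar"
  proof (intro subalgebra.intro subalgebra_axioms.intro)
    show "subgroup (adjoin (set Us)) (add_monoid kbar)"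
      using subfieldE(1)[OF ad] by (simp add: subring_def)
  qed (use base_subset_adjoin[of "set Us"] subfield_kbarD(6)[OF ad] in auto)
  then have "L \<subseteq> adjoin (set Us)"
    using kbar.subalgebra_Span_incl[OF subfield_base _ subset_adjoin] Us by blast
  moreover have "adjoin (set Us) \<subseteq> L" by (rule adjoin_subset[OF L(1,2) sub])
  ultimately show ?thesis using that[of "set Us"] by auto
qed

text \<open>
  If \<open>z\<close> were not in \<open>K\<close>, all \<open>[M : K]\<close> extensions of the identity of \<open>K\<close> to \<open>M\<close> would extend the
  identity of the larger field \<open>K(z)\<close>, but there are only \<open>[M : K(z)]\<close> of those.
\<close>

lemma fixed_by_embeddings:
  fixes K :: "'k::field alg_closure set"
  assumes perf: "perfect_field TYPE('k)" and K: "finite_ext K" and M: "finite_ext M" and KM: "K \<subseteq> M"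
    and z: "z \<in> M" "\<And>\<rho>. \<rho> \<in> embeddings M UNIV \<Longrightarrow> \<forall>x\<in>K. \<rho> x = x \<Longrightarrow> \<rho> z = z"
  shows "z \<in> K"
proof (rule ccontr)
  assume nz: "z \<notin> K"
  note K' = finite_extD[OF K] and M' = finite_extD[OF M]
  define E where "E = adjoin (insert z K)"
  have E: "subfield E kbar" "base \<subseteq> E" "K \<subseteq> E" "z \<in> E"
    unfolding E_def using subset_adjoin[of "insert z K"]
    by (auto simp: subfield_adjoin base_subset_adjoin[THEN subsetD])
  have EM: "E \<subseteq> M" unfolding E_def using z KM M' by (intro adjoin_subset) auto
  have finKM: "kbar.finite_dimension K M" by (rule finite_dimension_upper[OF subfield_base K'(1,2) M'(1) KM M'(3)])
  have finEM: "kbar.finite_dimension E M" by (rule finite_dimension_upper[OF subfield_base E(1,2) M'(1) EM M'(3)])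
  have finKE: "kbar.finite_dimension K E" by (rule finite_dimension_lower[OF K'(1) E(3,1) EM finKM])
  have id: "base_hom F id" for F :: "'k alg_closure set" by (simp add: base_hom_def)
  have "{\<rho> \<in> embeddings M UNIV. \<forall>x\<in>K. \<rho> x = id x} = {\<rho> \<in> embeddings M UNIV. \<forall>x\<in>E. \<rho> x = id x}"
  proof safe
    fix \<rho> x assume \<rho>: "\<rho> \<in> embeddings M UNIV" "\<forall>x\<in>K. \<rho> x = id x" and "x \<in> E"
    have hom: "base_hom M \<rho>" using \<rho> by (simp add: embeddings_iff_base_hom)
    have "E \<subseteq> {y \<in> M. \<rho> y = y}"
      unfolding E_def using \<rho> z KM M'(2) base_hom_base[OF M'(1) hom]
      by (intro adjoin_subset base_hom_fixed_subfield[OF M'(1) hom]) auto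
    then show "\<rho> x = id x" using \<open>x \<in> E\<close> by auto
  qed (use E(3) in auto)
  then have "ext_degree K M = ext_degree E M"
    using card_extensions[OF perf K'(1,2) id M'(1) KM finKM] card_extensions[OF perf E(1,2) id M'(1) EM finEM]
    by simp
  moreover have "ext_degree K M = ext_degree K E * ext_degree E M"
    by (rule ext_degree_tower[OF K'(1) E(1,3) M'(1) EM finKM])
  ultimately have "ext_degree K E = 1" using ext_degree_pos[OF E(1) M'(1) finEM] by simp
  then have "E = K" using ext_degree_eq_1[OF K'(1) E(3) finKE] by simp
  then show False using E(4) nz by simp
qed

text \<open>On the image of \<open>K\<close> the condition says that \<open>\<tau>\<close> extends
  the inverse of \<open>\<sigma>\<close>, so \<open>card_extensions\<close> counts the conjugates
  that enter a norm.\<close>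

lemma extensions_of_inverse:
  fixes K L :: "'k::field alg_closure set"
  assumes perf: "perfect_field TYPE('k)" and K: "finite_ext K" and L: "finite_ext L" and \<sigma>: "\<sigma> \<in> embeddings K L"
  defines "T \<equiv> {\<tau> \<in> embeddings L UNIV. \<forall>x\<in>K. \<tau> (\<sigma> x) = x}"
  shows "finite T" "card T = ext_degree (\<sigma> ` K) L"
proof -
  note K' = finite_extD[OF K] and L' = finite_extD[OF L]
  have \<sigma>': "base_hom K \<sigma>" "\<sigma> ` K \<subseteq> L" using \<sigma> by (auto simp: embeddings_iff_base_hom)
  have sf: "subfield (\<sigma> ` K) kbar" by (rule subfield_image[OF K'(1) \<sigma>'(1)])
  have sb: "base \<subseteq> \<sigma> ` K" using base_hom_base[OF K'(1) \<sigma>'(1)] K'(2) by (force simp: image_iff)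
  have inj: "inj_on \<sigma> K" by (rule base_hom_inj[OF K'(1) \<sigma>'(1)])
  have "T = {\<tau> \<in> embeddings L UNIV. \<forall>y\<in>\<sigma> ` K. \<tau> y = inv_into K \<sigma> y}"
    unfolding T_def using inj by auto
  then show "finite T" "card T = ext_degree (\<sigma> ` K) L"
    using card_extensions[OF perf sf sb base_hom_inv_into[OF K'(1,2) \<sigma>'(1)] L'(1) \<sigma>'(2)
        finite_dimension_upper[OF subfield_base sf sb L'(1) \<sigma>'(2) L'(3)]] by auto
qed

section \<open>Rational points and norms on an abelian variety\<close>

locale abelian_var =
  fixes A :: "'k::field abvar"
  assumes perfect: "perfect_field TYPE('k)" and abelian: "abelian_variety A"
begin

lemma carrier_closed: "zariski_closed base (ambient A) (carrier A)"
  using abelian unfolding abelian_variety_def by blast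

lemma carrier_proj_space: "carrier A \<subseteq> proj_space (ambient A)"
  by (rule zariski_closed_proj_space[OF carrier_closed])

sublocale A: comm_group A
  using abelian unfolding abelian_variety_def by blast

lemma one_rational: "\<one>\<^bsub>A\<^esub> \<in> carrier A" "range \<one>\<^bsub>A\<^esub> \<subseteq> base"
  using abelian unfolding abelian_variety_def by auto

abbreviation segre_square :: "'k point set" where
  "segre_square \<equiv> {segre (ambient A) x y | x y. x \<in> carrier A \<and> y \<in> carrier A}"

lemma mult_regular:
  obtains \<mu> where
    "regular_map ((ambient A + 1) * (ambient A + 1) - 1) segre_square (ambient A) (carrier A) \<mu>"
    "\<And>x y. x \<in> carrier A \<Longrightarrow> y \<in> carrier A \<Longrightarrow> \<mu> (segre (ambient A) x y) = x \<otimes>\<^bsub>A\<^esub> y"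
  using abelian unfolding abelian_variety_def by blast

lemma regular_map_mult:
  assumes f: "regular_map N V (ambient A) (carrier A) f" and g: "regular_map N V (ambient A) (carrier A) g"
  shows "regular_map N V (ambient A) (carrier A) (\<lambda>x. f x \<otimes>\<^bsub>A\<^esub> g x)"
proof -
  obtain \<mu> where \<mu>: "regular_map ((ambient A + 1) * (ambient A + 1) - 1) segre_square (ambient A) (carrier A) \<mu>"
    "\<And>x y. x \<in> carrier A \<Longrightarrow> y \<in> carrier A \<Longrightarrow> \<mu> (segre (ambient A) x y) = x \<otimes>\<^bsub>A\<^esub> y"
    using mult_regular by blast
  have "regular_map N V (ambient A) (carrier A) (\<mu> \<circ> (\<lambda>x. segre (ambient A) (f x) (g x)))"
    by (rule regular_map_compose[OF regular_map_segre[OF f g carrier_proj_space carrier_proj_space] \<mu>(1) carrier_proj_space])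
  then show ?thesis
    by (rule regular_map_cong) (use f g \<mu>(2) in \<open>auto simp: regular_map_def Pi_iff\<close>)
qed

lemma regular_map_pow: "regular_map (ambient A) (carrier A) (ambient A) (carrier A) (\<lambda>x. x [^]\<^bsub>A\<^esub> (n :: nat))"
proof (induction n)
  case 0
  show ?case using regular_map_const[OF carrier_proj_space one_rational] by simp
next
  case (Suc n)
  show ?case using regular_map_mult[OF Suc regular_map_id[OF carrier_proj_space]] by simp
qed

lemma rational_pointsD: "x \<in> rational_points A K \<Longrightarrow> x \<in> carrier A" "x \<in> rational_points A K \<Longrightarrow> range x \<subseteq> K"
  by (auto simp: rational_points_def)

lemma rational_points_residue_field: "x \<in> carrier A \<Longrightarrow> x \<in> rational_points A (residue_field x)"
  using range_subset_residue_field by (auto simp: rational_points_def)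

context
  fixes K :: "'k alg_closure set" assumes K: "subfield K kbar" "base \<subseteq> K"
begin

lemma base_hom_rational_points: "x \<in> rational_points A K \<Longrightarrow> base_hom K \<tau> \<Longrightarrow> \<tau> ` K \<subseteq> L \<Longrightarrow> \<tau> \<circ> x \<in> rational_points A L"
  using zariski_closed_hom[OF carrier_closed K, of x \<tau>] by (auto simp: rational_points_def)

text \<open>The group law is a morphism on the Segre image. The Segre vector of two
  \<open>K\<close>-points has entries in \<open>K\<close> and is compatible with
  \<open>\<tau>\<close>, so both claims are instances of \<open>regular_map_hom\<close>.\<close>

lemma rational_points_mult:
  assumes x: "x \<in> rational_points A K" and y: "y \<in> rational_points A K"
  shows "x \<otimes>\<^bsub>A\<^esub> y \<in> rational_points A K"
    and "base_hom K \<tau> \<Longrightarrow> \<tau> \<circ> (x \<otimes>\<^bsub>A\<^esub> y) = (\<tau> \<circ> x) \<otimes>\<^bsub>A\<^esub> (\<tau> \<circ> y)"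
proof -
  obtain \<mu> where \<mu>: "regular_map ((ambient A + 1) * (ambient A + 1) - 1) segre_square (ambient A) (carrier A) \<mu>"
    "\<And>x y. x \<in> carrier A \<Longrightarrow> y \<in> carrier A \<Longrightarrow> \<mu> (segre (ambient A) x y) = x \<otimes>\<^bsub>A\<^esub> y"
    using mult_regular by blast
  note xy = rational_pointsD[OF x] rational_pointsD[OF y]
  let ?s = "segre (ambient A) x y"
  have s: "?s \<in> segre_square" "range ?s \<subseteq> K"
    using xy by (blast, auto simp: segre_def intro!: subfield_kbarD(6)[OF K(1)])
  note eq = \<mu>(2)[OF xy(1) xy(3), symmetric]
  show "x \<otimes>\<^bsub>A\<^esub> y \<in> rational_points A K"
    using regular_map_hom(1)[OF \<mu>(1) K s] A.m_closed[OF xy(1,3)] unfolding rational_points_def eq by simp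
  assume \<tau>: "base_hom K \<tau>"
  have \<tau>s: "\<tau> \<circ> ?s = segre (ambient A) (\<tau> \<circ> x) (\<tau> \<circ> y)"
    using xy base_hom_mult[OF K(1) \<tau>] by (auto simp: segre_def fun_eq_iff)
  have \<tau>xy: "\<tau> \<circ> x \<in> carrier A" "\<tau> \<circ> y \<in> carrier A"
    using base_hom_rational_points[OF _ \<tau> subset_UNIV] x y rational_pointsD(1) by blast+
  then have "\<tau> \<circ> ?s \<in> segre_square" unfolding \<tau>s by blast
  from regular_map_hom(2)[OF \<mu>(1) K s \<tau> this] show "\<tau> \<circ> (x \<otimes>\<^bsub>A\<^esub> y) = (\<tau> \<circ> x) \<otimes>\<^bsub>A\<^esub> (\<tau> \<circ> y)"
    unfolding \<tau>s \<mu>(2)[OF \<tau>xy] eq by simp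
qed

lemma rational_points_one: "\<one>\<^bsub>A\<^esub> \<in> rational_points A K"
  using one_rational K by (auto simp: rational_points_def)

lemma rational_points_pow: "x \<in> rational_points A K \<Longrightarrow> x [^]\<^bsub>A\<^esub> (n :: nat) \<in> rational_points A K"
  by (induction n) (auto intro: rational_points_one rational_points_mult)

lemma base_hom_one: "base_hom K \<tau> \<Longrightarrow> \<tau> \<circ> \<one>\<^bsub>A\<^esub> = \<one>\<^bsub>A\<^esub>"
  using one_rational(2) base_hom_base[OF K(1)] by (auto simp: fun_eq_iff)

lemma base_hom_pow:
  assumes x: "x \<in> rational_points A K" and \<tau>: "base_hom K \<tau>"
  shows "\<tau> \<circ> (x [^]\<^bsub>A\<^esub> (n :: nat)) = (\<tau> \<circ> x) [^]\<^bsub>A\<^esub> n"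
  using x \<tau> by (induction n) (auto simp: base_hom_one rational_points_mult rational_points_pow)

lemma rational_points_finprod:
  assumes "finite I" "f \<in> I \<rightarrow> rational_points A K" "base_hom K \<tau>"
  shows "finprod A f I \<in> rational_points A K \<and> \<tau> \<circ> finprod A f I = finprod A (\<lambda>i. \<tau> \<circ> f i) I"
  using assms
proof (induction I rule: finite_induct)
  case empty
  then show ?case by (simp add: rational_points_one base_hom_one)
next
  case (insert i I)
  have f: "f \<in> I \<rightarrow> carrier A" "f i \<in> carrier A" "f i \<in> rational_points A K"
    using insert.prems(1) by (auto simp: rational_points_def)
  have \<tau>f: "(\<lambda>i. \<tau> \<circ> f i) \<in> I \<rightarrow> carrier A" "\<tau> \<circ> f i \<in> carrier A"
    using base_hom_rational_points[OF _ insert.prems(2) subset_UNIV] insert.prems(1) rational_pointsD(1) by blast+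
  have IH: "finprod A f I \<in> rational_points A K" "\<tau> \<circ> finprod A f I = finprod A (\<lambda>i. \<tau> \<circ> f i) I"
    using insert.IH insert.prems by (auto simp: comp_def)
  have "finprod A f (insert i I) = f i \<otimes>\<^bsub>A\<^esub> finprod A f I"
    using insert.hyps f by simp
  moreover have "finprod A (\<lambda>i. \<tau> \<circ> f i) (insert i I) = (\<tau> \<circ> f i) \<otimes>\<^bsub>A\<^esub> finprod A (\<lambda>i. \<tau> \<circ> f i) I"
    by (rule A.finprod_insert[OF insert.hyps \<tau>f])
  ultimately show ?case using rational_points_mult[OF f(3) IH(1)] insert.prems(2) IH(2) by (simp add: comp_def)
qed

end

text \<open>Each \<open>\<tau>\<close> undoes \<open>\<sigma>\<close>, so every factor of the norm
  is \<open>b\<close> itself and only the number of factors counts.\<close>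

lemma norm_pt_restrict:
  assumes K: "finite_ext K" and L: "finite_ext L" and \<sigma>: "\<sigma> \<in> embeddings K L" and b: "b \<in> rational_points A K"
  shows "norm_pt A K L \<sigma> (restrict_pt \<sigma> b) = b [^]\<^bsub>A\<^esub> ext_degree (\<sigma> ` K) L"
proof -
  have "norm_pt A K L \<sigma> (restrict_pt \<sigma> b) = finprod A (\<lambda>\<tau>. b) {\<tau> \<in> embeddings L UNIV. \<forall>x\<in>K. \<tau> (\<sigma> x) = x}"
    unfolding norm_pt_def restrict_pt_def
  proof (rule A.finprod_cong')
    fix \<tau> assume "\<tau> \<in> {\<tau> \<in> embeddings L UNIV. \<forall>x\<in>K. \<tau> (\<sigma> x) = x}"
    then show "\<tau> \<circ> (\<sigma> \<circ> b) = b" using rational_pointsD[OF b] by (auto simp: fun_eq_iff)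
  qed (use rational_pointsD[OF b] in auto)
  also have "\<dots> = b [^]\<^bsub>A\<^esub> ext_degree (\<sigma> ` K) L"
    by (subst A.finprod_const[OF rational_pointsD(1)[OF b]]) (simp only: extensions_of_inverse(2)[OF perfect K L \<sigma>])
  finally show ?thesis .
qed

text \<open>Galois descent: every embedding of a large field \<open>M\<close> that fixes
  \<open>K\<close> permutes the conjugates of \<open>a\<close>, hence fixes their product, and
  \<open>fixed_by_embeddings\<close> puts its coordinates into \<open>K\<close>. With this, the
  projection relations involve genuine symbols over \<open>K\<close>.\<close>

lemma norm_pt_rational:
  assumes K: "finite_ext K" and L: "finite_ext L" and \<sigma>: "\<sigma> \<in> embeddings K L" and a: "a \<in> rational_points A L"
  shows "norm_pt A K L \<sigma> a \<in> rational_points A K"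
proof -
  note K' = finite_extD[OF K] and L' = finite_extD[OF L]
  define T where "T = {\<tau> \<in> embeddings L UNIV. \<forall>x\<in>K. \<tau> (\<sigma> x) = x}"
  have finT: "finite T" unfolding T_def by (rule extensions_of_inverse(1)[OF perfect K L \<sigma>])
  have T: "base_hom L \<tau>" if "\<tau> \<in> T" for \<tau> using that by (auto simp: T_def embeddings_iff_base_hom)
  define Nm where "Nm = norm_pt A K L \<sigma> a"
  have Nm_eq: "Nm = finprod A (\<lambda>\<tau>. \<tau> \<circ> a) T" unfolding Nm_def norm_pt_def T_def ..
  have \<tau>a: "\<tau> \<circ> a \<in> carrier A" if "\<tau> \<in> T" for \<tau>
    using base_hom_rational_points[OF L'(1,2) a T[OF that] subset_UNIV] rational_pointsD(1) by blast
  then have Nm: "Nm \<in> carrier A" unfolding Nm_eq by (intro A.finprod_closed) auto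
  obtain S\<^sub>K S\<^sub>L where S: "finite S\<^sub>K" "K = adjoin S\<^sub>K" "finite S\<^sub>L" "L = adjoin S\<^sub>L"
    using finite_ext_generators[OF K] finite_ext_generators[OF L] by metis
  \<comment> \<open>\<open>M\<close> must be finite over \<open>k\<close>, hence the finite
    generating sets. It contains \<open>K\<close> and the fields \<open>\<tau>(L)\<close>, so that
    \<open>\<rho>\<close> can be composed with each \<open>\<tau>\<close>; the coordinates of the
    norm are adjoined so that \<open>\<rho>\<close> acts on them.\<close>
  define G where "G = S\<^sub>K \<union> range Nm \<union> (\<Union>\<tau>\<in>T. \<tau> ` S\<^sub>L)"
  define M where "M = adjoin G"
  have "finite G"
    unfolding G_def using S finT finite_range_proj_space carrier_proj_space Nm by blast
  then have M: "finite_ext M" unfolding M_def by (rule finite_ext_adjoin)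
  note M' = finite_extD[OF M]
  have GM: "G \<subseteq> M" unfolding M_def by (rule subset_adjoin)
  have KM: "K \<subseteq> M" unfolding S(2) using GM M' by (intro adjoin_subset) (auto simp: G_def)
  have \<tau>M: "\<tau> ` L \<subseteq> M" if \<tau>: "\<tau> \<in> T" for \<tau>
  proof -
    have "\<tau> ` S\<^sub>L \<subseteq> M" using GM \<tau> unfolding G_def by blast
    moreover have "S\<^sub>L \<subseteq> L" unfolding S(4) by (rule subset_adjoin)
    ultimately have "adjoin S\<^sub>L \<subseteq> {y \<in> L. \<tau> y \<in> M}"
      using base_hom_base[OF L'(1) T[OF \<tau>]] L'(2) M'(2)
      by (intro adjoin_subset base_hom_preimage_subfield[OF L'(1) M'(1) T[OF \<tau>]]) auto
    then show ?thesis using S(4) by blast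
  qed
  have fixed: "\<rho> \<circ> Nm = Nm" if \<rho>: "\<rho> \<in> embeddings M UNIV" "\<forall>x\<in>K. \<rho> x = x" for \<rho>
  proof -
    have hom: "base_hom M \<rho>" using \<rho> by (simp add: embeddings_iff_base_hom)
    \<comment> \<open>Composition with \<open>\<rho>\<close>, cut off outside \<open>L\<close> to be
      extensional again. Being injective on the finite set \<open>T\<close>, it permutes
      \<open>T\<close>, which only reorders the factors of the norm.\<close>
    define h where "h \<tau> = restrict (\<rho> \<circ> \<tau>) L" for \<tau>
    have "h \<tau> \<in> T" if \<tau>: "\<tau> \<in> T" for \<tau>
    proof -
      have "base_hom L (\<rho> \<circ> \<tau>)"
        using base_hom_comp[OF L'(1) T[OF \<tau>]] base_hom_subset[OF hom \<tau>M[OF \<tau>]] by blast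
      then have "base_hom L (h \<tau>)" using base_hom_cong[OF L'(2,1), of "\<rho> \<circ> \<tau>" "h \<tau>"] by (simp add: h_def)
      moreover have "\<sigma> x \<in> L" if "x \<in> K" for x using \<sigma> that by (auto simp: embeddings_iff)
      ultimately show ?thesis
        using \<rho>(2) \<tau> unfolding T_def embeddings_iff_base_hom by (auto simp: h_def)
    qed
    moreover have "inj_on h T"
    proof (rule inj_onI)
      fix \<tau> \<tau>' assume \<tau>: "\<tau> \<in> T" "\<tau>' \<in> T" "h \<tau> = h \<tau>'"
      have "\<tau> x = \<tau>' x" if "x \<in> L" for x
      proof -
        have "\<rho> (\<tau> x) = \<rho> (\<tau>' x)" using fun_cong[OF \<tau>(3), of x] that by (simp add: h_def)
        moreover have "\<tau> x \<in> M" "\<tau>' x \<in> M" using \<tau>M \<tau>(1,2) that by auto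
        ultimately show ?thesis using base_hom_inj[OF M'(1) hom] by (auto dest: inj_onD)
      qed
      moreover have "\<tau> \<in> extensional L" "\<tau>' \<in> extensional L" using \<tau> by (auto simp: T_def embeddings_iff)
      ultimately show "\<tau> = \<tau>'" by (rule extensionalityI[rotated 2])
    qed
    ultimately have hT: "h ` T = T" using finT by (intro endo_inj_surj) auto
    have ha: "h \<tau> \<circ> a = \<rho> \<circ> (\<tau> \<circ> a)" for \<tau>
      using rational_pointsD(2)[OF a] by (auto simp: h_def fun_eq_iff)
    have "(\<lambda>\<tau>. \<tau> \<circ> a) \<in> T \<rightarrow> rational_points A M"
      by (rule Pi_I) (rule base_hom_rational_points[OF L'(1,2) a T \<tau>M])
    then have "\<rho> \<circ> Nm = finprod A (\<lambda>\<tau>. \<rho> \<circ> (\<tau> \<circ> a)) T"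
      unfolding Nm_eq using rational_points_finprod[OF M'(1,2) finT _ hom] by blast
    also have "\<dots> = finprod A (\<lambda>\<tau>. h \<tau> \<circ> a) T" by (simp only: ha)
    also have "\<dots> = finprod A (\<lambda>\<tau>. \<tau> \<circ> a) (h ` T)"
      by (rule A.finprod_reindex[OF _ \<open>inj_on h T\<close>, symmetric], unfold hT) (rule Pi_I, rule \<tau>a)
    finally show ?thesis unfolding hT Nm_eq .
  qed
  have "Nm i \<in> K" for i
  proof (rule fixed_by_embeddings[OF perfect K M KM])
    show "Nm i \<in> M" using GM unfolding G_def by auto
    show "\<rho> (Nm i) = Nm i" if "\<rho> \<in> embeddings M UNIV" "\<forall>x\<in>K. \<rho> x = x" for \<rho>
      using fun_cong[OF fixed[OF that], of i] by simp
  qed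
  then show ?thesis using Nm unfolding Nm_def[symmetric] rational_points_def by auto
qed

end

section \<open>Quotients by generated subgroups\<close>

context comm_group
begin

lemma generate_normal:
  assumes "H \<subseteq> carrier G"
  shows "generate G H \<lhd> G"
  by (rule normal_iff_subgroup[THEN iffD2]) (rule generate_is_subgroup[OF assms])

lemma comm_group_quot_group:
  assumes "H \<subseteq> carrier G"
  shows "comm_group (quot_group G H)"
  unfolding quot_group_def by (rule abelian_FactGroup[OF generate_is_subgroup[OF assms]])

lemma quot_group_carrier: "carrier (quot_group G H) = quot_class G H ` carrier G"
  by (auto simp: quot_group_def quot_class_def FactGroup_def RCOSETS_def)

lemma quot_class_hom:
  assumes "H \<subseteq> carrier G"
  shows "quot_class G H \<in> hom G (quot_group G H)"
proof (rule homI)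
  show "quot_class G H x \<in> carrier (quot_group G H)" if "x \<in> carrier G" for x
    using that quot_group_carrier by blast
  show "quot_class G H (x \<otimes> y) = quot_class G H x \<otimes>\<^bsub>quot_group G H\<^esub> quot_class G H y"
    if "x \<in> carrier G" "y \<in> carrier G" for x y
    using normal.rcos_sum[OF generate_normal[OF assms] that]
    by (simp add: quot_class_def quot_group_def FactGroup_def)
qed

lemma quot_group_one: "\<one>\<^bsub>quot_group G H\<^esub> = generate G H"
  by (simp add: quot_group_def FactGroup_def)

lemma quot_class_eq_one_iff:
  assumes "H \<subseteq> carrier G" "a \<in> carrier G"
  shows "quot_class G H a = \<one>\<^bsub>quot_group G H\<^esub> \<longleftrightarrow> a \<in> generate G H"
  unfolding quot_group_one quot_class_def
  using coset_join1[OF _ assms(2) generate_is_subgroup[OF assms(1)]]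
    coset_join2[OF assms(2) generate_is_subgroup[OF assms(1)]] generate_incl[OF assms(1)] by blast

end

lemma comm_group_zero_cycles: "comm_group (zero_cycles V)"
  unfolding zero_cycles_def by (rule abelian_free_Abelian_group)

section \<open>Congruences modulo relations in a free abelian group\<close>

context
  fixes S :: "'a set" and R :: "('a \<Rightarrow>\<^sub>0 int) set"
  assumes R: "R \<subseteq> carrier (free_Abelian_group S)"
begin

lemma generate_free_Abelian_group_keys: "a \<in> generate (free_Abelian_group S) R \<Longrightarrow> Poly_Mapping.keys a \<subseteq> S"
  using subsetD[OF group.generate_incl[OF group_free_Abelian_group R], of a] by simp

lemma generate_free_Abelian_group_diff:
  assumes "a \<in> generate (free_Abelian_group S) R" "b \<in> generate (free_Abelian_group S) R"
  shows "a - b \<in> generate (free_Abelian_group S) R"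
proof -
  have "inv\<^bsub>free_Abelian_group S\<^esub> b \<in> generate (free_Abelian_group S) R"
    by (rule group.generate_m_inv_closed[OF group_free_Abelian_group R assms(2)])
  then have "- b \<in> generate (free_Abelian_group S) R" using generate_free_Abelian_group_keys[OF assms(2)] by simp
  from generate.eng[OF assms(1) this] show ?thesis by simp
qed

lemma generate_free_Abelian_group_0: "0 \<in> generate (free_Abelian_group S) R"
  using generate.one[of "free_Abelian_group S" R] by simp

lemma generate_free_Abelian_group_minus: "a \<in> generate (free_Abelian_group S) R \<Longrightarrow> - a \<in> generate (free_Abelian_group S) R"
  using generate_free_Abelian_group_diff[OF generate_free_Abelian_group_0] by simp

lemma generate_free_Abelian_group_add:
  "a \<in> generate (free_Abelian_group S) R \<Longrightarrow> b \<in> generate (free_Abelian_group S) R \<Longrightarrow> a + b \<in> generate (free_Abelian_group S) R"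
  using generate.eng[of a "free_Abelian_group S" R b] by simp

lemma generate_free_Abelian_group_cmul:
  "a \<in> generate (free_Abelian_group S) R \<Longrightarrow> frag_cmul k a \<in> generate (free_Abelian_group S) R"
  by (rule frag_closure_minus_cmul[where P = "\<lambda>a. a \<in> generate (free_Abelian_group S) R"])
     (auto intro: generate_free_Abelian_group_0 generate_free_Abelian_group_diff)

text \<open>Equality in the quotient, stated for representatives. Chains of symbol identities can
  then be calculated with \<open>also\<close>, without handling cosets.\<close>

definition frag_cong :: "('a \<Rightarrow>\<^sub>0 int) \<Rightarrow> ('a \<Rightarrow>\<^sub>0 int) \<Rightarrow> bool" where
  "frag_cong a b \<longleftrightarrow> a - b \<in> generate (free_Abelian_group S) R"

lemma frag_cong_rel: "a - b \<in> R \<Longrightarrow> frag_cong a b"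
  unfolding frag_cong_def by (rule generate.incl)

lemma frag_cong_refl: "frag_cong a a"
  unfolding frag_cong_def using generate_free_Abelian_group_0 by simp

lemma frag_cong_sym: "frag_cong a b \<Longrightarrow> frag_cong b a"
  unfolding frag_cong_def using generate_free_Abelian_group_minus by fastforce

lemma frag_cong_trans: "frag_cong a b \<Longrightarrow> frag_cong b c \<Longrightarrow> frag_cong a c"
  unfolding frag_cong_def using generate_free_Abelian_group_add[of "a - b" "b - c"] by simp

lemma frag_cong_add: "frag_cong a b \<Longrightarrow> frag_cong a' b' \<Longrightarrow> frag_cong (a + a') (b + b')"
  unfolding frag_cong_def using generate_free_Abelian_group_add[of "a - b" "a' - b'"] by (simp add: algebra_simps)

lemma frag_cong_diff: "frag_cong a b \<Longrightarrow> frag_cong a' b' \<Longrightarrow> frag_cong (a - a') (b - b')"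
  unfolding frag_cong_def using generate_free_Abelian_group_diff[of "a - b" "a' - b'"] by (simp add: algebra_simps)

lemma frag_cong_cmul: "frag_cong a b \<Longrightarrow> frag_cong (frag_cmul k a) (frag_cmul k b)"
  unfolding frag_cong_def using generate_free_Abelian_group_cmul[of "a - b" k]
  by (metis frag_cmul_distrib2 add_diff_cancel_right' diff_add_cancel)

end

lemma geom_pt_in_closed:
  assumes V: "zariski_closed base N V" and c: "c \<in> closed_points V"
  shows "geom_pt c \<in> V" "closed_point (geom_pt c) = c"
proof -
  obtain x where x: "x \<in> V" "c = closed_point x" using c by (auto simp: closed_points_def)
  obtain \<sigma> where \<sigma>: "\<sigma> \<in> galois_group" "geom_pt c = \<sigma> \<circ> x" unfolding x(2) by (rule geom_pt_closed_point)
  show "geom_pt c \<in> V" unfolding \<sigma>(2)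
    by (rule zariski_closed_hom[OF V subfield_UNIV _ x(1) _ galois_group_base_hom[OF \<sigma>(1)]]) auto
  show "closed_point (geom_pt c) = c" using \<sigma>(2) x(2) closed_point_galois[OF \<sigma>(1), of x] by simp
qed

lemma keys_principal_divisor: "Poly_Mapping.keys (principal_divisor M C f) \<subseteq> closed_points C"
proof -
  have "Poly_Mapping.keys (principal_divisor M C f)
      \<subseteq> (\<Union>c\<in>{c \<in> closed_points C. ord_at M C (geom_pt c) f \<noteq> 0}. Poly_Mapping.keys (frag_cmul (ord_at M C (geom_pt c) f) (frag_of c)))"
    unfolding principal_divisor_def by (rule keys_sum)
  then show ?thesis by auto
qed

section \<open>Symbol calculus in the Somekawa group\<close>

context abelian_var
begin

lemma point_tuples_replicate:
  "as \<in> point_tuples (replicate r A) L \<longleftrightarrow> length as = r \<and> set as \<subseteq> rational_points A L"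
  unfolding point_tuples_def by (auto simp: in_set_conv_nth subset_iff)

lemma symbols_replicate:
  "(L, as) \<in> symbols (replicate r A) \<longleftrightarrow> finite_ext L \<and> length as = r \<and> set as \<subseteq> rational_points A L"
  unfolding symbols_def by (auto simp: point_tuples_replicate)

lemma keys_diff_subset: "Poly_Mapping.keys a \<subseteq> S \<Longrightarrow> Poly_Mapping.keys b \<subseteq> S \<Longrightarrow> Poly_Mapping.keys (a - b) \<subseteq> S"
  using keys_diff[of a b] by blast

text \<open>All entries occurring in a relation must be rational over the field of their symbol. For
  the three kinds of relations this is rationality of sums, of restrictions and norms, and of the
  images of a geometric point of the curve under \<open>k\<close>-morphisms.\<close>

lemma somekawa_rels_subset:
  "somekawa_rels (replicate r A) \<subseteq> carrier (free_Abelian_group (symbols (replicate r A)))"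
proof -
  let ?S = "symbols (replicate r A)"
  have upd: "set (as[i := a]) \<subseteq> rational_points A L" if "set as \<subseteq> rational_points A L" "a \<in> rational_points A L" for as i a L
    using that set_update_subset_insert[of as i a] by blast
  have "Poly_Mapping.keys p \<subseteq> ?S" if p: "p \<in> multilinear_rels (replicate r A)" for p
  proof -
    obtain L as i a b where *: "finite_ext L" "length as = r" "set as \<subseteq> rational_points A L" "i < r"
      "a \<in> rational_points A L" "b \<in> rational_points A L"
      "p = frag_of (L, as[i := a \<otimes>\<^bsub>A\<^esub> b]) - frag_of (L, as[i := a]) - frag_of (L, as[i := b])"
      using p unfolding multilinear_rels_def by (auto simp: point_tuples_replicate)
    note L = finite_extD[OF *(1)]
    show ?thesis unfolding *(7)
      by (intro keys_diff_subset)
         (use * upd[OF *(3)] rational_points_mult(1)[OF L(1,2) *(5,6)] in \<open>auto simp: symbols_replicate\<close>)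
  qed
  moreover have "Poly_Mapping.keys p \<subseteq> ?S" if p: "p \<in> projection_rels (replicate r A)" for p
  proof -
    obtain K L \<sigma> bs i a where *: "finite_ext K" "finite_ext L" "\<sigma> \<in> embeddings K L" "length bs = r"
      "set bs \<subseteq> rational_points A K" "i < r" "a \<in> rational_points A L"
      "p = frag_of (L, (map (restrict_pt \<sigma>) bs)[i := a]) - frag_of (K, bs[i := norm_pt A K L \<sigma> a])"
      using p unfolding projection_rels_def by (auto simp: point_tuples_replicate)
    note K = finite_extD[OF *(1)]
    have "base_hom K \<sigma>" "\<sigma> ` K \<subseteq> L" using *(3) by (auto simp: embeddings_iff_base_hom)
    then have "set (map (restrict_pt \<sigma>) bs) \<subseteq> rational_points A L"
      using *(5) base_hom_rational_points[OF K(1,2)] unfolding restrict_pt_def by auto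
    from upd[OF this *(7)] upd[OF *(5) norm_pt_rational[OF *(1,2,3,7)]]
    show ?thesis unfolding *(8)
      by (intro keys_diff_subset) (use * in \<open>auto simp: symbols_replicate\<close>)
  qed
  moreover have "Poly_Mapping.keys p \<subseteq> ?S" if p: "p \<in> weil_rels (replicate r A)" for p
  proof -
    obtain M C gs f where *: "smooth_proj_curve M C" "length gs = r"
      "\<And>i. i < r \<Longrightarrow> regular_map M C (ambient A) (carrier A) (gs ! i)"
      "p = frag_extend (\<lambda>c. frag_of (residue_field (geom_pt c), map (\<lambda>g. g (geom_pt c)) gs)) (principal_divisor M C f)"
      using p unfolding weil_rels_def by auto
    have C: "zariski_closed base M C" using *(1) by (auto simp: smooth_proj_curve_def irreducible_closed_def)
    have "(residue_field (geom_pt c), map (\<lambda>g. g (geom_pt c)) gs) \<in> ?S" if c: "c \<in> closed_points C" for c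
    proof -
      note x = geom_pt_in_closed(1)[OF C c]
      have "g (geom_pt c) \<in> rational_points A (residue_field (geom_pt c))" if "g \<in> set gs" for g
      proof -
        have g: "regular_map M C (ambient A) (carrier A) g" using that *(2,3) by (auto simp: in_set_conv_nth)
        show ?thesis
          using regular_map_hom(1)[OF g subfield_residue_field base_subset_residue_field x range_subset_residue_field] g x
          by (auto simp: rational_points_def regular_map_def)
      qed
      then show ?thesis
        using *(2) finite_ext_residue_field x zariski_closed_proj_space[OF C] by (auto simp: symbols_replicate)
    qed
    then show ?thesis
      unfolding *(4) using keys_frag_extend keys_principal_divisor[of M C f] by fastforce
  qed
  ultimately show ?thesis unfolding somekawa_rels_def by auto
qed

abbreviation symb_cong :: "nat \<Rightarrow> ('k symb \<Rightarrow>\<^sub>0 int) \<Rightarrow> ('k symb \<Rightarrow>\<^sub>0 int) \<Rightarrow> bool" where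
  "symb_cong r \<equiv> frag_cong (symbols (replicate r A)) (somekawa_rels (replicate r A))"

lemmas symb_cong_rel = frag_cong_rel[OF somekawa_rels_subset]
  and symb_cong_refl = frag_cong_refl[OF somekawa_rels_subset]
  and symb_cong_sym = frag_cong_sym[OF somekawa_rels_subset]
  and symb_cong_trans [trans] = frag_cong_trans[OF somekawa_rels_subset]
  and symb_cong_add = frag_cong_add[OF somekawa_rels_subset]
  and symb_cong_diff = frag_cong_diff[OF somekawa_rels_subset]
  and symb_cong_cmul = frag_cong_cmul[OF somekawa_rels_subset]

lemma symb_cong_mult:
  assumes "finite_ext L" "length as = r" "set as \<subseteq> rational_points A L" "i < r"
    "a \<in> rational_points A L" "b \<in> rational_points A L"
  shows "symb_cong r (frag_of (L, as[i := a \<otimes>\<^bsub>A\<^esub> b])) (frag_of (L, as[i := a]) + frag_of (L, as[i := b]))"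
proof (rule symb_cong_rel)
  have "frag_of (L, as[i := a \<otimes>\<^bsub>A\<^esub> b]) - frag_of (L, as[i := a]) - frag_of (L, as[i := b])
      \<in> multilinear_rels (replicate r A)"
    unfolding multilinear_rels_def mem_Collect_eq
    using assms by (intro exI[of _ L] exI[of _ as] exI[of _ i] exI[of _ a] exI[of _ b]) (auto simp: point_tuples_replicate)
  then show "frag_of (L, as[i := a \<otimes>\<^bsub>A\<^esub> b]) - (frag_of (L, as[i := a]) + frag_of (L, as[i := b]))
      \<in> somekawa_rels (replicate r A)"
    unfolding somekawa_rels_def by (simp add: diff_diff_add)
qed

lemma symb_cong_pow:
  assumes L: "finite_ext L" "length as = r" "set as \<subseteq> rational_points A L" "i < r" "a \<in> rational_points A L"
  shows "symb_cong r (frag_of (L, as[i := a [^]\<^bsub>A\<^esub> (m :: nat)])) (frag_cmul (int m) (frag_of (L, as[i := a])))"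
proof (induction m)
  case 0
  let ?e = "frag_of (L, as[i := \<one>\<^bsub>A\<^esub>])"
  \<comment> \<open>Additivity with both arguments neutral gives \<open>?e + ?e\<close> congruent to
    \<open>?e\<close>; subtracting \<open>?e\<close> makes the symbol vanish.\<close>
  have "symb_cong r (?e + ?e) ?e"
    using symb_cong_mult[OF L(1-4), of "\<one>\<^bsub>A\<^esub>" "\<one>\<^bsub>A\<^esub>"] rational_points_one[OF finite_extD(1,2)[OF L(1)]]
    by (auto intro: symb_cong_sym)
  from symb_cong_diff[OF this symb_cong_refl, of ?e] show ?case by simp
next
  case (Suc m)
  have "symb_cong r (frag_of (L, as[i := a [^]\<^bsub>A\<^esub> m \<otimes>\<^bsub>A\<^esub> a]))
      (frag_of (L, as[i := a [^]\<^bsub>A\<^esub> m]) + frag_of (L, as[i := a]))"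
    using L rational_points_pow[OF finite_extD(1,2)[OF L(1)] L(5)] by (intro symb_cong_mult)
  also have "symb_cong r \<dots> (frag_cmul (int m) (frag_of (L, as[i := a])) + frag_of (L, as[i := a]))"
    by (intro symb_cong_add Suc symb_cong_refl)
  finally show ?case by (simp add: frag_cmul_distrib algebra_simps)
qed

text \<open>The entries are replaced one at a time: after \<open>j\<close> steps the first
  \<open>j\<close> entries are multiplied by \<open>n\<close> and the factor is
  \<open>n ^ j\<close>.\<close>

lemma symb_cong_replicate_pow:
  assumes L: "finite_ext L" and a: "a \<in> rational_points A L"
  shows "symb_cong r (frag_of (L, replicate r (a [^]\<^bsub>A\<^esub> (n :: nat)))) (frag_cmul (int (n ^ r)) (frag_of (L, replicate r a)))"
proof -
  have an: "a [^]\<^bsub>A\<^esub> n \<in> rational_points A L" by (rule rational_points_pow[OF finite_extD(1,2)[OF L] a])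
  have "symb_cong r (frag_of (L, replicate j (a [^]\<^bsub>A\<^esub> n) @ replicate (r - j) a))
      (frag_cmul (int (n ^ j)) (frag_of (L, replicate r a)))" if "j \<le> r" for j
    using that
  proof (induction j)
    case 0
    show ?case by (simp add: symb_cong_refl)
  next
    case (Suc j)
    define as where "as = replicate j (a [^]\<^bsub>A\<^esub> n) @ replicate (r - j) a"
    have as: "length as = r" "set as \<subseteq> rational_points A L" unfolding as_def using Suc.prems a an by auto
    have rj: "r - j = Suc (r - Suc j)" using Suc.prems by simp
    have upd: "as[j := b] = replicate j (a [^]\<^bsub>A\<^esub> n) @ b # replicate (r - Suc j) a" for b
      unfolding as_def rj by (simp add: list_update_append)
    have "as[j := a [^]\<^bsub>A\<^esub> n] = replicate (Suc j) (a [^]\<^bsub>A\<^esub> n) @ replicate (r - Suc j) a"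
      unfolding upd by (simp add: replicate_app_Cons_same)
    moreover have "as[j := a] = as" unfolding upd unfolding as_def rj by simp
    ultimately have "symb_cong r (frag_of (L, replicate (Suc j) (a [^]\<^bsub>A\<^esub> n) @ replicate (r - Suc j) a))
        (frag_cmul (int n) (frag_of (L, as)))"
      using symb_cong_pow[OF L as _ a, of j n] Suc.prems by simp
    also have "symb_cong r \<dots> (frag_cmul (int n) (frag_cmul (int (n ^ j)) (frag_of (L, replicate r a))))"
      using Suc by (intro symb_cong_cmul) (simp add: as_def)
    finally show ?case by simp
  qed
  from this[of r] show ?thesis by simp
qed

text \<open>The projection formula in slot \<open>0\<close> with the entry
  \<open>\<sigma> \<circ> b\<close>: one side is the restricted tuple, on the other side the norm of
  a restriction is the multiple of \<open>b\<close> by the degree, which additivity moves out. The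
  condition \<open>r > 0\<close> provides the slot.\<close>

lemma symb_cong_projection:
  assumes K: "finite_ext K" "finite_ext L" "\<sigma> \<in> embeddings K L" and b: "b \<in> rational_points A K" and r: "r > 0"
  shows "symb_cong r (frag_of (L, replicate r (\<sigma> \<circ> b))) (frag_cmul (int (ext_degree (\<sigma> ` K) L)) (frag_of (K, replicate r b)))"
proof -
  let ?d = "ext_degree (\<sigma> ` K) L"
  have \<sigma>: "base_hom K \<sigma>" "\<sigma> ` K \<subseteq> L" using K(3) by (auto simp: embeddings_iff_base_hom)
  have \<sigma>b: "\<sigma> \<circ> b \<in> rational_points A L" by (rule base_hom_rational_points[OF finite_extD(1,2)[OF K(1)] b \<sigma>])
  have id: "(replicate r c)[0 := c] = replicate r c" for c :: "'k point"
    using r by (cases r) auto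
  have "frag_of (L, (map (restrict_pt \<sigma>) (replicate r b))[0 := \<sigma> \<circ> b])
      - frag_of (K, (replicate r b)[0 := norm_pt A K L \<sigma> (\<sigma> \<circ> b)]) \<in> projection_rels (replicate r A)"
    unfolding projection_rels_def mem_Collect_eq
    using K b \<sigma>b r
    by (intro exI[of _ K] exI[of _ L] exI[of _ \<sigma>] exI[of _ "replicate r b"] exI[of _ "0::nat"] exI[of _ "\<sigma> \<circ> b"])
       (auto simp: point_tuples_replicate)
  then have "frag_of (L, replicate r (\<sigma> \<circ> b)) - frag_of (K, (replicate r b)[0 := b [^]\<^bsub>A\<^esub> ?d])
      \<in> somekawa_rels (replicate r A)"
    using norm_pt_restrict[OF K b] by (simp add: restrict_pt_def id somekawa_rels_def)
  then have "symb_cong r (frag_of (L, replicate r (\<sigma> \<circ> b))) (frag_of (K, (replicate r b)[0 := b [^]\<^bsub>A\<^esub> ?d]))"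
    by (rule symb_cong_rel)
  also have "symb_cong r \<dots> (frag_cmul (int ?d) (frag_of (K, (replicate r b)[0 := b])))"
    using K(1) b r by (intro symb_cong_pow) auto
  finally show ?thesis by (simp only: id)
qed

end

section \<open>Push-forward of zero-cycles\<close>

lemma push_cycle_diff: "push_cycle g (a - b) = push_cycle g a - push_cycle g b"
  by (simp add: push_cycle_def frag_extend_diff)

lemma push_cycle_add: "push_cycle g (a + b) = push_cycle g a + push_cycle g b"
  by (simp add: push_cycle_def frag_extend_add)

lemma push_cycle_cmul: "push_cycle g (frag_cmul k a) = frag_cmul k (push_cycle g a)"
  by (simp add: push_cycle_def frag_extend_cmul)

lemma push_cycle_0 [simp]: "push_cycle g 0 = 0"
  by (simp add: push_cycle_def)

lemma push_cycle_minus: "push_cycle g (- a) = - push_cycle g a"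
  by (simp add: push_cycle_def frag_extend_minus)

lemma push_cycle_of:
  "push_cycle g (frag_of c) = frag_cmul (int (ext_degree (residue_field (g (geom_pt c))) (residue_field (geom_pt c))))
     (frag_of (closed_point (g (geom_pt c))))"
  by (simp add: push_cycle_def Let_def)

lemma keys_push_cycle:
  assumes "\<And>c. c \<in> S \<Longrightarrow> closed_point (g (geom_pt c)) \<in> T" "Poly_Mapping.keys z \<subseteq> S"
  shows "Poly_Mapping.keys (push_cycle g z) \<subseteq> T"
proof -
  have "Poly_Mapping.keys (push_cycle g z) \<subseteq> (\<Union>c\<in>Poly_Mapping.keys z. {closed_point (g (geom_pt c))})"
    unfolding push_cycle_def using keys_frag_extend[of _ z] by (fastforce simp: Let_def)
  then show ?thesis using assms by auto
qed

definition degree_of_point :: "'k::field point set \<Rightarrow> int" where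
  "degree_of_point c = int (ext_degree base (residue_field (geom_pt c)))"

lemma cycle_degree_superset:
  assumes "finite S" "Poly_Mapping.keys z \<subseteq> S"
  shows "cycle_degree z = (\<Sum>c\<in>S. Poly_Mapping.lookup z c * degree_of_point c)"
  unfolding cycle_degree_def degree_of_point_def using assms by (intro sum.mono_neutral_left) (auto simp: in_keys_iff)

lemma cycle_degree_diff: "cycle_degree (a - b) = cycle_degree a - cycle_degree b"
proof -
  let ?S = "Poly_Mapping.keys a \<union> Poly_Mapping.keys b"
  have "cycle_degree z = (\<Sum>c\<in>?S. Poly_Mapping.lookup z c * degree_of_point c)" if "z \<in> {a, b, a - b}" for z
    using that keys_diff[of a b] by (intro cycle_degree_superset) auto
  then show ?thesis by (simp add: lookup_minus left_diff_distrib sum_subtractf)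
qed

lemma cycle_degree_0 [simp]: "cycle_degree 0 = 0"
  by (simp add: cycle_degree_def)

lemma cycle_degree_add: "cycle_degree (a + b) = cycle_degree a + cycle_degree b"
  using cycle_degree_diff[of "a + b" b] by simp

lemma cycle_degree_cmul_of: "cycle_degree (frag_cmul k (frag_of c)) = k * degree_of_point c"
proof -
  have "Poly_Mapping.keys (frag_cmul k (frag_of c)) \<subseteq> {c}" using keys_cmul[of k "frag_of c"] by simp
  then show ?thesis using cycle_degree_superset[of "{c}" "frag_cmul k (frag_of c)"] by simp
qed

lemma residue_field_galois:
  assumes \<sigma>: "\<sigma> \<in> galois_group"
  shows "residue_field (\<sigma> \<circ> x) = \<sigma> ` residue_field x"
  by (rule residue_field_image[OF subfield_UNIV _ galois_group_base_hom[OF \<sigma>]]) auto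

lemma image_base_galois: "\<sigma> \<in> galois_group \<Longrightarrow> \<sigma> ` base = base"
  using galois_group_base_hom[of \<sigma> UNIV] by (force simp: base_hom_def image_iff)

text \<open>Automorphisms over \<open>k\<close> preserve degrees, so the choice made by
  \<open>geom_pt\<close> is immaterial.\<close>

lemma degree_of_closed_point:
  fixes x :: "'k::field point"
  assumes x: "x \<in> proj_space N"
  shows "degree_of_point (closed_point x) = int (ext_degree base (residue_field x))"
proof -
  obtain \<sigma> where \<sigma>: "\<sigma> \<in> galois_group" "geom_pt (closed_point x) = \<sigma> \<circ> x" by (rule geom_pt_closed_point)
  have "ext_degree (\<sigma> ` base) (\<sigma> ` residue_field x) = ext_degree base (residue_field x)"
    by (rule ext_degree_galois_image[OF \<sigma>(1) subfield_base finite_extD(3)[OF finite_ext_residue_field[OF x]]])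
  then show ?thesis
    unfolding degree_of_point_def \<sigma>(2) residue_field_galois[OF \<sigma>(1)] image_base_galois[OF \<sigma>(1)] by simp
qed

section \<open>Push-forward along multiplication by \<open>n\<close>\<close>

context abelian_var
begin

lemma carrier_zero_cycles: "z \<in> carrier (zero_cycles (carrier A)) \<longleftrightarrow> Poly_Mapping.keys z \<subseteq> closed_points (carrier A)"
  by (simp add: zero_cycles_def)

abbreviation mult_by :: "nat \<Rightarrow> 'k point \<Rightarrow> 'k point" where
  "mult_by n \<equiv> (\<lambda>x. x [^]\<^bsub>A\<^esub> n)"

lemma residue_field_mult_by: "x \<in> carrier A \<Longrightarrow> residue_field (mult_by n x) \<subseteq> residue_field x"
  using rational_points_pow[OF subfield_residue_field base_subset_residue_field rational_points_residue_field]
  by (intro residue_field_subset subfield_residue_field base_subset_residue_field) (auto simp: rational_points_def)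

lemma galois_pow:
  assumes \<sigma>: "\<sigma> \<in> galois_group" and x: "x \<in> carrier A"
  shows "\<sigma> \<circ> x \<in> carrier A" "mult_by n (\<sigma> \<circ> x) = \<sigma> \<circ> mult_by n x"
proof -
  have x': "x \<in> rational_points A UNIV" using x by (auto simp: rational_points_def)
  note * = galois_group_base_hom[OF \<sigma>, of UNIV]
  show "\<sigma> \<circ> x \<in> carrier A"
    using base_hom_rational_points[OF subfield_UNIV _ x' *, of UNIV] by (auto simp: rational_points_def)
  show "mult_by n (\<sigma> \<circ> x) = \<sigma> \<circ> mult_by n x"
    using base_hom_pow[OF subfield_UNIV _ x' *] by simp
qed

lemma finite_dimension_residue_field: "x \<in> carrier A \<Longrightarrow> kbar.finite_dimension base (residue_field x)"
  using finite_ext_residue_field carrier_proj_space finite_extD(3) by blast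

text \<open>\<open>push_cycle\<close> works with the chosen geometric point, whereas here an
  arbitrary \<open>y\<close> in the orbit is given. Multiplication by \<open>n\<close> commutes with
  automorphisms over \<open>k\<close>, and these preserve degrees and orbits.\<close>

lemma push_mult_by_closed_point:
  assumes y: "y \<in> carrier A"
  shows "push_cycle (mult_by n) (frag_of (closed_point y))
    = frag_cmul (int (ext_degree (residue_field (mult_by n y)) (residue_field y))) (frag_of (closed_point (mult_by n y)))"
proof -
  obtain \<sigma> where \<sigma>: "\<sigma> \<in> galois_group" "geom_pt (closed_point y) = \<sigma> \<circ> y" by (rule geom_pt_closed_point)
  have "kbar.finite_dimension (residue_field (mult_by n y)) (residue_field y)"
    by (rule finite_dimension_upper[OF subfield_base subfield_residue_field base_subset_residue_field
          subfield_residue_field residue_field_mult_by[OF y] finite_dimension_residue_field[OF y]])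
  then show ?thesis
    unfolding push_cycle_of \<sigma>(2) galois_pow(2)[OF \<sigma>(1) y] closed_point_galois[OF \<sigma>(1)] residue_field_galois[OF \<sigma>(1)]
    using ext_degree_galois_image[OF \<sigma>(1) subfield_residue_field] by simp
qed

text \<open>Functoriality, checked on points: with \<open>x\<close> over \<open>c\<close>, the
  coefficients multiply by the tower law for the residue fields of \<open>n (g x)\<close>,
  \<open>g x\<close> and \<open>x\<close>. The second push-forward starts from some conjugate of
  \<open>g x\<close>, which \<open>push_mult_by_closed_point\<close> takes care of.\<close>

lemma push_cycle_mult_by_push_cycle:
  assumes C: "zariski_closed base M C" and g: "regular_map M C (ambient A) (carrier A) g"
    and z: "Poly_Mapping.keys z \<subseteq> closed_points C"
  shows "push_cycle (mult_by n) (push_cycle g z) = push_cycle (mult_by n \<circ> g) z"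
  using z
proof (induction z rule: frag_induction)
  case (one c)
  define x where "x = geom_pt c"
  have x: "x \<in> C" unfolding x_def by (rule geom_pt_in_closed(1)[OF C one])
  have gx: "g x \<in> carrier A" using g x by (auto simp: regular_map_def)
  have fin: "kbar.finite_dimension base (residue_field x)"
    using finite_ext_residue_field zariski_closed_proj_space[OF C] x finite_extD(3) by blast
  have sub: "residue_field (g x) \<subseteq> residue_field x"
    using regular_map_hom(1)[OF g subfield_residue_field base_subset_residue_field x range_subset_residue_field]
    by (intro residue_field_subset subfield_residue_field base_subset_residue_field)
  have "ext_degree (residue_field (mult_by n (g x))) (residue_field x) =
      ext_degree (residue_field (mult_by n (g x))) (residue_field (g x)) * ext_degree (residue_field (g x)) (residue_field x)"
    using residue_field_mult_by[OF gx] sub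
    by (intro ext_degree_tower subfield_residue_field finite_dimension_upper[OF subfield_base subfield_residue_field _ _ _ fin]
        base_subset_residue_field) auto
  moreover have "push_cycle (mult_by n) (push_cycle g (frag_of c)) =
      frag_cmul (int (ext_degree (residue_field (g x)) (residue_field x))) (push_cycle (mult_by n) (frag_of (closed_point (g x))))"
    by (simp only: push_cycle_of[of g] push_cycle_cmul x_def)
  ultimately show ?case
    unfolding push_mult_by_closed_point[OF gx] by (simp add: push_cycle_of[of _ c] x_def[symmetric] mult.commute)
qed (simp_all add: push_cycle_diff)

lemma push_cycle_mult_by_closed:
  assumes "z \<in> carrier (zero_cycles (carrier A))"
  shows "push_cycle (mult_by n) z \<in> carrier (zero_cycles (carrier A))"
proof -
  have "closed_point (mult_by n (geom_pt c)) \<in> closed_points (carrier A)" if "c \<in> closed_points (carrier A)" for c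
    using geom_pt_in_closed(1)[OF carrier_closed that] by (auto simp: closed_points_def)
  then show ?thesis using assms keys_push_cycle unfolding carrier_zero_cycles by meson
qed

lemma rat_equiv_rels_subset: "rat_equiv_rels A \<subseteq> carrier (zero_cycles (carrier A))"
proof
  fix z assume "z \<in> rat_equiv_rels A"
  then obtain M C g f where *: "smooth_proj_curve M C" "regular_map M C (ambient A) (carrier A) g"
    "z = push_cycle g (principal_divisor M C f)" unfolding rat_equiv_rels_def by auto
  have C: "zariski_closed base M C" using *(1) by (auto simp: smooth_proj_curve_def irreducible_closed_def)
  have "closed_point (g (geom_pt c)) \<in> closed_points (carrier A)" if "c \<in> closed_points C" for c
    using geom_pt_in_closed(1)[OF C that] *(2) by (auto simp: closed_points_def regular_map_def)
  then show "z \<in> carrier (zero_cycles (carrier A))"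
    unfolding *(3) carrier_zero_cycles by (rule keys_push_cycle[OF _ keys_principal_divisor])
qed

text \<open>A generator of rational equivalence given by \<open>C\<close>, \<open>g\<close> and
  \<open>f\<close> is sent to the one with the same \<open>C\<close> and \<open>f\<close> and with
  \<open>g\<close> followed by multiplication by \<open>n\<close>, which is again a morphism to
  \<open>A\<close>.\<close>

lemma push_cycle_mult_by_rat_equiv:
  assumes "z \<in> generate (zero_cycles (carrier A)) (rat_equiv_rels A)"
  shows "push_cycle (mult_by n) z \<in> generate (zero_cycles (carrier A)) (rat_equiv_rels A)"
proof -
  have rel: "push_cycle (mult_by n) h \<in> rat_equiv_rels A" if h: "h \<in> rat_equiv_rels A" for h
  proof -
    obtain M C g f where *: "smooth_proj_curve M C" "regular_map M C (ambient A) (carrier A) g"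
      "f \<in> rat_functions_nz M C" "h = push_cycle g (principal_divisor M C f)" using h unfolding rat_equiv_rels_def by blast
    have C: "zariski_closed base M C" using *(1) by (auto simp: smooth_proj_curve_def irreducible_closed_def)
    have "push_cycle (mult_by n) h = push_cycle (mult_by n \<circ> g) (principal_divisor M C f)"
      unfolding *(4) by (rule push_cycle_mult_by_push_cycle[OF C *(2) keys_principal_divisor])
    moreover have "regular_map M C (ambient A) (carrier A) (mult_by n \<circ> g)"
      by (rule regular_map_compose[OF *(2) regular_map_pow carrier_proj_space])
    ultimately show ?thesis using * unfolding rat_equiv_rels_def by blast
  qed
  note R = rat_equiv_rels_subset[unfolded zero_cycles_def]
  show ?thesis
    using assms unfolding zero_cycles_def
  proof (induction z rule: generate.induct)
    case one
    then show ?case using generate_free_Abelian_group_0[OF R] by simp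
  next
    case (incl h)
    then show ?case using rel by (auto intro: generate.incl)
  next
    case (inv h)
    have "Poly_Mapping.keys h \<subseteq> closed_points (carrier A)" using subsetD[OF R inv] by simp
    then show ?case
      using generate_free_Abelian_group_minus[OF R] rel[OF inv] by (auto simp: push_cycle_minus intro: generate.incl)
  next
    case (eng h1 h2)
    then show ?case using generate_free_Abelian_group_add[OF R] by (simp add: push_cycle_add)
  qed
qed

text \<open>The tower law for the residue field of \<open>n x\<close> between \<open>k\<close> and
  the residue field of \<open>x\<close>. This is the multiplication formula for
  \<open>\<Phi>\<^sub>0\<close>, with factor \<open>n ^ 0 = 1\<close>.\<close>

lemma cycle_degree_push_mult_by:
  assumes "Poly_Mapping.keys z \<subseteq> closed_points (carrier A)"
  shows "cycle_degree (push_cycle (mult_by n) z) = cycle_degree z"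
  using assms
proof (induction z rule: frag_induction)
  case (one c)
  define x where "x = geom_pt c"
  have x: "x \<in> carrier A" unfolding x_def by (rule geom_pt_in_closed(1)[OF carrier_closed one])
  have nx: "mult_by n x \<in> proj_space (ambient A)" using x carrier_proj_space by auto
  have "ext_degree base (residue_field x) =
      ext_degree base (residue_field (mult_by n x)) * ext_degree (residue_field (mult_by n x)) (residue_field x)"
    by (rule ext_degree_tower[OF subfield_base subfield_residue_field base_subset_residue_field
          subfield_residue_field residue_field_mult_by[OF x] finite_dimension_residue_field[OF x]])
  moreover have "cycle_degree (frag_of c) = degree_of_point c" using cycle_degree_cmul_of[of 1 c] by simp
  ultimately show ?case
    unfolding push_cycle_of x_def[symmetric] cycle_degree_cmul_of degree_of_closed_point[OF nx]
    by (simp add: degree_of_point_def x_def mult.commute)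
qed (simp_all add: push_cycle_diff cycle_degree_diff)

section \<open>Symbols of zero-cycles and of their push-forwards\<close>

definition symbol_cycle :: "nat \<Rightarrow> 'k cycle \<Rightarrow> 'k symb \<Rightarrow>\<^sub>0 int" where
  "symbol_cycle r = frag_extend (\<lambda>c. frag_of (residue_field (geom_pt c), replicate r (geom_pt c)))"

lemma symbol_cycle_closed:
  assumes "Poly_Mapping.keys z \<subseteq> closed_points (carrier A)"
  shows "Poly_Mapping.keys (symbol_cycle r z) \<subseteq> symbols (replicate r A)"
proof -
  have "(residue_field (geom_pt c), replicate r (geom_pt c)) \<in> symbols (replicate r A)"
    if "c \<in> closed_points (carrier A)" for c
    using geom_pt_in_closed(1)[OF carrier_closed that] finite_ext_residue_field carrier_proj_space rational_points_residue_field
    by (auto simp: symbols_replicate)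
  then show ?thesis using assms keys_frag_extend unfolding symbol_cycle_def by fastforce
qed

text \<open>The projection formula along the isomorphism that \<open>\<sigma>\<close> induces on
  residue fields, which has degree \<open>1\<close>. Hence the symbol of a closed point does not
  depend on the geometric point chosen over it.\<close>

lemma symb_cong_galois:
  assumes \<sigma>: "\<sigma> \<in> galois_group" and y: "y \<in> carrier A" and r: "r > 0"
  shows "symb_cong r (frag_of (residue_field (\<sigma> \<circ> y), replicate r (\<sigma> \<circ> y))) (frag_of (residue_field y, replicate r y))"
proof -
  let ?K = "residue_field y" and ?L = "residue_field (\<sigma> \<circ> y)"
  define \<sigma>' where "\<sigma>' = restrict \<sigma> ?K"
  have eq: "\<sigma>' \<circ> y = \<sigma> \<circ> y" "\<sigma>' ` ?K = ?L"
    using range_subset_residue_field[of y] residue_field_galois[OF \<sigma>] by (auto simp: \<sigma>'_def fun_eq_iff)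
  have "base_hom ?K \<sigma>'"
    using base_hom_cong[OF base_subset_residue_field subfield_residue_field, of y \<sigma> \<sigma>'] galois_group_base_hom[OF \<sigma>]
    by (simp add: \<sigma>'_def)
  then have \<sigma>': "\<sigma>' \<in> embeddings ?K ?L" using eq(2) unfolding embeddings_iff_base_hom by (auto simp: \<sigma>'_def)
  have "ext_degree ?L ?L = 1"
    using kbar.dimI[OF subfield_residue_field kbar.dimension_one[OF subfield_residue_field]] by (simp add: ext_degree_def over_def)
  moreover have "finite_ext ?K" "finite_ext ?L"
    using finite_ext_residue_field carrier_proj_space y galois_pow(1)[OF \<sigma> y] by blast+
  ultimately show ?thesis
    using symb_cong_projection[OF _ _ \<sigma>' rational_points_residue_field[OF y] r] unfolding eq by simp
qed

text \<open>The projection formula must have an entry to act on, hence \<open>r > 0\<close>; the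
  counterpart for \<open>r = 0\<close> is \<open>cycle_degree_push_mult_by\<close>.\<close>

lemma symb_cong_push_mult_by:
  assumes z: "Poly_Mapping.keys z \<subseteq> closed_points (carrier A)" and r: "r > 0"
  shows "symb_cong r (symbol_cycle r (push_cycle (mult_by n) z)) (frag_cmul (int (n ^ r)) (symbol_cycle r z))"
  using z
proof (induction z rule: frag_induction)
  case zero
  show ?case by (simp add: symbol_cycle_def symb_cong_refl)
next
  case (one c)
  define x where "x = geom_pt c"
  have x: "x \<in> carrier A" unfolding x_def by (rule geom_pt_in_closed(1)[OF carrier_closed one])
  define y where "y = mult_by n x"
  have y: "y \<in> carrier A" unfolding y_def using x by simp
  let ?K = "residue_field y" and ?L = "residue_field x"
  have KL: "?K \<subseteq> ?L" unfolding y_def by (rule residue_field_mult_by[OF x])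
  have fin: "finite_ext ?K" "finite_ext ?L" using finite_ext_residue_field carrier_proj_space x y by blast+
  let ?d = "int (ext_degree ?K ?L)"
  obtain \<sigma> where \<sigma>: "\<sigma> \<in> galois_group" "geom_pt (closed_point y) = \<sigma> \<circ> y" by (rule geom_pt_closed_point)
  have "symbol_cycle r (push_cycle (mult_by n) (frag_of c))
      = frag_cmul ?d (frag_of (residue_field (\<sigma> \<circ> y), replicate r (\<sigma> \<circ> y)))"
    by (simp add: symbol_cycle_def push_cycle_of frag_extend_cmul x_def[symmetric] y_def[symmetric] \<sigma>(2))
  \<comment> \<open>Removes the conjugation introduced by \<open>geom_pt\<close>.\<close>
  also have "symb_cong r \<dots> (frag_cmul ?d (frag_of (?K, replicate r y)))"
    by (intro symb_cong_cmul symb_cong_galois[OF \<sigma>(1) y r])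
  \<comment> \<open>The projection formula along the inclusion of residue fields, read from right to
    left: the multiplicity of the push-forward is exactly the degree that the norm produces.\<close>
  also have "symb_cong r \<dots> (frag_of (?L, replicate r y))"
  proof -
    define \<iota> where "\<iota> = restrict id ?K"
    have "base_hom ?K \<iota>"
      using base_hom_cong[OF base_subset_residue_field subfield_residue_field, of y id \<iota>] by (simp add: \<iota>_def base_hom_def)
    then have "\<iota> \<in> embeddings ?K ?L" using KL unfolding embeddings_iff_base_hom by (auto simp: \<iota>_def)
    moreover have "\<iota> ` ?K = ?K" "\<iota> \<circ> y = y" using range_subset_residue_field[of y] by (auto simp: \<iota>_def fun_eq_iff)
    ultimately show ?thesis
      using symb_cong_projection[OF fin _ rational_points_residue_field[OF y] r, of \<iota>] by (auto intro: symb_cong_sym)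
  qed
  also have "symb_cong r \<dots> (frag_cmul (int (n ^ r)) (frag_of (?L, replicate r x)))"
    unfolding y_def by (rule symb_cong_replicate_pow[OF fin(2) rational_points_residue_field[OF x]])
  finally show ?case by (simp add: symbol_cycle_def x_def)
next
  case (diff a b)
  have "frag_cmul k (u - v) = frag_cmul k u - frag_cmul k v" for k and u v :: "'k symb \<Rightarrow>\<^sub>0 int"
    by (metis frag_cmul_distrib2 add_diff_cancel_right' diff_add_cancel)
  then show ?case
    using symb_cong_diff[OF diff] by (simp add: push_cycle_diff symbol_cycle_def frag_extend_diff)
qed

end

lemma (in group) subgroup_nat_pow_closed: "subgroup H G \<Longrightarrow> x \<in> H \<Longrightarrow> x [^] (n :: nat) \<in> H"
  by (induction n) (auto intro: subgroup.one_closed subgroup.m_closed)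

lemma (in comm_group) subgroup_comm_group: "subgroup H G \<Longrightarrow> comm_group (G\<lparr>carrier := H\<rparr>)"
  by (rule group.group_comm_groupI[OF subgroup_imp_group]) (auto simp: m_comm subgroup.mem_carrier)

section \<open>Classes of zero-cycles modulo rational equivalence\<close>

context abelian_var
begin

lemma CH0_eq: "CH0 A = quot_group (zero_cycles (carrier A)) (rat_equiv_rels A)"
  "CH0_class A = quot_class (zero_cycles (carrier A)) (rat_equiv_rels A)"
  by (simp_all add: CH0_def CH0_class_def)

sublocale Z: comm_group "zero_cycles (carrier A)"
  by (rule comm_group_zero_cycles)

sublocale CH: comm_group "CH0 A"
  unfolding CH0_eq by (rule Z.comm_group_quot_group[OF rat_equiv_rels_subset])

sublocale CH_class: group_hom "zero_cycles (carrier A)" "CH0 A" "CH0_class A"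
  unfolding group_hom_def group_hom_axioms_def
  using Z.quot_class_hom[OF rat_equiv_rels_subset] by (auto simp: CH0_eq[symmetric])

lemma CH0_class_surj:
  assumes "c \<in> carrier (CH0 A)"
  obtains z where "z \<in> carrier (zero_cycles (carrier A))" "c = CH0_class A z"
  using assms Z.quot_group_carrier unfolding CH0_eq by blast

lemma zero_cycles_simps [simp]:
  "z \<otimes>\<^bsub>zero_cycles (carrier A)\<^esub> w = z + w" "\<one>\<^bsub>zero_cycles (carrier A)\<^esub> = 0"
  "z [^]\<^bsub>zero_cycles (carrier A)\<^esub> (k :: nat) = frag_cmul (int k) z"
  "z \<in> carrier (zero_cycles (carrier A)) \<Longrightarrow> inv\<^bsub>zero_cycles (carrier A)\<^esub> z = - z"
  by (simp_all add: zero_cycles_def)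

text \<open>\<open>mult_push\<close> applies \<open>the_elem\<close> to the images of all
  representatives. These coincide because two representatives differ by an element of the subgroup
  of relations, which \<open>push_cycle_mult_by_rat_equiv\<close> maps into itself.\<close>

lemma mult_push_class:
  assumes z: "z \<in> carrier (zero_cycles (carrier A))"
  shows "mult_push A n (CH0_class A z) = CH0_class A (push_cycle (mult_by n) z)"
proof -
  let ?N = "generate (zero_cycles (carrier A)) (rat_equiv_rels A)"
  have "CH0_class A (push_cycle (mult_by n) w) = CH0_class A (push_cycle (mult_by n) z)" if w: "w \<in> CH0_class A z" for w
  proof -
    obtain m where m: "m \<in> ?N" "w = m + z" using w unfolding CH0_eq quot_class_def r_coset_def by auto
    have m': "m \<in> carrier (zero_cycles (carrier A))" using m(1) Z.generate_incl[OF rat_equiv_rels_subset] by blast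
    have "CH0_class A (push_cycle (mult_by n) m) = \<one>\<^bsub>CH0 A\<^esub>"
      using Z.quot_class_eq_one_iff[OF rat_equiv_rels_subset push_cycle_mult_by_closed[OF m']]
        push_cycle_mult_by_rat_equiv[OF m(1)] unfolding CH0_eq by blast
    moreover have "CH0_class A (push_cycle (mult_by n) w) =
        CH0_class A (push_cycle (mult_by n) m) \<otimes>\<^bsub>CH0 A\<^esub> CH0_class A (push_cycle (mult_by n) z)"
      using CH_class.hom_mult[OF push_cycle_mult_by_closed[OF m'] push_cycle_mult_by_closed[OF z]]
      by (simp add: m(2) push_cycle_add)
    ultimately show ?thesis using CH_class.hom_closed[OF push_cycle_mult_by_closed[OF z]] by simp
  qed
  moreover have "z \<in> CH0_class A z"
    unfolding CH0_eq quot_class_def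
    using Z.rcos_self[OF z Z.generate_is_subgroup[OF rat_equiv_rels_subset]] .
  ultimately have "(\<lambda>w. CH0_class A (push_cycle (mult_by n) w)) ` CH0_class A z = {CH0_class A (push_cycle (mult_by n) z)}"
    by blast
  then show ?thesis unfolding mult_push_def by simp
qed

section \<open>The symmetric quotient\<close>

lemma K_sym_eq: "K_sym A r = quot_group (free_Abelian_group (symbols (replicate r A))) (somekawa_rels (replicate r A))"
  by (simp add: K_sym_def somekawa_K_def)

lemma comm_group_K_sym: "comm_group (K_sym A r)"
  unfolding K_sym_eq
  by (rule comm_group.comm_group_quot_group[OF abelian_free_Abelian_group somekawa_rels_subset])

lemma somekawa_class_hom:
  "somekawa_class (replicate r A) \<in> hom (free_Abelian_group (symbols (replicate r A))) (K_sym A r)"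
  unfolding K_sym_eq somekawa_class_def
  by (rule comm_group.quot_class_hom[OF abelian_free_Abelian_group somekawa_rels_subset])

lemma symmetry_rels_subset: "symmetry_rels A r \<subseteq> carrier (K_sym A r)"
proof
  interpret K: comm_group "K_sym A r" by (rule comm_group_K_sym)
  fix a assume "a \<in> symmetry_rels A r"
  then obtain L as \<pi> where *: "(L, as) \<in> symbols (replicate r A)" "\<pi> permutes {..<r}"
    "a = somekawa_class (replicate r A) (frag_of (L, permute_list \<pi> as))
        \<otimes>\<^bsub>K_sym A r\<^esub> inv\<^bsub>K_sym A r\<^esub> somekawa_class (replicate r A) (frag_of (L, as))"
    unfolding symmetry_rels_def by blast
  have "(L, permute_list \<pi> as) \<in> symbols (replicate r A)"
    using *(1,2) unfolding symbols_replicate by auto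
  then have "frag_of (L, permute_list \<pi> as) \<in> carrier (free_Abelian_group (symbols (replicate r A)))" by simp
  moreover have "frag_of (L, as) \<in> carrier (free_Abelian_group (symbols (replicate r A)))" using *(1) by simp
  ultimately show "a \<in> carrier (K_sym A r)"
    unfolding *(3) using hom_in_carrier[OF somekawa_class_hom] by blast
qed

lemma comm_group_S_sym: "comm_group (S_sym A r)"
  unfolding S_sym_def by (rule comm_group.comm_group_quot_group[OF comm_group_K_sym symmetry_rels_subset])

lemma S_class_hom: "S_class A r \<in> hom (free_Abelian_group (symbols (replicate r A))) (S_sym A r)"
proof -
  have "quot_class (K_sym A r) (symmetry_rels A r) \<circ> somekawa_class (replicate r A)
      \<in> hom (free_Abelian_group (symbols (replicate r A))) (S_sym A r)"
    unfolding S_sym_def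
    by (rule hom_compose[OF somekawa_class_hom comm_group.quot_class_hom[OF comm_group_K_sym symmetry_rels_subset]])
  then show ?thesis by (simp add: S_class_def[abs_def] comp_def)
qed

text \<open>Carries congruences of symbols, which live in the Somekawa group, over to its symmetric
  quotient.\<close>

lemma S_class_eq_one:
  assumes "a \<in> generate (free_Abelian_group (symbols (replicate r A))) (somekawa_rels (replicate r A))"
  shows "S_class A r a = \<one>\<^bsub>S_sym A r\<^esub>"
proof -
  interpret K: comm_group "K_sym A r" by (rule comm_group_K_sym)
  have "a \<in> carrier (free_Abelian_group (symbols (replicate r A)))"
    using generate_free_Abelian_group_keys[OF somekawa_rels_subset assms] by simp
  then have "somekawa_class (replicate r A) a = \<one>\<^bsub>K_sym A r\<^esub>"
    using comm_group.quot_class_eq_one_iff[OF abelian_free_Abelian_group somekawa_rels_subset] assms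
    unfolding K_sym_eq somekawa_class_def by blast
  then show ?thesis
    unfolding S_class_def S_sym_def
    using K.quot_class_eq_one_iff[OF symmetry_rels_subset K.one_closed] generate.one by auto
qed

text \<open>
  As \<open>\<Phi>\<^sub>j\<close> is given by its graph, its kernel is the image of \<open>Phi_zero j\<close> whether or not the graph is
  single-valued; the well-definedness of \<open>\<Phi>\<^sub>j\<close> plays no role below.
\<close>

definition Phi_zero :: "nat \<Rightarrow> 'k cycle set" where
  "Phi_zero j = {z \<in> carrier (zero_cycles (carrier A)).
     if j = 0 then cycle_degree z = 0 else S_class A j (symbol_cycle j z) = \<one>\<^bsub>S_sym A j\<^esub>}"

lemma ker_Phi_eq: "ker_Phi A j = CH0_class A ` Phi_zero j"
  unfolding ker_Phi_def Phi0_def Phi_def Phi_zero_def symbol_cycle_def by force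

lemma Phi_hom: "(\<lambda>z. S_class A j (symbol_cycle j z)) \<in> hom (zero_cycles (carrier A)) (S_sym A j)"
proof -
  have "symbol_cycle j \<in> hom (zero_cycles (carrier A)) (free_Abelian_group (symbols (replicate j A)))"
    using symbol_cycle_closed by (auto simp: hom_def carrier_zero_cycles symbol_cycle_def frag_extend_add)
  from hom_compose[OF this S_class_hom] show ?thesis by (simp add: comp_def)
qed

lemma subgroup_Phi_zero: "subgroup (Phi_zero j) (zero_cycles (carrier A))"
proof (cases "j = 0")
  case True
  show ?thesis
  proof (rule Z.subgroupI)
    show "inv\<^bsub>zero_cycles (carrier A)\<^esub> a \<in> Phi_zero j" if "a \<in> Phi_zero j" for a
      using that Z.inv_closed[of a] cycle_degree_diff[of 0 a] True by (auto simp: Phi_zero_def)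
    show "a \<otimes>\<^bsub>zero_cycles (carrier A)\<^esub> b \<in> Phi_zero j" if "a \<in> Phi_zero j" "b \<in> Phi_zero j" for a b
      using that Z.m_closed[of a b] cycle_degree_add[of a b] True by (auto simp: Phi_zero_def)
  qed (use True Z.one_closed in \<open>auto simp: Phi_zero_def\<close>)
next
  case False
  interpret S: comm_group "S_sym A j" by (rule comm_group_S_sym)
  interpret h: group_hom "zero_cycles (carrier A)" "S_sym A j" "\<lambda>z. S_class A j (symbol_cycle j z)"
    by unfold_locales (rule Phi_hom)
  have "Phi_zero j = kernel (zero_cycles (carrier A)) (S_sym A j) (\<lambda>z. S_class A j (symbol_cycle j z))"
    using False by (auto simp: Phi_zero_def kernel_def)
  then show ?thesis using h.subgroup_kernel by simp
qed

text \<open>This is \<open>\<Phi>\<^sub>j \<circ> n\<^sub>\<star> = n\<^sup>j \<Phi>\<^sub>j\<close> on the level of cycles.\<close>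

lemma push_minus_power_Phi_zero:
  assumes z: "z \<in> carrier (zero_cycles (carrier A))"
  shows "push_cycle (mult_by n) z - frag_cmul (int (n ^ j)) z \<in> Phi_zero j"
proof -
  note pz = push_cycle_mult_by_closed[OF z, of n]
  have nz: "frag_cmul (int (n ^ j)) z \<in> carrier (zero_cycles (carrier A))"
    using Z.nat_pow_closed[OF z, of "n ^ j"] by simp
  have car: "push_cycle (mult_by n) z - frag_cmul (int (n ^ j)) z \<in> carrier (zero_cycles (carrier A))"
    using pz nz unfolding carrier_zero_cycles by (rule keys_diff_subset)
  show ?thesis
  proof (cases "j = 0")
    case True
    then show ?thesis
      using car z cycle_degree_push_mult_by unfolding carrier_zero_cycles Phi_zero_def
      by (simp add: cycle_degree_diff)
  next
    case False
    have "symb_cong j (symbol_cycle j (push_cycle (mult_by n) z)) (frag_cmul (int (n ^ j)) (symbol_cycle j z))"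
      using z False unfolding carrier_zero_cycles by (intro symb_cong_push_mult_by) auto
    then have "symbol_cycle j (push_cycle (mult_by n) z - frag_cmul (int (n ^ j)) z)
        \<in> generate (free_Abelian_group (symbols (replicate j A))) (somekawa_rels (replicate j A))"
      unfolding frag_cong_def[OF somekawa_rels_subset] by (simp add: symbol_cycle_def frag_extend_diff frag_extend_cmul)
    from S_class_eq_one[OF this] show ?thesis using car False by (simp add: Phi_zero_def)
  qed
qed

text \<open>The push-forward is its difference from \<open>n ^ j\<close> times the cycle plus that
  multiple, and both lie in \<open>Phi_zero j\<close>. So stability of the kernels follows from the
  multiplication formula.\<close>

lemma push_Phi_zero:
  assumes "z \<in> Phi_zero j"
  shows "push_cycle (mult_by n) z \<in> Phi_zero j"
proof -
  have z: "z \<in> carrier (zero_cycles (carrier A))" using assms by (simp add: Phi_zero_def)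
  have "frag_cmul (int (n ^ j)) z \<in> Phi_zero j"
    using Z.subgroup_nat_pow_closed[OF subgroup_Phi_zero assms, of "n ^ j"] by simp
  from subgroup.m_closed[OF subgroup_Phi_zero push_minus_power_Phi_zero[OF z, of n] this] show ?thesis by simp
qed

section \<open>The filtration\<close>

lemma subgroup_ker_Phi: "subgroup (ker_Phi A j) (CH0 A)"
  unfolding ker_Phi_eq by (rule CH_class.subgroup_img_is_subgroup[OF subgroup_Phi_zero])

lemma F_filt_0: "F_filt A 0 = carrier (CH0 A)"
  by (simp add: F_filt_def)

lemma F_filt_Suc: "F_filt A (Suc r) = F_filt A r \<inter> ker_Phi A r"
  unfolding F_filt_def by (auto simp: less_Suc_eq)

lemma subgroup_F_filt: "subgroup (F_filt A r) (CH0 A)"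
  by (induction r) (auto simp: F_filt_0 F_filt_Suc CH.subgroup_self intro: CH.subgroups_Inter_pair subgroup_ker_Phi)

lemma mult_push_ker_Phi: "c \<in> ker_Phi A j \<Longrightarrow> mult_push A n c \<in> ker_Phi A j"
  unfolding ker_Phi_eq using push_Phi_zero mult_push_class by (force simp: Phi_zero_def)

lemma mult_push_closed: "c \<in> carrier (CH0 A) \<Longrightarrow> mult_push A n c \<in> carrier (CH0 A)"
  using CH0_class_surj mult_push_class push_cycle_mult_by_closed CH_class.hom_closed by metis

lemma mult_push_F_filt: "c \<in> F_filt A r \<Longrightarrow> mult_push A n c \<in> F_filt A r"
  by (induction r) (auto simp: F_filt_0 F_filt_Suc mult_push_closed mult_push_ker_Phi)

text \<open>\<open>F_filt A (Suc r)\<close> is \<open>F_filt A r\<close> cut by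
  \<open>ker_Phi A r\<close>. Stability of the filtration gives the first membership; for the
  second, a cycle \<open>z\<close> representing \<open>c\<close> is used. \<open>CH0 A\<close> is
  written multiplicatively, so the power stands for the multiple by \<open>n ^ r\<close>.\<close>

lemma mult_push_minus_power:
  assumes c: "c \<in> F_filt A r"
  shows "mult_push A n c \<otimes>\<^bsub>CH0 A\<^esub> inv\<^bsub>CH0 A\<^esub> (c [^]\<^bsub>CH0 A\<^esub> (n ^ r)) \<in> F_filt A (Suc r)"
proof -
  note F = subgroup_F_filt[of r]
  have "mult_push A n c \<otimes>\<^bsub>CH0 A\<^esub> inv\<^bsub>CH0 A\<^esub> (c [^]\<^bsub>CH0 A\<^esub> (n ^ r)) \<in> F_filt A r"
    by (intro subgroup.m_closed[OF F] subgroup.m_inv_closed[OF F] mult_push_F_filt c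
        CH.subgroup_nat_pow_closed[OF F])
  moreover have "c \<in> carrier (CH0 A)" using c subgroup.subset[OF F] by blast
  then obtain z where z: "z \<in> carrier (zero_cycles (carrier A))" "c = CH0_class A z" by (rule CH0_class_surj)
  define w where "w = frag_cmul (int (n ^ r)) z"
  have w: "w \<in> carrier (zero_cycles (carrier A))"
    using Z.nat_pow_closed[OF z(1), of "n ^ r"] by (simp add: w_def)
  have "c [^]\<^bsub>CH0 A\<^esub> (n ^ r) = CH0_class A w"
    using CH_class.hom_nat_pow[OF z(1), of "n ^ r"] z(2) by (simp add: w_def)
  then have "mult_push A n c \<otimes>\<^bsub>CH0 A\<^esub> inv\<^bsub>CH0 A\<^esub> (c [^]\<^bsub>CH0 A\<^esub> (n ^ r)) =
      CH0_class A (push_cycle (mult_by n) z - w)"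
    using CH_class.hom_mult[OF push_cycle_mult_by_closed[OF z(1), of n] Z.inv_closed[OF w]] CH_class.hom_inv[OF w]
      mult_push_class[OF z(1), of n] z(2) w by simp
  then have "mult_push A n c \<otimes>\<^bsub>CH0 A\<^esub> inv\<^bsub>CH0 A\<^esub> (c [^]\<^bsub>CH0 A\<^esub> (n ^ r)) \<in> ker_Phi A r"
    unfolding ker_Phi_eq w_def using push_minus_power_Phi_zero[OF z(1)] by blast
  ultimately show ?thesis unfolding F_filt_Suc by blast
qed

lemma gr_mult_push_eq_power:
  assumes V: "V \<in> carrier (gr_group A r)"
  shows "gr_mult_push A n r V = V [^]\<^bsub>gr_group A r\<^esub> (n ^ r)"
proof -
  define G where "G = (CH0 A)\<lparr>carrier := F_filt A r\<rparr>"
  let ?F = "F_filt A (Suc r)"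
  have sub: "?F \<subseteq> F_filt A r" by (auto simp: F_filt_Suc)
  interpret G: comm_group G unfolding G_def by (rule CH.subgroup_comm_group[OF subgroup_F_filt])
  have FG: "subgroup ?F G"
    unfolding G_def by (rule CH.subgroup_incl[OF subgroup_F_filt subgroup_F_filt sub])
  have normal: "?F \<lhd> G" by (rule G.normal_iff_subgroup[THEN iffD2, OF FG])
  interpret h: group_hom G "G Mod ?F" "\<lambda>c. ?F #>\<^bsub>G\<^esub> c"
    unfolding group_hom_def group_hom_axioms_def
    using normal.r_coset_hom_Mod[OF normal] normal.factorgroup_is_group[OF normal] G.is_group by blast
  \<comment> \<open>Shrinking the carrier leaves the operation unchanged, so cosets in the graded
    piece can be computed in \<open>CH0 A\<close>.\<close>
  have coset: "?F #>\<^bsub>G\<^esub> c = ?F #>\<^bsub>CH0 A\<^esub> c" for c unfolding G_def by simp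
  have gr: "gr_group A r = G Mod ?F" by (simp add: gr_group_def G_def)
  obtain c where c: "c \<in> carrier G" "V = ?F #>\<^bsub>G\<^esub> c"
    using V unfolding gr by (auto simp: FactGroup_def RCOSETS_def)
  \<comment> \<open>\<open>gr_mult_push\<close> takes the single element of an image over the whole
    coset, so the formula is proved for every member \<open>d\<close> of \<open>V\<close>, with
    \<open>V\<close> rewritten as the coset of \<open>d\<close>.\<close>
  have power_eq: "?F #>\<^bsub>CH0 A\<^esub> mult_push A n d = V [^]\<^bsub>gr_group A r\<^esub> (n ^ r)" if d: "d \<in> V" for d
  proof -
    have dG: "d \<in> carrier G" using d c G.r_coset_subset_G[OF subgroup.subset[OF FG] c(1)] by blast
    have V_eq: "V = ?F #>\<^bsub>G\<^esub> d" using d c G.repr_independence[OF _ c(1) FG] by simp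
    have dF: "d \<in> F_filt A r" using dG by (simp add: G_def)
    have dC: "d \<in> carrier (CH0 A)" using dF subgroup.subset[OF subgroup_F_filt] by blast
    note rem = mult_push_minus_power[OF dF, of n]
    have "?F #>\<^bsub>CH0 A\<^esub> (mult_push A n d \<otimes>\<^bsub>CH0 A\<^esub> inv\<^bsub>CH0 A\<^esub> (d [^]\<^bsub>CH0 A\<^esub> (n ^ r))) = ?F"
      using rem subgroup.subset[OF subgroup_F_filt] by (intro CH.coset_join2[OF _ subgroup_F_filt]) auto
    then have "?F #>\<^bsub>CH0 A\<^esub> mult_push A n d = ?F #>\<^bsub>CH0 A\<^esub> (d [^]\<^bsub>CH0 A\<^esub> (n ^ r))"
      using dC mult_push_closed subgroup.subset[OF subgroup_F_filt] by (intro CH.coset_mult_inv1) auto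
    also have "\<dots> = ?F #>\<^bsub>G\<^esub> (d [^]\<^bsub>G\<^esub> (n ^ r))"
      unfolding coset by (simp add: G_def nat_pow_def)
    also have "\<dots> = V [^]\<^bsub>gr_group A r\<^esub> (n ^ r)"
      unfolding gr V_eq by (rule h.hom_nat_pow[OF dG])
    finally show ?thesis .
  qed
  moreover have "c \<in> V" unfolding c(2) by (rule G.rcos_self[OF c(1) FG])
  ultimately have "(\<lambda>d. ?F #>\<^bsub>CH0 A\<^esub> mult_push A n d) ` V = {V [^]\<^bsub>gr_group A r\<^esub> (n ^ r)}" by blast
  then show ?thesis unfolding gr_mult_push_def by simp
qed

end

theorem corollary1p2:
  fixes A :: "'k::field abvar" and n r :: nat
  assumes "perfect_field TYPE('k)"
    and "abelian_variety A"
    and "n \<ge> 1"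
  shows "\<forall>V \<in> carrier (gr_group A r). gr_mult_push A n r V = V [^]\<^bsub>gr_group A r\<^esub> (n ^ r)"
proof -
  interpret abelian_var A using assms by unfold_locales
  show ?thesis using gr_mult_push_eq_power by blast
qed

end
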